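(* Let $p_0$ be an odd prime, $p$ a power of $p_0$, $q$ a power of $p$, and write $q = p^n = p_0^{f_0}$. Let $R(x) = \sum_{i=0}^e a_i x^{p^i} \in \mathbb{F}_q[x]$ with $e \geq 1$, $a_e \neq 0$, and let $A \subset H_R$ be a maximal abelian subgroup with $A \subset \mathbb{F}_q^2$. Suppose Condition $(\ast)$ holds for $R$ and $A$. Let $\overline{C}_R$ be the smooth projective compactification over $\mathbb{F}_q$ of $y^p - y = xR(x)$. (1) If $n$ is even and $p_0 \equiv 1 \pmod 4$: $\overline{C}_R$ is $\mathbb{F}_q$-maximal if $\left(\frac{a_e}{q}\right) = -1$, and $\mathbb{F}_q$-minimal if $\left(\frac{a_e}{q}\right) = 1$. (2) If $n$ is even and $p_0 \equiv 3 \pmod 4$: $\overline{C}_R$ is $\mathbb{F}_q$-maximal if $\left(\frac{a_e}{q}\right) = -(-1)^{f_0/2}$, and $\mathbb{F}_q$-minimal if $\left(\frac{a_e}{q}\right) = (-1)^{f_0/2}$. (3) If $n$ is odd, $\overline{C}_R$ is neither $\mathbb{F}_q$-maximal nor $\mathbb{F}_q$-minimal.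
   Context: $\mathbb{F}$ is an algebraic closure of $\mathbb{F}_{p_0}$; $\mathrm{Tr}_{q/p}$ denotes the trace $\mathbb{F}_q \to \mathbb{F}_p$; for $x \in \mathbb{F}_q^\times$, $\left(\frac{x}{q}\right) := x^{(q-1)/2} \in \{\pm1\}$. Define $E_R(x) = R(x)^{p^e} + \sum_{i=0}^e (a_i x)^{p^{e-i}}$, $V_R = \{x \in \mathbb{F} : E_R(x) = 0\}$, $f_R(x,y) = -\sum_{i=0}^{e-1}\left(\sum_{j=0}^{e-i-1}(a_i x^{p^i} y)^{p^j} + (xR(y))^{p^i}\right)$, and the Heisenberg group $H_R = \{(\alpha,\beta) \in \mathbb{F}^2 : \alpha \in V_R,\ \beta^p - \beta = \alpha R(\alpha)\}$ with law $(\alpha,\beta)(\alpha',\beta') = (\alpha+\alpha', \beta+\beta'+f_R(\alpha,\alpha'))$. For a maximal abelian subgroup $A$, let $\overline{A} \subset V_R$ be its image under $(\alpha,\beta) \mapsto \alpha$ (an $e$-dimensional $\mathbb{F}_p$-space, contained in $\mathbb{F}_q$ when $A \subset \mathbb{F}_q^2$). Let $F_A(x) = \prod_{\alpha \in \overline{A}}(x - \alpha) = \sum_{i=0}^e b_i x^{p^i}$ (monic, $\mathbb{F}_p$-linearized, $b_0 \neq 0$), let $c_A = (-1)^e a_e/(2b_0)$, and let $a(x) \in \mathbb{F}_q[x]$ be the unique $\mathbb{F}_p$-linearized polynomial with $F_A(a(x)) = x^q - x$; its root set $\mathrm{Ker}\, a \subset \mathbb{F}_q$. Condition $(\ast)$: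 for every $\lambda \in \mathbb{F}_q$ such that $\mathrm{Tr}_{q/p}(\lambda t) = 0$ for all $t \in \mathrm{Ker}\, a$, one has $\mathrm{Tr}_{q/p}(c_A^{-1}\lambda^2) = 0$. $\overline{C}_R$ has genus $g = p^e(p-1)/2$; it is $\mathbb{F}_q$-maximal (resp. minimal) if $|\overline{C}_R(\mathbb{F}_q)| = q+1+2gq^{1/2}$ (resp. $q+1-2gq^{1/2}$). *)

theory Defs
  imports
    Complex_Main
    "HOL-Computational_Algebra.Computational_Algebra"
    "HOL-Algebra.Algebraic_Closure_Type"
    "HOL-Algebra.Generated_Fields"
begin

text \<open>
  The class \<^class>\<open>alg_closed_field\<close> provides algebraic closedness; the predicate below adds
  that the type is algebraic over its prime field \<open>range of_nat\<close>, which has \<open>p0\<close> elements.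
\<close>

definition algebraic_closure_of_prime_field :: "'a::alg_closed_field itself \<Rightarrow> nat \<Rightarrow> bool" where
  "algebraic_closure_of_prime_field _ p0 \<longleftrightarrow>
     CHAR('a) = p0 \<and>
     (\<forall>x::'a. \<exists>h::'a poly. h \<noteq> 0 \<and> (\<forall>k. coeff h k \<in> range of_nat) \<and> poly h x = 0)"

definition Fq :: "nat \<Rightarrow> 'a::field set" where
  "Fq q = {x. x ^ q = x}"

text \<open>The trace from the field with \<open>p ^ n\<close> elements to the field with \<open>p\<close> elements.\<close>

definition trace_Fq :: "nat \<Rightarrow> nat \<Rightarrow> 'a::field \<Rightarrow> 'a" where
  "trace_Fq p n x = (\<Sum>i<n. x ^ (p ^ i))"

text \<open>The quadratic symbol, as the element \<open>1\<close> or \<open>-1\<close> of the field (for \<open>x \<noteq> 0\<close> in \<open>Fq q\<close>).\<close>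

definition quad_symbol :: "'a::field \<Rightarrow> nat \<Rightarrow> 'a" where
  "quad_symbol x q = x ^ ((q - 1) div 2)"

text \<open>
  Throughout, \<open>R\<close> is given by \<open>p\<close>, \<open>e\<close> and its coefficients \<open>a 0, \<dots>, a e\<close>; the values of \<open>a\<close> beyond
  \<open>e\<close> play no role.
\<close>

definition R_fun :: "nat \<Rightarrow> nat \<Rightarrow> (nat \<Rightarrow> 'a::field) \<Rightarrow> 'a \<Rightarrow> 'a" where
  "R_fun p e a x = (\<Sum>i\<le>e. a i * x ^ (p ^ i))"

definition E_fun :: "nat \<Rightarrow> nat \<Rightarrow> (nat \<Rightarrow> 'a::field) \<Rightarrow> 'a \<Rightarrow> 'a" where
  "E_fun p e a x = R_fun p e a x ^ (p ^ e) + (\<Sum>i\<le>e. (a i * x) ^ (p ^ (e - i)))"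

definition V_set :: "nat \<Rightarrow> nat \<Rightarrow> (nat \<Rightarrow> 'a::field) \<Rightarrow> 'a set" where
  "V_set p e a = {x. E_fun p e a x = 0}"

definition f_fun :: "nat \<Rightarrow> nat \<Rightarrow> (nat \<Rightarrow> 'a::field) \<Rightarrow> 'a \<Rightarrow> 'a \<Rightarrow> 'a" where
  "f_fun p e a x y =
     - (\<Sum>i<e. (\<Sum>j<e - i. (a i * x ^ (p ^ i) * y) ^ (p ^ j)) + (x * R_fun p e a y) ^ (p ^ i))"

definition Heisenberg :: "nat \<Rightarrow> nat \<Rightarrow> (nat \<Rightarrow> 'a::field) \<Rightarrow> ('a \<times> 'a) monoid" where
  "Heisenberg p e a =
     \<lparr> carrier = {(\<alpha>, \<beta>). \<alpha> \<in> V_set p e a \<and> \<beta> ^ p - \<beta> = \<alpha> * R_fun p e a \<alpha>},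
       monoid.mult = (\<lambda>(\<alpha>, \<beta>) (\<alpha>', \<beta>'). (\<alpha> + \<alpha>', \<beta> + \<beta>' + f_fun p e a \<alpha> \<alpha>')),
       monoid.one = (0, 0) \<rparr>"

definition abelian_subgroup :: "'g set \<Rightarrow> 'g monoid \<Rightarrow> bool" where
  "abelian_subgroup A G \<longleftrightarrow> subgroup A G \<and> (\<forall>x\<in>A. \<forall>y\<in>A. x \<otimes>\<^bsub>G\<^esub> y = y \<otimes>\<^bsub>G\<^esub> x)"

definition maximal_abelian_subgroup :: "'g set \<Rightarrow> 'g monoid \<Rightarrow> bool" where
  "maximal_abelian_subgroup A G \<longleftrightarrow>
     abelian_subgroup A G \<and> (\<forall>B. abelian_subgroup B G \<and> A \<subseteq> B \<longrightarrow> B = A)"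

definition F_poly :: "('a::field \<times> 'a) set \<Rightarrow> 'a poly" where
  "F_poly A = (\<Prod>\<alpha>\<in>fst ` A. [:- \<alpha>, 1:])"

text \<open>\<open>coeff (F_poly A) 1\<close> is \<open>b\<^sub>0\<close>, the coefficient of \<open>x ^ (p ^ 0)\<close> in the linearized polynomial.\<close>

definition c_const :: "nat \<Rightarrow> (nat \<Rightarrow> 'a::field) \<Rightarrow> ('a \<times> 'a) set \<Rightarrow> 'a" where
  "c_const e a A = (-1) ^ e * a e / (2 * coeff (F_poly A) 1)"

definition linearized :: "nat \<Rightarrow> 'a::field poly \<Rightarrow> bool" where
  "linearized p h \<longleftrightarrow> (\<forall>k. coeff h k \<noteq> 0 \<longrightarrow> (\<exists>i. k = p ^ i))"

definition a_poly :: "nat \<Rightarrow> nat \<Rightarrow> ('a::field \<times> 'a) set \<Rightarrow> 'a poly" where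
  "a_poly p q A = (THE h. linearized p h \<and> (\<forall>k. coeff h k \<in> Fq q) \<and>
                     pcompose (F_poly A) h = monom 1 q - [:0, 1:])"

definition condition_star :: "nat \<Rightarrow> nat \<Rightarrow> nat \<Rightarrow> (nat \<Rightarrow> 'a::field) \<Rightarrow> ('a \<times> 'a) set \<Rightarrow> bool" where
  "condition_star p n e a A \<longleftrightarrow>
     (\<forall>l \<in> Fq (p ^ n).
        (\<forall>t. poly (a_poly p (p ^ n) A) t = 0 \<longrightarrow> trace_Fq p n (l * t) = 0) \<longrightarrow>
        trace_Fq p n (inverse (c_const e a A) * l ^ 2) = 0)"

text \<open>
  The smooth projective compactification over \<open>Fq q\<close> of the affine curve \<open>y ^ p - y = x R(x)\<close> is the
  smooth projective curve with the same function field \<open>K = Fq q (x, y)\<close>.  Its closed points are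
  the places of \<open>K\<close> over \<open>Fq q\<close>, given by their valuation rings, and its \<open>Fq q\<close>-rational points are
  the places with residue field \<open>Fq q\<close>.

  The function field is realised inside an algebraic closure of the rational function field
  \<open>F(x)\<close> over the ambient field \<open>F\<close>.  The equation for \<open>y\<close> is irreducible over \<open>Fq q (x)\<close> when
  \<open>e \<ge> 1\<close> and \<open>a e \<noteq> 0\<close>, and two roots differ by an element of \<open>Fq p\<close>, so neither the choice of
  \<open>y\<close> nor that of the closure matters.
\<close>

type_synonym 'a ff_closure = "'a poly fract alg_closure"

definition ff_const :: "'a::field \<Rightarrow> 'a ff_closure" where
  "ff_const c = to_ac (Fract [:c:] 1)"

definition ff_x :: "'a::field ff_closure" where
  "ff_x = to_ac (Fract [:0, 1:] 1)"

definition ff_y :: "nat \<Rightarrow> nat \<Rightarrow> (nat \<Rightarrow> 'a::field) \<Rightarrow> 'a ff_closure" where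
  "ff_y p e a = (SOME y. y ^ p - y = ff_x * R_fun p e (\<lambda>i. ff_const (a i)) ff_x)"

definition function_field :: "nat \<Rightarrow> nat \<Rightarrow> nat \<Rightarrow> (nat \<Rightarrow> 'a::field) \<Rightarrow> 'a ff_closure set" where
  "function_field q p e a =
     generate_field ring_of_type_algebra (ff_const ` Fq q \<union> {ff_x, ff_y p e a})"

text \<open>Valuation rings of a function field \<open>K\<close> over \<open>k\<close>, both being subfields of the type.\<close>

definition valuation_rings :: "'b::field set \<Rightarrow> 'b set \<Rightarrow> 'b set set" where
  "valuation_rings k K =
     {V. subring V ring_of_type_algebra \<and> k \<subset> V \<and> V \<subset> K \<and> (\<forall>u\<in>K. u \<in> V \<or> inverse u \<in> V)}"

definition max_ideal :: "'b::field set \<Rightarrow> 'b set" where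
  "max_ideal V = {u \<in> V. u = 0 \<or> inverse u \<notin> V}"

text \<open>The condition says that \<open>k \<rightarrow> V / max_ideal V\<close> is onto, i.e. that the place has degree one.\<close>

definition rational_places :: "'b::field set \<Rightarrow> 'b set \<Rightarrow> 'b set set" where
  "rational_places k K =
     {V \<in> valuation_rings k K. \<forall>u\<in>V. \<exists>c\<in>k. u - c \<in> max_ideal V}"

definition curve_points :: "nat \<Rightarrow> nat \<Rightarrow> nat \<Rightarrow> (nat \<Rightarrow> 'a::field) \<Rightarrow> 'a ff_closure set set" where
  "curve_points q p e a = rational_places (ff_const ` Fq q) (function_field q p e a)"

text \<open>The genus of this compactification, entered by its known closed formula.\<close>

definition curve_genus :: "nat \<Rightarrow> nat \<Rightarrow> real" where
  "curve_genus p e = real p ^ e * (real p - 1) / 2"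

definition curve_maximal :: "nat \<Rightarrow> nat \<Rightarrow> nat \<Rightarrow> (nat \<Rightarrow> 'a::field) \<Rightarrow> bool" where
  "curve_maximal q p e a \<longleftrightarrow>
     real (card (curve_points q p e a)) = real q + 1 + 2 * curve_genus p e * sqrt (real q)"

definition curve_minimal :: "nat \<Rightarrow> nat \<Rightarrow> nat \<Rightarrow> (nat \<Rightarrow> 'a::field) \<Rightarrow> bool" where
  "curve_minimal q p e a \<longleftrightarrow>
     real (card (curve_points q p e a)) = real q + 1 - 2 * curve_genus p e * sqrt (real q)"

end

theory Submission
  imports Defs
begin

text \<open>
  The function field has one rational place at infinity, and its other rational places correspond to
  the affine points, so the number of rational points is \<open>1 + p M\<close>, where \<open>M\<close> counts the \<open>x\<close> with
  \<open>Tr (x R(x)) = 0\<close>.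

  The image \<open>W\<close> of a maximal abelian subgroup is its own orthogonal complement in \<open>V\<^sub>R\<close> for the
  commutator pairing.  Hence \<open>E\<^sub>R\<close> factors through \<open>F = F\<^sub>A\<close>, and \<open>Tr (x R(x))\<close> equals
  \<open>Tr (c F(x)\<^sup>2)\<close> up to sign, where \<open>c = c\<^sub>A\<close>.  As \<open>x\<close> runs through \<open>Fq q\<close>, \<open>F(x)\<close> runs through
  the kernel of \<open>a(x)\<close>, each value being taken \<open>p ^ e\<close> times.  Condition \<open>(\<ast>)\<close> says that the
  orthogonal complement of this kernel for the form \<open>Tr (c z\<^sup>2)\<close> is totally isotropic.  So the
  zeros of the form on the kernel can be counted through its zeros on \<open>Fq q\<close>, whose number depends
  only on whether \<open>c\<close> is a square.  Finally \<open>c\<close> is \<open>a\<^sub>e / 2\<close> up to a square, because \<open>b\<^sub>0\<close> is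
  \<open>(-1) ^ e\<close> times a square.
\<close>

section \<open>Valuation rings\<close>

text \<open>The curve is given by valuation rings alone, with no value group and no irreducibility
  known in advance. One observation supplies both: at infinity \<open>x\<close> and \<open>y\<close>
  have pole orders \<open>p\<close> and \<open>p ^ e + 1\<close>, which are coprime, so the nonzero
  terms of a polynomial of \<open>y\<close>-degree below \<open>p\<close> have distinct pole orders.
  Irreducibility of the equation, and uniqueness and rationality of the infinite place, all follow.
  Dimension formulas are replaced by comparing cardinalities, and Gauss sums by two devices. For odd
  \<open>n\<close>, multiplying \<open>c\<close> by a nonsquare of \<open>Fq p\<close> changes its
  square class but not the zeros of the form. For \<open>n = 2 * h\<close> and
  \<open>s = p ^ h\<close>, one explicit form vanishes on all of \<open>Fq s\<close>, and its
  coefficient has symbol \<open>(-1) ^ ((s + 1) div 2)\<close>: this is where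
  \<open>p0 mod 4\<close> and \<open>f0 div 2\<close> enter. The number of zeros times
  \<open>p\<close> is \<open>q\<close> for odd \<open>n\<close>, and \<open>q\<close> plus or minus
  \<open>(p - 1) * s\<close> for even \<open>n\<close>; multiplying the deviation by
  \<open>p ^ e\<close> turns it into twice the genus times the square root of
  \<open>q\<close>.\<close>

definition subring_set :: "'b::comm_ring_1 set \<Rightarrow> bool" where
  "subring_set S \<longleftrightarrow> 1 \<in> S \<and> (\<forall>u\<in>S. \<forall>v\<in>S. u - v \<in> S \<and> u * v \<in> S)"

definition poly_over :: "'b::comm_ring_1 set \<Rightarrow> 'b poly set" where
  "poly_over S = {f. \<forall>i. coeff f i \<in> S}"

lemma subring_set_one: "subring_set S \<Longrightarrow> 1 \<in> S"
  and subring_set_diff: "subring_set S \<Longrightarrow> u \<in> S \<Longrightarrow> v \<in> S \<Longrightarrow> u - v \<in> S"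
  and subring_set_mult: "subring_set S \<Longrightarrow> u \<in> S \<Longrightarrow> v \<in> S \<Longrightarrow> u * v \<in> S"
  by (auto simp: subring_set_def)

lemma subring_set_zero: "subring_set S \<Longrightarrow> 0 \<in> S"
  using subring_set_diff[of S 1 1] subring_set_one[of S] by simp

lemma subring_set_uminus: "subring_set S \<Longrightarrow> u \<in> S \<Longrightarrow> - u \<in> S"
  using subring_set_diff[of S 0 u] subring_set_zero[of S] by simp

lemma subring_set_add:
  "subring_set S \<Longrightarrow> u \<in> S \<Longrightarrow> v \<in> S \<Longrightarrow> u + v \<in> S"
  using subring_set_diff[of S u "- v"] subring_set_uminus[of S v] by simp

lemma subring_set_power: "subring_set S \<Longrightarrow> u \<in> S \<Longrightarrow> u ^ n \<in> S"
  by (induction n) (auto intro: subring_set_one subring_set_mult)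

lemma subring_set_sum:
  "subring_set S \<Longrightarrow> (\<And>i. i \<in> I \<Longrightarrow> g i \<in> S) \<Longrightarrow>
    sum g I \<in> S"
  by (induction I rule: infinite_finite_induct) (auto intro: subring_set_zero subring_set_add)

lemmas subring_set_intros = subring_set_zero subring_set_one subring_set_uminus subring_set_diff
  subring_set_add subring_set_mult subring_set_power subring_set_sum

text \<open>The places are defined through the record-based \<open>subring\<close>. The one point to
  settle is that the additive inverse of the record is the minus of the type.\<close>

lemma subring_set_iff_subring:
  "subring S (ring_of_type_algebra :: 'b ring) \<longleftrightarrow> subring_set (S :: 'b::comm_ring_1 set)"
proof
  interpret ring "ring_of_type_algebra :: 'b ring" by (rule ring_from_type_algebra)
  have neg: "\<ominus>\<^bsub>ring_of_type_algebra\<^esub> u = - u" for u :: 'b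
    by (rule minus_equality) (auto simp: ring_of_type_algebra_def)
  show "subring_set S" if S: "subring S (ring_of_type_algebra :: 'b ring)"
    using subringE[OF S] unfolding subring_set_def
    by (auto simp: ring_of_type_algebra_def neg[unfolded ring_of_type_algebra_def]
        diff_conv_add_uminus simp del: add_uminus_conv_diff)
  show "subring S (ring_of_type_algebra :: 'b ring)" if S: "subring_set S"
    by (rule subringI)
      (use S in \<open>auto simp: neg, auto simp: ring_of_type_algebra_def intro: subring_set_intros\<close>)
qed

lemma poly_over_coeff: "f \<in> poly_over S \<Longrightarrow> coeff f i \<in> S"
  by (simp add: poly_over_def)

lemma pCons_in_poly_over:
  "pCons c f \<in> poly_over S \<longleftrightarrow> c \<in> S \<and> f \<in> poly_over S"
  by (auto simp: poly_over_def coeff_pCons split: nat.splits)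

lemma subring_set_poly_over:
  assumes S: "subring_set S"
  shows "subring_set (poly_over S)"
  unfolding subring_set_def
proof (intro conjI ballI)
  show "1 \<in> poly_over S"
    using S by (auto simp: poly_over_def subring_set_zero subring_set_one)
  fix f g assume "f \<in> poly_over S" "g \<in> poly_over S"
  then show "f - g \<in> poly_over S" "f * g \<in> poly_over S"
    using S by (auto simp: poly_over_def coeff_mult intro!: subring_set_intros)
qed

lemma zero_in_poly_over: "subring_set S \<Longrightarrow> 0 \<in> poly_over S"
  by (simp add: poly_over_def subring_set_zero)

lemma monom_in_poly_over:
  "subring_set S \<Longrightarrow> c \<in> S \<Longrightarrow> monom c n \<in> poly_over S"
  by (auto simp: poly_over_def intro: subring_set_zero)

lemma poly_in_subring_set:
  "subring_set S \<Longrightarrow> f \<in> poly_over S \<Longrightarrow> u \<in> S \<Longrightarrow> poly f u \<in> S"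
  by (auto simp: poly_altdef intro!: subring_set_intros poly_over_coeff)

lemma smult_in_poly_over:
  "subring_set S \<Longrightarrow> c \<in> S \<Longrightarrow> f \<in> poly_over S \<Longrightarrow>
    smult c f \<in> poly_over S"
  by (auto simp: poly_over_def intro!: subring_set_mult)

text \<open>The divisor is monic, so no inverses occur and the quotient stays over \<open>S\<close>.
  Besides rings of elements, \<open>S\<close> will also be a polynomial ring in \<open>x\<close>,
  with \<open>c\<close> a value for \<open>y\<close>.\<close>

lemma linear_division:
  fixes f :: "'b::comm_ring_1 poly"
  assumes S: "subring_set S" and "f \<in> poly_over S" and c: "c \<in> S"
  shows "\<exists>g\<in>poly_over S. f = [:poly f c:] + [:- c, 1:] * g"
  using assms(2)
proof (induction f)
  case 0
  then show ?case using zero_in_poly_over[OF S] by (intro bexI[of _ 0]) auto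
next
  case (pCons d f)
  then have f: "f \<in> poly_over S" and d: "d \<in> S" by (auto simp: pCons_in_poly_over)
  from pCons.IH[OF f] obtain g where g: "g \<in> poly_over S" "f = [:poly f c:] + [:- c, 1:] * g" by blast
  have "pCons d f = [:d:] + [:0, 1:] * f" by simp
  also have "\<dots> = [:poly (pCons d f) c:] + [:- c, 1:] * ([:poly f c:] + [:0, 1:] * g)"
    by (subst g(2)) (simp add: algebra_simps)
  finally show ?case
    using g(1) poly_in_subring_set[OF S f c] subring_set_zero[OF S] zero_in_poly_over[OF S]
    by (intro bexI[of _ "[:poly f c:] + [:0, 1:] * g"])
      (auto simp: pCons_in_poly_over intro!: subring_set_add[OF subring_set_poly_over[OF S]])
qed

text \<open>Powers of the leading coefficient of \<open>g\<close> stand in for division by it. For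
  monic \<open>g\<close> they are 1, which gives reduction modulo the equation of the curve; the
  general case drives the Euclidean descent in \<open>norm_reduced\<close>.\<close>

lemma pseudo_division:
  fixes f g :: "'b::idom poly"
  assumes S: "subring_set S" and "f \<in> poly_over S" and g: "g \<in> poly_over S" "g \<noteq> 0"
  shows "\<exists>N. \<exists>Q\<in>poly_over S. \<exists>R\<in>poly_over S.
    smult (lead_coeff g ^ N) f = g * Q + R \<and> (R = 0 \<or> degree R < degree g)"
  using assms(2)
proof (induction "degree f" arbitrary: f rule: less_induct)
  case less
  note SP = subring_set_poly_over[OF S]
  show ?case
  proof (cases "f = 0 \<or> degree f < degree g")
    case True
    then show ?thesis using less.prems zero_in_poly_over[OF S]
      by (intro exI[of _ 0] bexI[of _ 0] bexI[of _ f]) auto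
  next
    case False
    define l where "l = lead_coeff g"
    have l0: "l \<noteq> 0" using g(2) by (simp add: l_def)
    have lS: "l \<in> S" using g(1) by (simp add: l_def poly_over_coeff)
    define M where "M = monom (lead_coeff f) (degree f - degree g)"
    have M: "M \<in> poly_over S" unfolding M_def
      by (rule monom_in_poly_over[OF S]) (use less.prems in \<open>simp add: poly_over_coeff\<close>)
    define h where "h = smult l f - g * M"
    have h: "h \<in> poly_over S" unfolding h_def
      by (intro subring_set_diff[OF SP] subring_set_mult[OF SP] smult_in_poly_over S lS less.prems g M)
    have hd: "h = 0 \<or> degree h < degree f"
    proof (cases "degree f = 0")
      \<comment> \<open>With \<open>f\<close> and \<open>g\<close> both constant the degree cannot
        drop, but then \<open>h\<close> is zero.\<close>
      case True
      then obtain fc where fc: "f = [:fc:]" by (elim degree_eq_zeroE)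
      moreover from True False have "degree g = 0" by simp
      then obtain gc where "g = [:gc:]" by (elim degree_eq_zeroE)
      ultimately show ?thesis by (simp add: h_def l_def M_def monom_0)
    next
      case f0: False
      have dM: "degree (g * M) = degree f"
        using False g(2) by (subst degree_mult_eq) (auto simp: M_def degree_monom_eq)
      have lc: "coeff (g * M) (degree f) = l * lead_coeff f"
      proof -
        have "coeff (g * M) (degree f) = lead_coeff (g * M)" by (simp add: dM)
        also have "\<dots> = l * lead_coeff f"
          using False by (simp only: lead_coeff_mult) (simp add: l_def M_def degree_monom_eq)
        finally show ?thesis .
      qed
      have "degree h \<le> degree f" unfolding h_def
        by (intro degree_diff_le) (auto simp: dM degree_smult_le)
      moreover have "coeff h (degree f) = 0" by (simp add: h_def lc)
      ultimately show ?thesis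
        by (metis eq_zero_or_degree_less)
    qed
    have "\<exists>N. \<exists>Q\<in>poly_over S. \<exists>R\<in>poly_over S.
        smult (l ^ N) h = g * Q + R \<and> (R = 0 \<or> degree R < degree g)"
    proof (cases "h = 0")
      case True
      then show ?thesis using zero_in_poly_over[OF S]
        by (intro exI[of _ 0] bexI[of _ 0] bexI[of _ 0]) auto
    next
      case False
      then show ?thesis using less.hyps[of h] hd h by (auto simp: l_def)
    qed
    then obtain N Q R where N: "Q \<in> poly_over S" "R \<in> poly_over S" "smult (l ^ N) h = g * Q + R"
      "R = 0 \<or> degree R < degree g" by blast
    have "smult (l ^ Suc N) f = smult (l ^ N) (h + g * M)"
      by (simp add: h_def mult.commute)
    also have "\<dots> = g * (Q + smult (l ^ N) M) + R"
      by (simp only: smult_add_right N(3)) (simp add: algebra_simps)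
    finally have "smult (l ^ Suc N) f = g * (Q + smult (l ^ N) M) + R" .
    moreover have "Q + smult (l ^ N) M \<in> poly_over S"
      by (intro subring_set_add[OF SP] N smult_in_poly_over S M subring_set_power lS)
    ultimately show ?thesis using N unfolding l_def by blast
  qed
qed

text \<open>The shortening step of Chevalley's extension argument. As
  \<open>1 - inverse x * d 0\<close> is a unit of \<open>V\<close>, the relation in
  \<open>inverse u\<close>, multiplied by \<open>u ^ n\<close>, expresses \<open>u ^ n\<close>
  through lower powers of \<open>u\<close>; substituting this removes the top term of the relation
  in \<open>u\<close>.\<close>

lemma relation_shorten:
  fixes x u :: "'b::field"
  assumes V: "subring_set V" and tV: "inverse x \<in> V" and x0: "x \<noteq> 0"
    and unit: "\<And>b. b \<in> V \<Longrightarrow> inverse (1 + inverse x * b) \<in> V \<and> 1 + inverse x * b \<noteq> 0"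
    and c: "\<And>i. c i \<in> V" "x = (\<Sum>i\<le>n. c i * u ^ i)"
    and d: "\<And>i. d i \<in> V" "x = (\<Sum>i\<le>m. d i * inverse u ^ i)"
    and mn: "m \<le> n" and n: "0 < n" and u: "u \<noteq> 0"
  shows "\<exists>c'. (\<forall>i. c' i \<in> V) \<and> x = (\<Sum>i\<le>n - 1. c' i * u ^ i)"
proof -
  define t where "t = inverse x"
  define eps where "eps = inverse (1 + t * (- d 0))"
  have eps: "eps \<in> V" "1 + t * (- d 0) \<noteq> 0"
    using unit[OF subring_set_uminus[OF V d(1)[of 0]]] by (auto simp: eps_def t_def)
  have tx: "t * x = 1" using x0 by (simp add: t_def)
  have "x = d 0 + (\<Sum>i\<in>{1..m}. d i * inverse u ^ i)"
    by (subst d(2)) (simp only: atMost_atLeast0 sum.atLeast_Suc_atMost[of 0 m], simp)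
  then have "t * x = t * d 0 + t * (\<Sum>i\<in>{1..m}. d i * inverse u ^ i)"
    by (metis distrib_left)
  then have "1 + t * (- d 0) = t * (\<Sum>i\<in>{1..m}. d i * inverse u ^ i)"
    by (simp add: tx algebra_simps)
  then have e1: "1 = eps * (t * (\<Sum>i\<in>{1..m}. d i * inverse u ^ i))"
    using eps(2) unfolding eps_def by (metis left_inverse)
  have "u ^ n = eps * t * (\<Sum>i\<in>{1..m}. d i * (inverse u ^ i * u ^ n))"
    using arg_cong[OF e1, of "\<lambda>z. z * u ^ n"] by (simp add: sum_distrib_left sum_distrib_right mult_ac)
  also have "(\<Sum>i\<in>{1..m}. d i * (inverse u ^ i * u ^ n)) = (\<Sum>i\<in>{1..m}. d i * u ^ (n - i))"
    using mn u by (intro sum.cong) (auto simp: power_diff field_simps)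
  also have "\<dots> = (\<Sum>i\<in>{n - m..<n}. d (n - i) * u ^ i)"
    using mn n by (intro sum.reindex_bij_witness[of _ "\<lambda>i. n - i" "\<lambda>i. n - i"]) auto
  also have "\<dots> = (\<Sum>i\<le>n - 1. (if n - m \<le> i then d (n - i) else 0) * u ^ i)"
    using mn n by (intro sum.mono_neutral_cong_left) auto
  finally have un: "u ^ n = eps * t * \<dots>" .
  define c' where "c' i = c i + c n * (eps * t * (if n - m \<le> i then d (n - i) else 0))" for i
  have "x = (\<Sum>i\<le>n - 1. c i * u ^ i) + c n * u ^ n"
    using n by (subst c(2)) (cases n, auto)
  also have "\<dots> = (\<Sum>i\<le>n - 1. c' i * u ^ i)"
    by (subst un) (simp add: c'_def algebra_simps sum.distrib sum_distrib_left)
  finally have "x = (\<Sum>i\<le>n - 1. c' i * u ^ i)" .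
  moreover have "c' i \<in> V" for i
    using c(1) d(1) eps(1) tV V unfolding c'_def t_def by (auto intro!: subring_set_intros)
  ultimately show ?thesis by blast
qed

text \<open>A maximal subring containing \<open>1 / x\<close> but not \<open>x\<close> is a valuation ring.\<close>

lemma valuation_ring_avoiding:
  fixes x :: "'b::field"
  assumes S: "subring_set S" "inverse x \<in> S" "x \<notin> S"
  obtains V where "subring_set V" "S \<subseteq> V" "x \<notin> V" "\<And>u. u \<in> V \<or> inverse u \<in> V"
proof -
  define Rs where "Rs = {V. subring_set V \<and> S \<subseteq> V \<and> x \<notin> V}"
  have "\<exists>M\<in>Rs. \<forall>W\<in>Rs. M \<subseteq> W \<longrightarrow> W = M"
  proof (rule subset_Zorn_nonempty)
    show "Rs \<noteq> {}" using S by (auto simp: Rs_def)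
    fix c assume c: "c \<noteq> {}" "subset.chain Rs c"
    have tot: "W \<subseteq> Y \<or> Y \<subseteq> W" if "W \<in> c" "Y \<in> c" for W Y
      using c that by (auto simp: subset.chain_def)
    have cC: "\<And>W. W \<in> c \<Longrightarrow> W \<in> Rs" using c by (auto simp: subset.chain_def)
    have "subring_set (\<Union> c)"
      unfolding subring_set_def
    proof (intro conjI ballI)
      show "1 \<in> \<Union> c" using c cC subring_set_one by (auto simp: Rs_def)
      fix u v assume "u \<in> \<Union> c" "v \<in> \<Union> c"
      then obtain W where W: "W \<in> c" "u \<in> W" "v \<in> W" using tot by blast
      then have "subring_set W" using cC by (auto simp: Rs_def)
      with W show "u - v \<in> \<Union> c" "u * v \<in> \<Union> c" by (auto intro: subring_set_intros)
    qed
    then show "\<Union> c \<in> Rs" using c cC by (auto simp: Rs_def)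
  qed
  then obtain V where V: "subring_set V" "S \<subseteq> V" "x \<notin> V"
    and max: "\<And>W. subring_set W \<Longrightarrow> V \<subseteq> W \<Longrightarrow> x \<notin> W \<Longrightarrow> W = V"
    unfolding Rs_def by (smt (verit) mem_Collect_eq order_trans)
  have x0: "x \<noteq> 0" using V subring_set_zero by metis
  define t where "t = inverse x"
  have tx: "t * x = 1" using x0 by (simp add: t_def)
  have tV: "t \<in> V" using S V by (auto simp: t_def)
  have ne: "1 + t * b \<noteq> 0" if "b \<in> V" for b
  proof
    assume "1 + t * b = 0"
    then have "x * (1 + t * b) = 0" by simp
    then have "x = - b" using tx by (simp add: algebra_simps add_eq_0_iff2)
    then show False using that V subring_set_uminus by metis
  qed
  \<comment> \<open>The localisation of \<open>V\<close> at the elements \<open>1 + t * b\<close>.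
    It still omits \<open>x\<close>, so maximality gives \<open>U = V\<close> and makes all these
    elements units.\<close>
  define U where "U = {a * inverse (1 + t * b) | a b. a \<in> V \<and> b \<in> V}"
  have "U = V"
  proof (rule max)
    show "V \<subseteq> U"
    proof
      fix a assume "a \<in> V"
      then show "a \<in> U" unfolding U_def using subring_set_zero[OF V(1)]
        by (intro CollectI exI[of _ a] exI[of _ 0]) auto
    qed
    show "x \<notin> U"
    proof
      assume "x \<in> U"
      then obtain a b where ab: "a \<in> V" "b \<in> V" "x = a * inverse (1 + t * b)" by (auto simp: U_def)
      then have "x * (1 + t * b) = a" using ne[OF ab(2)] by simp
      then have "x = a - b" using tx by (simp add: algebra_simps)
      then show False using ab V subring_set_diff by metis
    qed
    show "subring_set U" unfolding subring_set_def
    proof (intro conjI ballI)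
      show "1 \<in> U" using \<open>V \<subseteq> U\<close> subring_set_one[OF V(1)] by auto
      fix u v assume "u \<in> U" "v \<in> U"
      then obtain a b a' b' where ab: "a \<in> V" "b \<in> V" "u = a * inverse (1 + t * b)"
        "a' \<in> V" "b' \<in> V" "v = a' * inverse (1 + t * b')" by (auto simp: U_def)
      define B where "B = b + b' + t * (b * b')"
      have B: "B \<in> V" using ab V tV by (auto simp: B_def intro!: subring_set_intros)
      have BB: "1 + t * B = (1 + t * b) * (1 + t * b')" by (simp add: B_def algebra_simps)
      have "u - v = (a * (1 + t * b') - a' * (1 + t * b)) * inverse (1 + t * B)"
        using ne[OF ab(2)] ne[OF ab(5)] unfolding BB ab by (simp add: field_simps)
      moreover have "a * (1 + t * b') - a' * (1 + t * b) \<in> V"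
        using ab V tV by (auto intro!: subring_set_intros)
      ultimately show "u - v \<in> U" using B by (auto simp: U_def)
      have "u * v = (a * a') * inverse (1 + t * B)"
        using ne[OF ab(2)] ne[OF ab(5)] unfolding BB ab by (simp add: field_simps)
      moreover have "a * a' \<in> V" using ab V by (auto intro!: subring_set_intros)
      ultimately show "u * v \<in> U" using B by (auto simp: U_def)
    qed
  qed
  then have unit: "inverse (1 + t * b) \<in> V" if "b \<in> V" for b
    using that subring_set_one[OF V(1)] by (force simp: U_def)
  define rel where "rel u n \<longleftrightarrow> (\<exists>c. (\<forall>i. c i \<in> V) \<and> x = (\<Sum>i\<le>n. c i * u ^ i))" for u n
  have rel_ex: "\<exists>n. rel u n" if u: "u \<notin> V" for u
  proof -
    \<comment> \<open>This is \<open>V[u]\<close>, a ring strictly above \<open>V\<close>; by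
      maximality it contains \<open>x\<close>, which is the desired relation.\<close>
    define W where "W = {poly f u | f. f \<in> poly_over V}"
    note VP = subring_set_poly_over[OF V(1)]
    have "subring_set W" unfolding subring_set_def W_def
    proof (safe, goal_cases)
      case 1 show ?case using subring_set_one[OF VP] by (intro exI[of _ 1]) auto
    next
      case (2 _ _ f g) then show ?case using subring_set_diff[OF VP] by (intro exI[of _ "f - g"]) auto
    next
      case (3 _ _ f g) then show ?case using subring_set_mult[OF VP] by (intro exI[of _ "f * g"]) auto
    qed
    moreover have "V \<subseteq> W"
    proof
      fix v assume "v \<in> V"
      then show "v \<in> W" unfolding W_def using zero_in_poly_over[OF V(1)]
        by (intro CollectI exI[of _ "[:v:]"]) (auto simp: pCons_in_poly_over)
    qed
    moreover have "u \<in> W" unfolding W_def using subring_set_zero[OF V(1)] subring_set_one[OF V(1)] zero_in_poly_over[OF V(1)]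
      by (intro CollectI exI[of _ "[:0, 1:]"]) (auto simp: pCons_in_poly_over)
    ultimately have "x \<in> W" using max u by blast
    then obtain f where "f \<in> poly_over V" "x = poly f u" by (auto simp: W_def)
    then have "rel u (degree f)" unfolding rel_def
      by (intro exI[of _ "coeff f"]) (auto simp: poly_altdef poly_over_coeff)
    then show ?thesis ..
  qed
  have rel0: "\<not> rel u 0" for u using V by (auto simp: rel_def)
  have step: "rel u (n - 1)" if "rel u n" "rel (inverse u) m" "m \<le> n" "u \<noteq> 0" for u n m
  proof -
    have n: "0 < n" using rel0 that(1) by (cases n) auto
    from that(1) obtain c where c: "\<And>i. c i \<in> V" "x = (\<Sum>i\<le>n. c i * u ^ i)" by (auto simp: rel_def)
    from that(2) obtain d where d: "\<And>i. d i \<in> V" "x = (\<Sum>i\<le>m. d i * inverse u ^ i)" by (auto simp: rel_def)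
    show ?thesis unfolding rel_def
      by (rule relation_shorten[OF V(1) tV[unfolded t_def] x0 _ c d that(3) n that(4)])
        (use unit ne in \<open>auto simp: t_def\<close>)
  qed
  have "u \<in> V \<or> inverse u \<in> V" for u
  proof (rule ccontr)
    assume "\<not> (u \<in> V \<or> inverse u \<in> V)"
    then have uV: "u \<notin> V" "inverse u \<notin> V" by auto
    then have u0: "u \<noteq> 0" using subring_set_zero[OF V(1)] by auto
    \<comment> \<open>With shortest relations in \<open>u\<close> and in its inverse, the one that
      is not shorter can be shortened by means of the other.\<close>
    define n where "n = (LEAST n. rel u n)"
    define m where "m = (LEAST m. rel (inverse u) m)"
    have n: "rel u n" and m: "rel (inverse u) m"
      unfolding n_def m_def using rel_ex uV by (auto intro: LeastI_ex)
    have n0: "n > 0" "m > 0" using rel0 n m by (metis gr0I)+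
    show False
    proof (cases "m \<le> n")
      case True
      from step[OF n m True u0] have "n \<le> n - 1" unfolding n_def by (rule Least_le)
      then show False using n0 by simp
    next
      case False
      then have "rel (inverse u) (m - 1)" using step[of "inverse u" m n] n m u0 by simp
      then have "m \<le> m - 1" unfolding m_def by (rule Least_le)
      then show False using n0 by simp
    qed
  qed
  then show ?thesis using V that by blast
qed

lemma poly_order_split:
  fixes h :: "'b::field poly"
  assumes k: "subring_set k" and c: "c \<in> k" and h: "h \<in> poly_over k" "h \<noteq> 0"
  shows "\<exists>r. \<exists>g\<in>poly_over k. h = [:- c, 1:] ^ r * g \<and> poly g c \<noteq> 0"
  using h
proof (induction "degree h" arbitrary: h rule: less_induct)
  case less
  show ?case
  proof (cases "poly h c = 0")
    case True
    then obtain g where g: "g \<in> poly_over k" "h = [:- c, 1:] * g"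
      using linear_division[OF k less.prems(1) c] by auto
    have g0: "g \<noteq> 0" using g less.prems by auto
    have "degree h = Suc (degree g)" unfolding g(2) using g0 by (subst degree_mult_eq) auto
    then obtain r g' where "g' \<in> poly_over k" "g = [:- c, 1:] ^ r * g'" "poly g' c \<noteq> 0"
      using less.hyps[of g] g g0 by auto
    then show ?thesis using g(2)
      by (intro exI[of _ "Suc r"] bexI[of _ g']) (auto simp only: power_Suc mult.assoc)
  next
    case False
    then show ?thesis using less.prems by (intro exI[of _ 0] bexI[of _ h]) auto
  qed
qed

text \<open>In contrast to \<open>valuation_rings\<close>, the ring may be all of \<open>K\<close>
  and constants are not mentioned; strictness of the inclusions is supplied in
  \<open>rational_places_eq\<close>.\<close>

definition valuation_ring_in :: "'b::field set \<Rightarrow> 'b set \<Rightarrow> bool" where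
  "valuation_ring_in K V \<longleftrightarrow> subring_set V \<and> V \<subseteq> K \<and> (\<forall>u\<in>K. u \<in> V \<or> inverse u \<in> V)"

definition subfield_set :: "'b::field set \<Rightarrow> bool" where
  "subfield_set K \<longleftrightarrow> subring_set K \<and> (\<forall>u\<in>K. inverse u \<in> K)"

section \<open>Units and the maximal ideal of a valuation ring\<close>

locale valued_field =
  fixes K V :: "'b::field set"
  assumes K: "subfield_set K" and V: "valuation_ring_in K V"
begin

lemma V_ring: "subring_set V" and V_sub: "u \<in> V \<Longrightarrow> u \<in> K"
  and V_cases: "u \<in> K \<Longrightarrow> u \<in> V \<or> inverse u \<in> V"
  using V by (auto simp: valuation_ring_in_def)

lemma K_ring: "subring_set K" and K_inverse: "u \<in> K \<Longrightarrow> inverse u \<in> K"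
  using K by (auto simp: subfield_set_def)

lemma K_divide: "u \<in> K \<Longrightarrow> v \<in> K \<Longrightarrow> u / v \<in> K"
  using K_ring K_inverse by (simp add: divide_inverse subring_set_mult)

abbreviation "\<mm> \<equiv> max_ideal V"

lemma m_V: "u \<in> \<mm> \<Longrightarrow> u \<in> V"
  and zero_m: "0 \<in> \<mm>"
  and one_not_m: "1 \<notin> \<mm>"
  using V_ring by (auto simp: max_ideal_def subring_set_zero subring_set_one)

lemma unit_inverse:
  "u \<in> V \<Longrightarrow> u \<notin> \<mm> \<Longrightarrow> u \<noteq> 0 \<and> inverse u \<in> V"
  by (auto simp: max_ideal_def)

lemma inverse_m: "u \<in> K \<Longrightarrow> u \<notin> V \<Longrightarrow> inverse u \<in> \<mm>"
  using V_cases by (auto simp: max_ideal_def)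

lemma m_mult:
  assumes "u \<in> \<mm>" "v \<in> V"
  shows "u * v \<in> \<mm>"
proof (cases "u * v = 0")
  case True
  then show ?thesis by (simp only: zero_m)
next
  case False
  have "inverse (u * v) \<notin> V"
  proof
    assume "inverse (u * v) \<in> V"
    then have "v * inverse (u * v) \<in> V" using assms V_ring by (auto intro: subring_set_intros)
    moreover have "v * inverse (u * v) = inverse u" using False by (simp add: field_simps)
    ultimately have "inverse u \<in> V" by (simp only:)
    then show False using assms False by (auto simp: max_ideal_def)
  qed
  then show ?thesis using assms False V_ring by (auto simp: max_ideal_def intro: subring_set_mult)
qed

lemma m_mult': "u \<in> V \<Longrightarrow> v \<in> \<mm> \<Longrightarrow> u * v \<in> \<mm>"
  using m_mult[of v u] by (simp add: mult.commute)

text \<open>Of two nonzero elements one divides the other in \<open>V\<close>, so the sum is a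
  multiple of one of them.\<close>

lemma m_add:
  assumes "u \<in> \<mm>" "v \<in> \<mm>"
  shows "u + v \<in> \<mm>"
proof -
  have *: "u + v \<in> \<mm>" if "u \<in> \<mm>" "v \<in> \<mm>" "u \<noteq> 0" "v / u \<in> V" for u v
  proof -
    have "u * (1 + v / u) \<in> \<mm>" using that V_ring by (intro m_mult) (auto intro: subring_set_intros)
    moreover have "u * (1 + v / u) = u + v" using that by (simp add: distrib_left)
    ultimately show ?thesis by simp
  qed
  show ?thesis
  proof (cases "u = 0 \<or> v = 0")
    case True
    then show ?thesis using assms by auto
  next
    case False
    have "v / u \<in> V \<or> inverse (v / u) \<in> V"
      using assms by (intro V_cases K_divide V_sub m_V)
    then show ?thesis using *[of u v] *[of v u] assms False
      by (metis add.commute inverse_divide)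
  qed
qed

lemma m_diff: "u \<in> \<mm> \<Longrightarrow> v \<in> \<mm> \<Longrightarrow> u - v \<in> \<mm>"
  using m_add[of u "- 1 * v"] m_mult'[OF subring_set_uminus[OF V_ring subring_set_one[OF V_ring]], of v]
  by simp

lemma m_uminus: "u \<in> \<mm> \<Longrightarrow> - u \<in> \<mm>"
  using m_diff[OF zero_m, of u] by simp

lemma m_sum:
  "(\<And>i. i \<in> I \<Longrightarrow> g i \<in> \<mm>) \<Longrightarrow> sum g I \<in> \<mm>"
  by (induction I rule: infinite_finite_induct) (auto intro: zero_m m_add)

lemma m_prime:
  assumes "u \<in> V" "v \<in> V" "u * v \<in> \<mm>"
  shows "u \<in> \<mm> \<or> v \<in> \<mm>"
proof (rule ccontr)
  assume "\<not> (u \<in> \<mm> \<or> v \<in> \<mm>)"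
  then have inv: "inverse u \<in> V" "inverse v \<in> V" and "u \<noteq> 0" "v \<noteq> 0"
    using assms unit_inverse by blast+
  have "u * v * (inverse u * inverse v) \<in> \<mm>"
    using assms(3) by (rule m_mult) (rule subring_set_mult[OF V_ring inv])
  moreover have "u * v * (inverse u * inverse v) = 1"
    using \<open>u \<noteq> 0\<close> \<open>v \<noteq> 0\<close> by (simp add: field_simps)
  ultimately show False using one_not_m by simp
qed

lemma m_power_iff: "u \<in> V \<Longrightarrow> u ^ n \<in> \<mm> \<Longrightarrow> u \<in> \<mm>"
proof (induction n)
  case 0
  then show ?case using one_not_m by simp
next
  case (Suc n)
  then show ?case using m_prime[of u "u ^ n"] subring_set_power[OF V_ring, of u n]
    by (metis power_Suc)
qed

lemma power_in_m: "u \<in> \<mm> \<Longrightarrow> 0 < n \<Longrightarrow> u ^ n \<in> \<mm>"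
  using m_mult[of u "u ^ (n - 1)"] subring_set_power[OF V_ring m_V[of u], of "n - 1"]
  by (metis power_minus_mult mult.commute)

lemma not_m_mult:
  "u \<in> V - \<mm> \<Longrightarrow> v \<in> V - \<mm> \<Longrightarrow> u * v \<in> V - \<mm>"
  using m_prime[of u v] subring_set_mult[OF V_ring, of u v] by blast

lemma not_m_inverse:
  assumes "u \<in> V - \<mm>"
  shows "inverse u \<in> V - \<mm>"
proof -
  have "u \<noteq> 0" "inverse u \<in> V" using unit_inverse[of u] assms by blast+
  then show ?thesis using assms unfolding max_ideal_def by simp
qed

lemma not_m_power: "u \<in> V - \<mm> \<Longrightarrow> u ^ n \<in> V - \<mm>"
proof (induction n)
  case 0
  then show ?case using one_not_m subring_set_one[OF V_ring] by simp
next
  case (Suc n)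
  then have "u ^ n \<in> V - \<mm>" by blast
  from not_m_mult[OF Suc.prems this] show ?case by (simp only: power_Suc)
qed

lemma root_in_V:
  assumes u: "u \<in> K" "u ^ n \<in> V" "0 < n"
  shows "u \<in> V"
proof (rule ccontr)
  assume "u \<notin> V"
  then have i: "inverse u \<in> \<mm>" "u \<noteq> 0" using inverse_m u(1) subring_set_zero[OF V_ring] by auto
  then have "inverse u ^ n * u ^ n \<in> \<mm>" using u power_in_m m_mult by blast
  moreover have "inverse u ^ n * u ^ n = 1" using i(2) by (simp flip: power_mult_distrib)
  ultimately show False using one_not_m by simp
qed

text \<open>This lets a monomial in \<open>x\<close> and \<open>y\<close> be judged by its
  \<open>p\<close>-th power, where \<open>y ^ p\<close> can be traded for a power of
  \<open>x\<close>.\<close>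

lemma root_in_m:
  assumes "u \<in> K" "u ^ n \<in> \<mm>" "0 < n"
  shows "u \<in> \<mm>"
  using assms root_in_V m_power_iff m_V by blast

lemma congruent_unit:
  assumes "c \<in> V - \<mm>" "u - c \<in> \<mm>"
  shows "u \<in> V - \<mm>"
proof -
  have "u \<in> V" using subring_set_add[OF V_ring, of "u - c" c] assms m_V by auto
  moreover have "c \<in> \<mm>" if "u \<in> \<mm>" using m_diff[OF that assms(2)] by simp
  ultimately show ?thesis using assms by auto
qed

end

section \<open>Places of an Artin--Schreier curve\<close>

text \<open>The outer variable is \<open>y\<close> and the coefficients are polynomials in
  \<open>x\<close>: the equation is monic in \<open>y\<close>, so reduction modulo it is division in
  the outer variable.\<close>

definition poly2 :: "'b::comm_ring_1 poly poly \<Rightarrow> 'b \<Rightarrow> 'b \<Rightarrow> 'b" where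
  "poly2 f u v = poly (poly f [:v:]) u"

lemma poly2_simps [simp]:
  "poly2 (f + g) u v = poly2 f u v + poly2 g u v"
  "poly2 (f - g) u v = poly2 f u v - poly2 g u v"
  "poly2 (- f) u v = - poly2 f u v"
  "poly2 (f * g) u v = poly2 f u v * poly2 g u v"
  "poly2 (f ^ n) u v = poly2 f u v ^ n"
  "poly2 0 u v = 0" "poly2 1 u v = 1"
  "poly2 [:c:] u v = poly c u"
  "poly2 (monom c n) u v = poly c u * v ^ n"
  "poly2 (pCons c f) u v = poly c u + v * poly2 f u v"
  "poly2 (smult c f) u v = poly c u * poly2 f u v"
  by (simp_all add: poly2_def poly_monom mult.commute)

lemma poly2_altdef: "poly2 f u v = (\<Sum>i\<le>degree f. poly (coeff f i) u * v ^ i)"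
  by (simp add: poly2_def poly_altdef[of f] poly_sum)

lemma poly_over_mono: "S \<subseteq> T \<Longrightarrow> poly_over S \<subseteq> poly_over T"
  by (auto simp: poly_over_def)

lemma poly2_in_subring_set:
  assumes T: "subring_set T" and S: "S \<subseteq> T" and "f \<in> poly_over (poly_over S)" "u \<in> T" "v \<in> T"
  shows "poly2 f u v \<in> T"
proof -
  have "f \<in> poly_over (poly_over T)" using assms poly_over_mono[OF poly_over_mono[OF S]] by auto
  moreover have "[:v:] \<in> poly_over T"
    using assms zero_in_poly_over[OF T] by (simp add: pCons_in_poly_over)
  ultimately have "poly f [:v:] \<in> poly_over T"
    by (intro poly_in_subring_set[OF subring_set_poly_over[OF T]])
  then show ?thesis unfolding poly2_def using assms by (intro poly_in_subring_set[OF T])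
qed

locale artin_schreier_curve =
  fixes k :: "'b::field set" and x y :: 'b and p m e :: nat and a :: "nat \<Rightarrow> 'b"
  assumes k: "subfield_set k"
    and char: "prime CHAR('b)" and p: "p = CHAR('b) ^ m" and m: "0 < m"
    and e: "0 < e"
    and a_k: "\<And>i. i \<le> e \<Longrightarrow> a i \<in> k" and a_e: "a e \<noteq> 0"
    and transcendental: "\<And>f. f \<in> poly_over k \<Longrightarrow> poly f x = 0 \<Longrightarrow> f = 0"
    and equation: "y ^ p - y = x * R_fun p e a x"
begin

abbreviation "P1 \<equiv> poly_over k"
abbreviation "P2 \<equiv> poly_over (poly_over k)"

text \<open>The degree of \<open>x R(x)\<close>. At infinity \<open>x\<close> has pole order
  \<open>p\<close> and \<open>y\<close> has pole order \<open>r\<close>.\<close>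

definition "r = p ^ e + 1"

definition xR :: "'b poly" where "xR = pCons 0 (\<Sum>i\<le>e. monom (a i) (p ^ i))"

definition rel :: "'b poly poly" where "rel = monom 1 p + (- monom 1 1 - [:xR:])"

text \<open>The denominator may vanish at \<open>(x, y)\<close>; the quotient is then 0, which
  belongs to the field anyway. This spares a side condition at the price of a case split for
  differences.\<close>

definition K :: "'b set" where "K = {poly2 f x y / poly2 g x y | f g. f \<in> P2 \<and> g \<in> P2}"

lemma k_ring: "subring_set k" and k_inverse: "c \<in> k \<Longrightarrow> inverse c \<in> k"
  using k by (auto simp: subfield_set_def)

lemma P1_ring: "subring_set P1" and P2_ring: "subring_set P2"
  using k_ring by (auto intro: subring_set_poly_over)

lemma const_P1: "c \<in> k \<Longrightarrow> [:c:] \<in> P1"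
  using zero_in_poly_over[OF k_ring] by (simp add: pCons_in_poly_over)

lemma const_P2: "c \<in> P1 \<Longrightarrow> [:c:] \<in> P2"
  using zero_in_poly_over[OF P1_ring] by (simp add: pCons_in_poly_over)

lemma linear_P1: "c \<in> k \<Longrightarrow> [:c, 1:] \<in> P1"
  using zero_in_poly_over[OF k_ring] subring_set_one[OF k_ring] by (simp add: pCons_in_poly_over)

lemma linear_P2: "c \<in> P1 \<Longrightarrow> [:c, 1:] \<in> P2"
  using zero_in_poly_over[OF P1_ring] subring_set_one[OF P1_ring] by (simp add: pCons_in_poly_over)

lemma p_gt_1: "1 < p"
  unfolding p by (rule one_less_power[OF prime_gt_1_nat[OF char] m])

lemma power_p_diff: "(u - v) ^ p = u ^ p - v ^ p" for u v :: 'b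
  using freshmans_dream'[OF char p, of "u - v" v] by (simp add: algebra_simps)

lemma poly_xR: "poly xR u = u * R_fun p e a u"
  by (simp add: xR_def R_fun_def poly_sum poly_monom)

lemma xR_P1: "xR \<in> P1"
  unfolding xR_def pCons_in_poly_over
  by (intro conjI subring_set_zero k_ring subring_set_sum[OF P1_ring] monom_in_poly_over) (simp add: a_k)

lemma degree_xR: "degree xR = r" and lead_coeff_xR: "lead_coeff xR = a e"
proof -
  define h where "h = (\<Sum>i\<le>e. monom (a i) (p ^ i))"
  have le: "degree h \<le> p ^ e" unfolding h_def
    by (intro degree_sum_le order.trans[OF degree_monom_le]) (use p_gt_1 in auto)
  have "coeff h (p ^ e) = (\<Sum>i\<le>e. if p ^ i = p ^ e then a i else 0)"
    by (simp add: h_def coeff_sum)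
  also have "\<dots> = (\<Sum>i\<le>e. if i = e then a i else 0)"
    using p_gt_1 by (intro sum.cong) (auto simp: power_inject_exp)
  also have "\<dots> = a e" by simp
  finally have c: "coeff h (p ^ e) = a e" .
  then have "degree h = p ^ e" using le a_e by (metis le_antisym le_degree)
  then show "degree xR = r" "lead_coeff xR = a e"
    using c a_e unfolding xR_def h_def[symmetric] r_def by (auto simp: degree_pCons_eq_if)
qed

lemma poly2_rel: "poly2 rel u v = v ^ p - v - u * R_fun p e a u"
  by (simp add: rel_def poly_xR)

lemma rel_P2: "rel \<in> P2"
  unfolding rel_def
  by (intro subring_set_intros P2_ring monom_in_poly_over P1_ring const_P2 xR_P1)

lemma degree_rel: "degree rel = p" and lead_coeff_rel: "lead_coeff rel = 1"
proof -
  have lt: "degree (- monom 1 1 - [:xR:]) < degree (monom (1 :: 'b poly) p)"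
    using p_gt_1 by (auto simp: degree_monom_eq intro!: le_less_trans[OF degree_diff_le_max])
  show "degree rel = p" unfolding rel_def
    by (subst degree_add_eq_left[OF lt]) (simp add: degree_monom_eq)
  show "lead_coeff rel = 1" unfolding rel_def
    unfolding degree_add_eq_left[OF lt] using p_gt_1 by (simp add: degree_monom_eq coeff_pCons split: nat.splits)
qed

lemma poly2_K: "f \<in> P2 \<Longrightarrow> poly2 f x y \<in> K"
  unfolding K_def using subring_set_one[OF P2_ring]
  by (intro CollectI exI[of _ f] exI[of _ 1]) auto

lemma poly_K: "f \<in> P1 \<Longrightarrow> poly f x \<in> K"
  using poly2_K[OF const_P2, of f] by simp

lemma k_K: "k \<subseteq> K"
  using poly_K[OF const_P1] by auto

lemma x_K: "x \<in> K"
  using poly_K[OF linear_P1[OF subring_set_zero[OF k_ring]]] by simp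

lemma y_K: "y \<in> K"
  using poly2_K[OF linear_P2[OF subring_set_zero[OF P1_ring]]] by simp

lemma subfield_K: "subfield_set K"
  unfolding subfield_set_def subring_set_def
proof (intro conjI ballI)
  show "1 \<in> K" using poly2_K[OF subring_set_one[OF P2_ring]] by simp
  fix u assume "u \<in> K"
  then obtain f g where fg: "f \<in> P2" "g \<in> P2" "u = poly2 f x y / poly2 g x y" by (auto simp: K_def)
  then show "inverse u \<in> K" unfolding K_def by (intro CollectI exI[of _ g] exI[of _ f]) auto
  fix v assume "v \<in> K"
  then obtain f' g' where fg': "f' \<in> P2" "g' \<in> P2" "v = poly2 f' x y / poly2 g' x y" by (auto simp: K_def)
  show "u * v \<in> K" unfolding K_def using fg fg' subring_set_mult[OF P2_ring]
    by (intro CollectI exI[of _ "f * f'"] exI[of _ "g * g'"]) auto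
  show "u - v \<in> K"
  proof (cases "poly2 g x y = 0 \<or> poly2 g' x y = 0")
    case True
    have *: "- f' \<in> P2" using fg' P2_ring by (intro subring_set_uminus)
    show ?thesis
    proof (cases "poly2 g x y = 0")
      case True
      then have "u - v = poly2 (- f') x y / poly2 g' x y" using fg fg' by simp
      then show ?thesis unfolding K_def using * fg' by blast
    next
      case False
      then have "u - v = poly2 f x y / poly2 g x y" using \<open>_ \<or> _\<close> fg fg' by simp
      then show ?thesis unfolding K_def using fg by blast
    qed
  next
    case False
    then show ?thesis unfolding K_def using fg fg' P2_ring
      by (intro CollectI exI[of _ "f * g' - f' * g"] exI[of _ "g * g'"])
        (auto simp: diff_frac_eq mult.commute intro!: subring_set_intros)
  qed
qed

lemma x_nonzero: "x \<noteq> 0"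
proof
  assume "x = 0"
  then have "poly [:0, 1:] x = 0" by simp
  with transcendental[OF linear_P1[OF subring_set_zero[OF k_ring]]] show False by simp
qed

text \<open>By transcendence \<open>x\<close> is not in \<open>k[1/x]\<close>: clearing powers of
  \<open>x\<close> would leave a monic equation for \<open>x\<close> over \<open>k\<close>. A
  valuation ring above \<open>k[1/x]\<close> that omits \<open>x\<close> is then intersected with
  \<open>K\<close>.\<close>

lemma infinite_valuation_ring_exists:
  "\<exists>V. valuation_ring_in K V \<and> k \<subseteq> V \<and> x \<notin> V"
proof -
  define S where "S = {poly f (inverse x) | f. f \<in> P1}"
  have S_ring: "subring_set S"
    unfolding subring_set_def S_def
  proof (safe, goal_cases)
    case 1 show ?case using subring_set_one[OF P1_ring] by (intro exI[of _ 1]) auto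
  next
    case (2 _ _ f g) then show ?case using subring_set_diff[OF P1_ring] by (intro exI[of _ "f - g"]) auto
  next
    case (3 _ _ f g) then show ?case using subring_set_mult[OF P1_ring] by (intro exI[of _ "f * g"]) auto
  qed
  have kS: "k \<subseteq> S"
    unfolding S_def using const_P1 by (auto intro!: exI[of _ "[:_:]"])
  have xS: "inverse x \<in> S"
    unfolding S_def using linear_P1[OF subring_set_zero[OF k_ring]]
    by (intro CollectI exI[of _ "[:0, 1:]"]) auto
  have "x \<notin> S"
  proof
    assume "x \<in> S"
    then obtain f where f: "f \<in> P1" "x = poly f (inverse x)" by (auto simp: S_def)
    define n where "n = degree f"
    have "x * x ^ n = (\<Sum>i\<le>n. coeff f i * (inverse x ^ i * x ^ n))"
      by (subst f(2)) (simp add: poly_altdef n_def sum_distrib_left mult_ac)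
    also have "\<dots> = (\<Sum>i\<le>n. coeff f i * x ^ (n - i))"
      using x_nonzero by (intro sum.cong) (auto simp: power_diff field_simps)
    finally have *: "x ^ Suc n = (\<Sum>i\<le>n. coeff f i * x ^ (n - i))" by simp
    define g where "g = monom 1 (Suc n) - (\<Sum>i\<le>n. monom (coeff f i) (n - i))"
    have "g \<in> P1" unfolding g_def
      by (intro subring_set_intros P1_ring monom_in_poly_over k_ring poly_over_coeff[OF f(1)])
    moreover have "poly g x = 0" using * by (simp add: g_def poly_sum poly_monom)
    ultimately have "g = 0" by (rule transcendental)
    moreover have "coeff g (Suc n) = 1"
      unfolding g_def coeff_diff coeff_sum coeff_monom
      by (subst sum.neutral) auto
    ultimately show False by simp
  qed
  from valuation_ring_avoiding[OF S_ring xS this] obtain V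
    where V: "subring_set V" "S \<subseteq> V" "x \<notin> V" "\<And>u. u \<in> V \<or> inverse u \<in> V" by blast
  have K_ring: "subring_set K" and "\<And>u. u \<in> K \<Longrightarrow> inverse u \<in> K"
    using subfield_K by (auto simp: subfield_set_def)
  then have "valuation_ring_in K (V \<inter> K)"
    using V(1,4) unfolding valuation_ring_in_def subring_set_def by auto
  then show ?thesis using V kS k_K by (intro exI[of _ "V \<inter> K"]) auto
qed

text \<open>The pole order at infinity of the term of \<open>f\<close> that contains
  \<open>y ^ i\<close>.\<close>

definition weight :: "'b poly poly \<Rightarrow> nat \<Rightarrow> nat" where
  "weight f i = p * degree (coeff f i) + r * i"

definition leading :: "'b poly poly \<Rightarrow> nat \<Rightarrow> bool" where
  "leading f j \<longleftrightarrow> j < p \<and> coeff f j \<noteq> 0 \<and> (\<forall>i. i \<noteq> j \<longrightarrow> coeff f i \<noteq> 0 \<longrightarrow> weight f i < weight f j)"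

text \<open>As \<open>e\<close> is positive, \<open>r\<close> is 1 modulo \<open>p\<close>, so the
  exponent of \<open>y\<close> can be read off the weight modulo \<open>p\<close>.\<close>

lemma weight_distinct:
  assumes "p * d + r * i = p * d' + r * j" "i < p" "j < p"
  shows "i = j \<and> d = d'"
proof -
  have *: "(p * d + r * i) mod p = i" if "i < p" for d i
  proof -
    have "p * d + r * i = i + p * (d + p ^ (e - 1) * i)"
      using e unfolding r_def by (cases e) (auto simp: algebra_simps)
    then show ?thesis using that by simp
  qed
  have "i = j" using *[OF assms(2), of d] *[OF assms(3), of d'] assms(1) by simp
  then show ?thesis using assms(1) p_gt_1 by simp
qed

lemma leading_exists:
  assumes "f \<noteq> 0" "degree f < p"
  shows "\<exists>j. leading f j"
proof -
  define I where "I = {i. coeff f i \<noteq> 0}"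
  have I: "I \<subseteq> {..degree f}" by (auto simp: I_def le_degree)
  then have fin: "finite I" using finite_subset by blast
  have "I \<noteq> {}" using assms by (auto simp: I_def) (metis leading_coeff_0_iff)
  then have "Max (weight f ` I) \<in> weight f ` I" using fin by (intro Max_in) auto
  then obtain j where "j \<in> I" "Max (weight f ` I) = weight f j" by blast
  with fin have j: "j \<in> I" "\<And>i. i \<in> I \<Longrightarrow> weight f i \<le> weight f j"
    using Max_ge[of "weight f ` I"] by auto
  have "weight f i < weight f j" if "i \<in> I" "i \<noteq> j" for i
  proof -
    have "i < p" "j < p" using subsetD[OF I that(1)] subsetD[OF I j(1)] assms(2) by auto
    then have "weight f i \<noteq> weight f j" using weight_distinct that(2) unfolding weight_def by blast
    then show ?thesis using j(2)[OF that(1)] by simp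
  qed
  then show ?thesis using j(1) I assms unfolding leading_def I_def by (intro exI[of _ j]) force
qed

end

locale curve_place = artin_schreier_curve +
  fixes V :: "'a set"
  assumes V_valuation: "valuation_ring_in K V" and k_V: "k \<subseteq> V"
begin

sublocale valued_field K V
  by standard (rule subfield_K, rule V_valuation)

lemma k_unit: "c \<in> k \<Longrightarrow> c \<noteq> 0 \<Longrightarrow> c \<in> V - \<mm>"
  using k_V k_inverse by (auto simp: max_ideal_def)

lemma k_m: "c \<in> k \<Longrightarrow> c \<in> \<mm> \<Longrightarrow> c = 0"
  using k_unit by blast

lemma poly2_V:
  "f \<in> P2 \<Longrightarrow> u \<in> V \<Longrightarrow> v \<in> V \<Longrightarrow> poly2 f u v \<in> V"
  by (rule poly2_in_subring_set[OF V_ring k_V])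

text \<open>\<open>y\<close> is integral over \<open>k[x]\<close>: if \<open>inverse y\<close> were
  in the maximal ideal, dividing the equation by \<open>y ^ p\<close> would put 1 there too.\<close>

lemma y_V: 
  assumes "x \<in> V"
  shows "y \<in> V"
proof (rule ccontr)
  assume "y \<notin> V"
  then have i: "inverse y \<in> \<mm>" and y0: "y \<noteq> 0"
    using inverse_m[OF y_K] subring_set_zero[OF V_ring] by auto
  have "xR \<in> poly_over V" using poly_over_mono[OF k_V] xR_P1 by auto
  then have "poly xR x \<in> V" by (rule poly_in_subring_set[OF V_ring _ assms])
  moreover have "y ^ p - y = poly xR x" by (simp add: equation poly_xR)
  ultimately have "inverse y ^ p * (y ^ p - y) \<in> \<mm>"
    using power_in_m[OF i, of p] p_gt_1 m_mult by simp
  moreover have "inverse y ^ p * (y ^ p - y) = 1 - inverse y ^ (p - 1)"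
    using y0 p_gt_1 by (simp add: right_diff_distrib flip: power_mult_distrib)
      (simp add: power_diff field_simps)
  ultimately have "1 - inverse y ^ (p - 1) \<in> \<mm>" by simp
  from m_add[OF this power_in_m[OF i, of "p - 1"]] have "1 \<in> \<mm>" using p_gt_1 by simp
  then show False using one_not_m by simp
qed

end

section \<open>The place at infinity\<close>

locale infinite_place = curve_place +
  assumes x_V: "x \<notin> V"
begin

lemma inverse_x: "inverse x \<in> \<mm>"
  by (rule inverse_m[OF x_K x_V])

lemma poly_x_asymp: "f \<in> P1 \<Longrightarrow> poly f x / x ^ degree f - lead_coeff f \<in> \<mm>"
proof (induction f)
  case 0
  then show ?case using zero_m by simp
next
  case (pCons c f)
  then have c: "c \<in> k" and f: "f \<in> P1" by (auto simp: pCons_in_poly_over)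
  show ?case
  proof (cases "f = 0")
    case True
    then show ?thesis using zero_m by simp
  next
    case False
    have "poly (pCons c f) x / x ^ degree (pCons c f) - lead_coeff (pCons c f) =
        c * inverse x ^ Suc (degree f) + (poly f x / x ^ degree f - lead_coeff f)"
      using False x_nonzero by (simp add: field_simps)
    also have "\<dots> \<in> \<mm>"
      using c k_V by (intro m_add pCons.IH[OF f] m_mult' power_in_m inverse_x) auto
    finally show ?thesis .
  qed
qed

lemma poly_x_unit:
  assumes "f \<in> P1" "f \<noteq> 0"
  shows "poly f x / x ^ degree f \<in> V - \<mm>"
  by (rule congruent_unit[OF _ poly_x_asymp[OF assms(1)]], rule k_unit)
    (use assms in \<open>auto simp: poly_over_coeff\<close>)

lemma y_not_V: "y \<notin> V"
proof
  assume y: "y \<in> V"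
  have "xR \<noteq> 0" using lead_coeff_xR a_e by auto
  then have u: "poly xR x / x ^ r \<in> V - \<mm>" using poly_x_unit[OF xR_P1] by (simp add: degree_xR)
  have "y ^ p - y = poly xR x" by (simp add: equation poly_xR)
  then have xV: "poly xR x \<in> V" using y V_ring by (metis subring_set_diff subring_set_power)
  have "inverse x ^ r * poly xR x \<in> \<mm>"
    by (intro m_mult power_in_m inverse_x xV) (simp add: r_def)
  then show False using u by (simp add: field_simps)
qed

lemma y_nonzero: "y \<noteq> 0"
  using y_not_V subring_set_zero[OF V_ring] by auto

text \<open>This pins down the valuation of \<open>y\<close> against that of \<open>x\<close>. In
  \<open>y ^ p - y = y ^ p * (1 - h)\<close> the second factor is a unit because \<open>y\<close>
  has a pole, and \<open>x R(x)\<close> is a unit times \<open>x ^ r\<close>.\<close>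

lemma ratio_unit: "y ^ p / x ^ r \<in> V - \<mm>"
proof -
  have i: "inverse y \<in> \<mm>" by (rule inverse_m[OF y_K y_not_V])
  define h where "h = inverse y ^ (p - 1)"
  have h: "h \<in> \<mm>" unfolding h_def using p_gt_1 by (intro power_in_m i) simp
  have "1 - h \<in> V - \<mm>"
    by (rule congruent_unit[of 1]) (use one_not_m V_ring h m_uminus in \<open>auto intro: subring_set_one\<close>)
  then have u: "inverse (1 - h) \<in> V - \<mm>" "1 - h \<noteq> 0" using not_m_inverse unit_inverse by blast+
  have "xR \<noteq> 0" using lead_coeff_xR a_e by auto
  then have "poly xR x / x ^ r \<in> V - \<mm>" using poly_x_unit[OF xR_P1] by (simp add: degree_xR)
  then have "poly xR x / x ^ r * inverse (1 - h) \<in> V - \<mm>" using u not_m_mult by blast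
  moreover have "poly xR x = y ^ p - y" by (simp add: equation poly_xR)
  moreover have "y ^ p - y = y ^ p * (1 - h)"
    using y_nonzero p_gt_1 by (simp add: h_def right_diff_distrib power_diff field_simps)
  ultimately have "y ^ p * (1 - h) / x ^ r * inverse (1 - h) \<in> V - \<mm>" by (simp only:)
  moreover have "y ^ p * (1 - h) / x ^ r * inverse (1 - h) = y ^ p / x ^ r"
    using u(2) by simp
  ultimately show ?thesis by (simp only:)
qed

text \<open>With no value group at hand, the quotient is raised to the power \<open>p\<close>:
  replacing \<open>y ^ p\<close> by a unit times \<open>x ^ r\<close> leaves a unit times a positive
  power of \<open>inverse x\<close>.\<close>

lemma monomial_less:
  assumes less: "p * d + r * j < p * d' + r * j'"
  shows "x ^ d * y ^ j / (x ^ d' * y ^ j') \<in> \<mm>"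
proof (rule root_in_m)
  define A where "A = y ^ p / x ^ r"
  have A: "A \<in> V - \<mm>" unfolding A_def by (rule ratio_unit)
  have yp: "y ^ p = A * x ^ r" using x_nonzero by (simp add: A_def)
  have A0: "A \<noteq> 0" using A unit_inverse by blast
  have yj: "(y ^ j) ^ p = A ^ j * x ^ (r * j)" for j
    by (metis yp power_mult power_mult_distrib mult.commute)
  have "(x ^ d * y ^ j / (x ^ d' * y ^ j')) ^ p =
    A ^ j * inverse A ^ j' * (x ^ (p * d + r * j) / x ^ (p * d' + r * j'))"
    unfolding power_divide power_mult_distrib yj power_add
    by (simp add: power_mult[symmetric] mult.commute[of p] divide_inverse power_inverse mult_ac)
  also have "x ^ (p * d + r * j) / x ^ (p * d' + r * j') =
      inverse x ^ (p * d' + r * j' - (p * d + r * j))"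
    using less x_nonzero by (simp add: power_diff field_simps)
  also have "A ^ j * inverse A ^ j' * \<dots> \<in> \<mm>"
    using less A not_m_inverse[OF A] not_m_power not_m_mult
    by (intro m_mult' power_in_m inverse_x) (blast, simp)
  finally show "(x ^ d * y ^ j / (x ^ d' * y ^ j')) ^ p \<in> \<mm>" .
  show "x ^ d * y ^ j / (x ^ d' * y ^ j') \<in> K"
    by (intro K_divide subring_set_mult K_ring subring_set_power x_K y_K)
  show "0 < p" using p_gt_1 by simp
qed

lemma poly2_asymp:
  assumes f: "f \<in> P2" and j: "leading f j"
  shows "poly2 f x y / (x ^ degree (coeff f j) * y ^ j) - lead_coeff (coeff f j) \<in> \<mm>"
proof -
  define d where "d = degree (coeff f j)"
  define T where "T i = poly (coeff f i) x * y ^ i / (x ^ d * y ^ j)" for i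
  have jd: "j \<le> degree f" using j by (auto simp: leading_def le_degree)
  have c: "coeff f i \<in> P1" for i using f by (simp add: poly_over_coeff)
  have "poly2 f x y / (x ^ d * y ^ j) = (\<Sum>i\<le>degree f. T i)"
    by (simp add: poly2_altdef T_def sum_divide_distrib)
  also have "\<dots> = T j + (\<Sum>i\<in>{..degree f} - {j}. T i)"
    using jd by (simp add: sum.remove)
  finally have eq: "poly2 f x y / (x ^ d * y ^ j) - lead_coeff (coeff f j) =
      (T j - lead_coeff (coeff f j)) + (\<Sum>i\<in>{..degree f} - {j}. T i)" by simp
  have "T j = poly (coeff f j) x / x ^ d" using y_nonzero by (simp add: T_def)
  then have "T j - lead_coeff (coeff f j) \<in> \<mm>" using poly_x_asymp[OF c, of j] by (simp add: d_def)
  moreover have "T i \<in> \<mm>" if "i \<noteq> j" for i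
  proof (cases "coeff f i = 0")
    case True
    then show ?thesis using zero_m by (simp add: T_def)
  next
    case False
    then have "weight f i < weight f j" using j that by (auto simp: leading_def)
    then have "x ^ degree (coeff f i) * y ^ i / (x ^ d * y ^ j) \<in> \<mm>"
      by (intro monomial_less) (simp add: weight_def d_def)
    moreover have "poly (coeff f i) x / x ^ degree (coeff f i) \<in> V"
      using poly_x_unit[OF c False] by blast
    ultimately have "poly (coeff f i) x / x ^ degree (coeff f i) *
        (x ^ degree (coeff f i) * y ^ i / (x ^ d * y ^ j)) \<in> \<mm>" by (intro m_mult')
    then show ?thesis using x_nonzero by (simp add: T_def)
  qed
  ultimately have "(T j - lead_coeff (coeff f j)) + (\<Sum>i\<in>{..degree f} - {j}. T i) \<in> \<mm>"
    by (intro m_add m_sum) (auto simp: d_def)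
  then show ?thesis unfolding eq[symmetric] by (simp only: d_def)
qed

lemma poly2_unit:
  assumes f: "f \<in> P2" and j: "leading f j"
  shows "poly2 f x y / (x ^ degree (coeff f j) * y ^ j) \<in> V - \<mm>"
  by (rule congruent_unit[OF _ poly2_asymp[OF assms]], rule k_unit)
    (use assms in \<open>auto simp: poly_over_coeff leading_def\<close>)

text \<open>Only the heaviest term of \<open>f\<close> and the degree of \<open>c\<close> matter, so
  the criterion is the same at every infinite place. Equality of weights forces
  \<open>j = 0\<close>, and the residue is then a ratio of leading coefficients, hence in
  \<open>k\<close>. Uniqueness and rationality of the infinite place rest on these two
  facts.\<close>

lemma quotient_classify:
  assumes f: "f \<in> P2" and j: "leading f j" and c: "c \<in> P1" "c \<noteq> 0"
  shows "poly2 f x y / poly c x \<in> V \<longleftrightarrow> weight f j \<le> p * degree c"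
    and "poly2 f x y / poly c x \<in> V \<Longrightarrow> \<exists>b\<in>k. poly2 f x y / poly c x - b \<in> \<mm>"
proof -
  define d where "d = degree (coeff f j)"
  define d' where "d' = degree c"
  define u1 where "u1 = poly2 f x y / (x ^ d * y ^ j)"
  define u2 where "u2 = poly c x / x ^ d'"
  define v where "v = x ^ d * y ^ j / (x ^ d' * y ^ 0)"
  define z where "z = poly2 f x y / poly c x"
  have u1: "u1 \<in> V - \<mm>" unfolding u1_def d_def by (rule poly2_unit[OF f j])
  have u2: "u2 \<in> V - \<mm>" unfolding u2_def d'_def by (rule poly_x_unit[OF c])
  have iu2: "inverse u2 \<in> V - \<mm>" by (rule not_m_inverse[OF u2])
  have zv: "z = u1 * inverse u2 * v"
    using x_nonzero y_nonzero by (simp add: z_def u1_def u2_def v_def field_simps)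
  have w: "weight f j = p * d + r * j" by (simp add: weight_def d_def)
  have uu: "u1 * inverse u2 \<in> V - \<mm>" by (rule not_m_mult[OF u1 iu2])
  consider "p * d + r * j < p * d'" | "p * d + r * j = p * d'" | "p * d' < p * d + r * j" by linarith
  then have "(z \<in> V \<longleftrightarrow> weight f j \<le> p * d') \<and> (z \<in> V \<longrightarrow> (\<exists>b\<in>k. z - b \<in> \<mm>))"
  proof cases
    case 1
    then have "v \<in> \<mm>" unfolding v_def by (intro monomial_less) simp
    then have "z \<in> \<mm>" unfolding zv using uu by (intro m_mult') auto
    then show ?thesis using 1 w m_V subring_set_zero[OF k_ring] by (auto intro!: bexI[of _ 0])
  next
    case 2
    then have "j = 0 \<and> d = d'" using weight_distinct[of d j d' 0] j p_gt_1 by (simp add: leading_def)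
    then have "v = 1" using x_nonzero by (simp add: v_def)
    then have z: "z = u1 * inverse u2" using zv by simp
    define b1 where "b1 = lead_coeff (coeff f j)"
    define b2 where "b2 = lead_coeff c"
    have b: "b1 \<in> k" "b2 \<in> k" "b2 \<noteq> 0" using f c by (auto simp: b1_def b2_def poly_over_coeff)
    have m1: "u1 - b1 \<in> \<mm>" unfolding u1_def d_def b1_def by (rule poly2_asymp[OF f j])
    have m2: "u2 - b2 \<in> \<mm>" unfolding u2_def d'_def b2_def by (rule poly_x_asymp[OF c(1)])
    have b2: "b2 \<in> V - \<mm>" using b k_unit by blast
    have "z - b1 * inverse b2 = ((u1 - b1) * b2 - b1 * (u2 - b2)) * (inverse u2 * inverse b2)"
      using u2 b unit_inverse[of u2] unfolding z by (auto simp: field_simps)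
    also have "\<dots> \<in> \<mm>"
      using m1 m2 b b2 k_V iu2 not_m_inverse[OF b2] V_ring
      by (intro m_mult[OF m_diff] m_mult m_mult' subring_set_mult) auto
    finally have "z - b1 * inverse b2 \<in> \<mm>" .
    moreover have "b1 * inverse b2 \<in> k" using b k_inverse k_ring by (auto intro: subring_set_mult)
    ultimately show ?thesis using 2 w z uu by auto
  next
    case 3
    have "inverse v = x ^ d' * y ^ 0 / (x ^ d * y ^ j)" by (simp add: v_def)
    also have "\<dots> \<in> \<mm>" by (rule monomial_less) (use 3 in simp)
    finally have iv: "inverse v \<in> \<mm>" .
    have "z \<notin> V"
    proof
      assume "z \<in> V"
      then have "z * inverse v \<in> \<mm>" using iv by (intro m_mult')
      moreover have "z * inverse v = u1 * inverse u2"
        using x_nonzero y_nonzero unfolding zv v_def by simp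
      ultimately show False using uu by simp
    qed
    then show ?thesis using 3 w by auto
  qed
  then show "poly2 f x y / poly c x \<in> V \<longleftrightarrow> weight f j \<le> p * degree c"
    and "poly2 f x y / poly c x \<in> V \<Longrightarrow> \<exists>b\<in>k. poly2 f x y / poly c x - b \<in> \<mm>"
    unfolding z_def d'_def by auto
qed

end

section \<open>Reduction modulo the equation, and uniqueness of the infinite place\<close>

context artin_schreier_curve
begin

text \<open>Irreducibility of the equation over \<open>k(x)\<close>, seen at a single infinite
  place: \<open>f\<close>, divided by its leading monomial, takes a unit value there.\<close>

lemma poly2_nonzero:
  assumes "f \<in> P2" "f \<noteq> 0" "degree f < p"
  shows "poly2 f x y \<noteq> 0"
proof
  assume 0: "poly2 f x y = 0"
  obtain V where "valuation_ring_in K V" "k \<subseteq> V" "x \<notin> V" using infinite_valuation_ring_exists by blast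
  then interpret infinite_place k x y p m e a V by unfold_locales
  obtain j where "leading f j" using leading_exists assms by blast
  from poly2_unit[OF assms(1) this] zero_m show False by (simp add: 0)
qed

lemma reduce_mod_rel:
  assumes "f \<in> P2"
  shows "\<exists>Q\<in>P2. \<exists>R\<in>P2. f = rel * Q + R \<and> (R = 0 \<or> degree R < p)"
proof -
  have "rel \<noteq> 0" using lead_coeff_rel by auto
  from pseudo_division[OF P1_ring assms rel_P2 this] show ?thesis
    unfolding lead_coeff_rel by (simp add: degree_rel)
qed

lemma poly2_rel_xy: "poly2 rel x y = 0"
  by (simp add: poly2_rel equation)

text \<open>Every relation between \<open>x\<close> and \<open>y\<close> is a multiple of the
  equation and so holds at every point; evaluation at a point is thereby well defined on
  \<open>k[x, y]\<close>.\<close>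

lemma poly2_vanishing:
  assumes "f \<in> P2" "poly2 f x y = 0" "v ^ p - v = u * R_fun p e a u"
  shows "poly2 f u v = 0"
proof -
  obtain Q R where QR: "R \<in> P2" "f = rel * Q + R" "R = 0 \<or> degree R < p"
    using reduce_mod_rel[OF assms(1)] by blast
  have "poly2 R x y = 0" using assms(2) by (simp add: QR(2) poly2_rel_xy)
  then have "R = 0" using poly2_nonzero QR by blast
  then show ?thesis using assms(3) by (simp add: QR(2) poly2_rel)
qed

text \<open>Some nonzero multiple in \<open>k[x]\<close> suffices, not the norm itself.
  Pseudo-dividing the equation by \<open>f\<close> shows that \<open>f\<close> divides the remainder
  modulo the equation, and the remainder has smaller \<open>y\<close>-degree.\<close>

lemma norm_reduced:
  assumes "f \<in> P2" "f \<noteq> 0" "degree f < p"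
  shows "\<exists>g\<in>P2. \<exists>c\<in>P1. c \<noteq> 0 \<and> poly2 f x y * poly2 g x y = poly c x"
  using assms
proof (induction "degree f" arbitrary: f rule: less_induct)
  case less
  show ?case
  proof (cases "degree f = 0")
    case True
    then obtain c where "f = [:c:]" by (elim degree_eq_zeroE)
    then show ?thesis using less.prems subring_set_one[OF P2_ring]
      by (intro bexI[of _ 1] bexI[of _ c]) (auto simp: pCons_in_poly_over)
  next
    case False
    obtain N Q R where NQR: "Q \<in> P2" "R \<in> P2" "smult (lead_coeff f ^ N) rel = f * Q + R"
      "R = 0 \<or> degree R < degree f"
      using pseudo_division[OF P1_ring rel_P2 less.prems(1,2)] by blast
    have eq: "poly2 f x y * poly2 Q x y = - poly2 R x y"
      using arg_cong[OF NQR(3), of "\<lambda>h. poly2 h x y"] by (simp add: poly2_rel_xy eq_neg_iff_add_eq_0)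
    \<comment> \<open>A zero remainder would factor the equation, and \<open>Q\<close>, of degree
      below \<open>p\<close>, would vanish at \<open>(x, y)\<close>.\<close>
    have "R \<noteq> 0"
    proof
      assume R: "R = 0"
      then have fQ: "smult (lead_coeff f ^ N) rel = f * Q" using NQR by simp
      then have "poly2 Q x y = 0" using eq poly2_nonzero less.prems by (simp add: R)
      moreover have "smult (lead_coeff f ^ N) rel \<noteq> 0"
        using less.prems lead_coeff_rel by (auto simp: smult_eq_0_iff)
      then have "Q \<noteq> 0" "f \<noteq> 0" using fQ by auto
      moreover have "degree f + degree Q = p"
        using arg_cong[OF fQ, of degree] less.prems(2) \<open>Q \<noteq> 0\<close>
        by (simp add: degree_mult_eq degree_rel degree_smult_eq)
      then have "degree Q < p" using False by simp
      ultimately show False using poly2_nonzero NQR by blast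
    qed
    then obtain g c where g: "g \<in> P2" "c \<in> P1" "c \<noteq> 0" "poly2 R x y * poly2 g x y = poly c x"
      using less.hyps[of R] NQR less.prems by auto
    have "poly2 f x y * poly2 (- (Q * g)) x y = poly c x"
      using eq g(4) by (simp flip: mult.assoc)
    moreover have "- (Q * g) \<in> P2" using NQR g P2_ring by (intro subring_set_intros)
    ultimately show ?thesis using g by blast
  qed
qed

lemma norm_exists:
  assumes "f \<in> P2" "poly2 f x y \<noteq> 0"
  shows "\<exists>g\<in>P2. \<exists>c\<in>P1. c \<noteq> 0 \<and> poly2 f x y * poly2 g x y = poly c x"
proof -
  obtain Q R where QR: "R \<in> P2" "f = rel * Q + R" "R = 0 \<or> degree R < p"
    using reduce_mod_rel[OF assms(1)] by blast
  have "poly2 f x y = poly2 R x y" by (simp add: QR(2) poly2_rel_xy)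
  moreover from this assms(2) have "R \<noteq> 0" by auto
  ultimately show ?thesis using norm_reduced[OF QR(1)] QR(3) by simp
qed

lemma poly_x_nonzero: "c \<in> P1 \<Longrightarrow> c \<noteq> 0 \<Longrightarrow> poly c x \<noteq> 0"
  using transcendental by blast

lemma K_normal_form:
  assumes "z \<in> K" "z \<noteq> 0"
  shows "\<exists>f\<in>P2. \<exists>c\<in>P1. f \<noteq> 0 \<and> degree f < p \<and> c \<noteq> 0 \<and> z = poly2 f x y / poly c x"
proof -
  obtain f g where fg: "f \<in> P2" "g \<in> P2" "z = poly2 f x y / poly2 g x y" using assms by (auto simp: K_def)
  then have nz: "poly2 g x y \<noteq> 0" using assms by auto
  obtain h c where h: "h \<in> P2" "c \<in> P1" "c \<noteq> 0" "poly2 g x y * poly2 h x y = poly c x"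
    using norm_exists[OF fg(2) nz] by blast
  have c0: "poly c x \<noteq> 0" by (rule poly_x_nonzero[OF h(2,3)])
  then have h0: "poly2 h x y \<noteq> 0" using h(4) by auto
  have "f * h \<in> P2" using fg h by (intro subring_set_mult[OF P2_ring])
  then obtain Q R where QR: "R \<in> P2" "f * h = rel * Q + R" "R = 0 \<or> degree R < p"
    using reduce_mod_rel by blast
  have "poly2 (f * h) x y = poly2 R x y" by (simp only: QR(2)) (simp add: poly2_rel_xy)
  moreover have "z = poly2 (f * h) x y / poly c x" using fg(3) h0 by (simp flip: h(4))
  ultimately have "z = poly2 R x y / poly c x" by simp
  moreover from this assms have "R \<noteq> 0" by auto
  ultimately show ?thesis using QR h by blast
qed

definition infinite_places :: "'b set set" where
  "infinite_places = {V. valuation_ring_in K V \<and> k \<subseteq> V \<and> x \<notin> V}"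

text \<open>In normal form, membership is decided by \<open>quotient_classify\<close>, whose
  criterion does not refer to the place.\<close>

lemma infinite_places_singleton: "\<exists>V. infinite_places = {V}"
proof -
  have "V1 \<subseteq> V2" if V1: "V1 \<in> infinite_places" and V2: "V2 \<in> infinite_places" for V1 V2
  proof
    interpret V1: infinite_place k x y p m e a V1
      using V1 by unfold_locales (auto simp: infinite_places_def)
    interpret V2: infinite_place k x y p m e a V2
      using V2 by unfold_locales (auto simp: infinite_places_def)
    fix z assume z: "z \<in> V1"
    show "z \<in> V2"
    proof (cases "z = 0")
      case True
      then show ?thesis using subring_set_zero[OF V2.V_ring] by simp
    next
      case False
      then obtain f c where f: "f \<in> P2" "c \<in> P1" "f \<noteq> 0" "degree f < p" "c \<noteq> 0" "z = poly2 f x y / poly c x"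
        using K_normal_form V1.V_sub[OF z] by blast
      then obtain j where j: "leading f j" using leading_exists by blast
      show ?thesis
        using V1.quotient_classify(1)[OF f(1) j f(2,5)] V2.quotient_classify(1)[OF f(1) j f(2,5)] z f(6)
        by simp
    qed
  qed
  moreover obtain V where "V \<in> infinite_places"
    using infinite_valuation_ring_exists by (auto simp: infinite_places_def)
  ultimately show ?thesis by blast
qed

lemma infinite_place_rational:
  assumes V: "V \<in> infinite_places"
  shows "\<forall>z\<in>V. \<exists>b\<in>k. z - b \<in> max_ideal V"
proof
  interpret infinite_place k x y p m e a V
    using V by unfold_locales (auto simp: infinite_places_def)
  fix z assume z: "z \<in> V"
  show "\<exists>b\<in>k. z - b \<in> \<mm>"
  proof (cases "z = 0")
    case True
    then show ?thesis using zero_m subring_set_zero[OF k_ring] by (intro bexI[of _ 0]) auto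
  next
    case False
    then obtain f c where f: "f \<in> P2" "c \<in> P1" "f \<noteq> 0" "degree f < p" "c \<noteq> 0" "z = poly2 f x y / poly c x"
      using K_normal_form V_sub[OF z] by blast
    then obtain j where j: "leading f j" using leading_exists by blast
    show ?thesis
      using quotient_classify(2)[OF f(1) j f(2,5)] z f(6) by simp
  qed
qed

definition points :: "('b \<times> 'b) set" where
  "points = {(u, v). u \<in> k \<and> v \<in> k \<and> v ^ p - v = u * R_fun p e a u}"

definition local_ring :: "'b \<times> 'b \<Rightarrow> 'b set" where
  "local_ring P = {poly2 f x y / poly2 g x y | f g.
     f \<in> P2 \<and> g \<in> P2 \<and> poly2 g (fst P) (snd P) \<noteq> 0}"

end

section \<open>The local ring of an affine point\<close>

locale curve_point = artin_schreier_curve +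
  fixes x0 y0 :: 'a
  assumes point: "(x0, y0) \<in> points"
begin

lemma x0: "x0 \<in> k" and y0: "y0 \<in> k" and point_equation: "y0 ^ p - y0 = x0 * R_fun p e a x0"
  using point by (auto simp: points_def)

abbreviation "val f \<equiv> poly2 f x0 y0"

lemma vanishing: "f \<in> P2 \<Longrightarrow> poly2 f x y = 0 \<Longrightarrow> val f = 0"
  by (rule poly2_vanishing[OF _ _ point_equation])

text \<open>The cofactor in \<open>(y - y0) ^ p - (y - y0) = (y - y0) * W\<close>. By additivity of
  the \<open>p\<close>-th power the left side is \<open>x R(x) - x0 R(x0)\<close>, which is
  divisible by \<open>x - x0\<close>.\<close>

definition W where "W = [:[:- y0:], 1:] ^ (p - 1) - 1"

lemma W_P2: "W \<in> P2"
  unfolding W_def using y0 k_ring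
  by (intro subring_set_intros P2_ring linear_P2 const_P1)

lemma val_W: "val W = - 1"
  using p_gt_1 by (simp add: W_def power_0_left)

text \<open>As \<open>(y - y0) * W\<close> is a multiple of \<open>x - x0\<close> and \<open>W\<close> is a unit at the point, \<open>x - x0\<close> is a
  local parameter there.\<close>

lemma extract_parameter:
  assumes f: "f \<in> P2" and f0: "val f = 0"
  shows "\<exists>g\<in>P2. poly2 W x y * poly2 f x y = (x - x0) * poly2 g x y"
proof -
  obtain g where g: "g \<in> P2" "f = [:poly f [:y0:]:] + [:- [:y0:], 1:] * g"
    using linear_division[OF P1_ring f const_P1[OF y0]] by blast
  define h where "h = poly f [:y0:]"
  have h: "h \<in> P1" unfolding h_def by (rule poly_in_subring_set[OF P1_ring f const_P1[OF y0]])
  have "poly h x0 = 0" using f0 by (simp add: h_def poly2_def)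
  then obtain h1 where h1: "h1 \<in> P1" "h = [:- x0, 1:] * h1"
    using linear_division[OF k_ring h x0] by auto
  obtain h2 where h2: "h2 \<in> P1" "xR = [:poly xR x0:] + [:- x0, 1:] * h2"
    using linear_division[OF k_ring xR_P1 x0] by auto
  have fxy: "poly2 f x y = (x - x0) * poly h1 x + (y - y0) * poly2 g x y"
  proof -
    have "poly2 f x y = poly h x + (y - y0) * poly2 g x y"
      by (subst g(2)) (simp add: h_def algebra_simps)
    then show ?thesis by (simp add: h1(2) algebra_simps)
  qed
  have "(y - y0) * poly2 W x y = (y - y0) ^ p - (y - y0)"
    using p_gt_1 power_minus_mult[of p "y - y0"] by (simp add: W_def right_diff_distrib mult.commute)
  also have "\<dots> = poly xR x - poly xR x0"
    using equation point_equation by (simp add: power_p_diff poly_xR algebra_simps)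
  also have "\<dots> = (x - x0) * poly h2 x"
    by (subst h2(2)) (simp add: algebra_simps)
  finally have sW: "(y - y0) * poly2 W x y = (x - x0) * poly h2 x" .
  have "poly2 W x y * poly2 f x y =
      (x - x0) * poly h1 x * poly2 W x y + ((y - y0) * poly2 W x y) * poly2 g x y"
    by (simp add: fxy algebra_simps)
  also have "\<dots> = (x - x0) * poly2 ([:h1:] * W + [:h2:] * g) x y"
    unfolding sW by (simp add: algebra_simps)
  finally have "poly2 W x y * poly2 f x y = (x - x0) * poly2 ([:h1:] * W + [:h2:] * g) x y" .
  moreover have "[:h1:] * W + [:h2:] * g \<in> P2"
    using g h1 h2 W_P2 by (intro subring_set_intros P2_ring const_P2)
  ultimately show ?thesis by blast
qed

lemma W_nonzero: "poly2 W x y \<noteq> 0"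
  using vanishing[OF W_P2] val_W by auto

lemma x_minus_x0_nonzero: "x - x0 \<noteq> 0"
  using poly_x_nonzero[OF linear_P1[OF subring_set_uminus[OF k_ring x0]]] by simp

text \<open>If \<open>val\<close> always vanished, the parameter could be extracted from
  \<open>f\<close> without end. But \<open>f\<close> has a nonzero multiple in \<open>k[x]\<close>,
  and the order of that polynomial at \<open>x0\<close> bounds the exponent.\<close>

lemma local_factorisation:
  assumes f: "f \<in> P2" "poly2 f x y \<noteq> 0"
  shows "\<exists>n. \<exists>g\<in>P2. poly2 W x y ^ n * poly2 f x y = (x - x0) ^ n * poly2 g x y \<and> val g \<noteq> 0"
proof (rule ccontr)
  assume neg: "\<not> ?thesis"
  have all: "\<exists>g\<in>P2. poly2 W x y ^ n * poly2 f x y = (x - x0) ^ n * poly2 g x y" for n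
  proof (induction n)
    case 0
    then show ?case using f by auto
  next
    case (Suc n)
    then obtain g where g: "g \<in> P2" "poly2 W x y ^ n * poly2 f x y = (x - x0) ^ n * poly2 g x y" by blast
    with neg have "val g = 0" by blast
    then obtain g' where g': "g' \<in> P2" "poly2 W x y * poly2 g x y = (x - x0) * poly2 g' x y"
      using extract_parameter g by blast
    have "poly2 W x y ^ Suc n * poly2 f x y = (x - x0) ^ n * (poly2 W x y * poly2 g x y)"
      using g(2) by (simp add: mult_ac)
    also have "\<dots> = (x - x0) ^ Suc n * poly2 g' x y" by (simp only: g'(2)) (simp add: mult_ac)
    finally show ?case using g' by blast
  qed
  obtain h c where h: "h \<in> P2" "c \<in> P1" "c \<noteq> 0" "poly2 f x y * poly2 h x y = poly c x"
    using norm_exists[OF f] by blast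
  obtain s c' where c': "c' \<in> P1" "c = [:- x0, 1:] ^ s * c'" "poly c' x0 \<noteq> 0"
    using poly_order_split[OF k_ring x0 h(2,3)] by blast
  obtain g where g: "g \<in> P2" "poly2 W x y ^ Suc s * poly2 f x y = (x - x0) ^ Suc s * poly2 g x y"
    using all by blast
  \<comment> \<open>After cancelling \<open>(x - x0) ^ s\<close>, the left side has a nonzero value
    at the point while the right side still contains \<open>x - x0\<close>.\<close>
  have "(x - x0) ^ s * (poly2 W x y ^ Suc s * poly c' x) = poly2 W x y ^ Suc s * poly c x"
    by (simp add: c'(2) mult_ac)
  also have "\<dots> = (x - x0) ^ Suc s * poly2 g x y * poly2 h x y"
    unfolding h(4)[symmetric] g(2)[symmetric] by (simp only: mult.assoc)
  also have "\<dots> = (x - x0) ^ s * ((x - x0) * poly2 g x y * poly2 h x y)" by (simp add: mult_ac)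
  finally have "poly2 W x y ^ Suc s * poly c' x = (x - x0) * poly2 g x y * poly2 h x y"
    using x_minus_x0_nonzero by simp
  then have 0: "poly2 (W ^ Suc s * [:c':] - [:[:- x0, 1:]:] * g * h) x y = 0"
    by (simp add: algebra_simps)
  have "W ^ Suc s * [:c':] - [:[:- x0, 1:]:] * g * h \<in> P2"
    using W_P2 c' g h x0 k_ring
    by (intro subring_set_intros P2_ring const_P2 linear_P1)
  from vanishing[OF this 0] show False using c'(3) by (simp add: val_W)
qed

definition D where "D = local_ring (x0, y0)"

lemma D_I:
  "f \<in> P2 \<Longrightarrow> g \<in> P2 \<Longrightarrow> val g \<noteq> 0 \<Longrightarrow>
    poly2 f x y / poly2 g x y \<in> D"
  by (auto simp: D_def local_ring_def)

lemma D_E: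
  assumes "z \<in> D"
  obtains f g where "f \<in> P2" "g \<in> P2" "val g \<noteq> 0" "z = poly2 f x y / poly2 g x y"
  using assms by (auto simp: D_def local_ring_def)

lemma val_nonzero:
  "g \<in> P2 \<Longrightarrow> val g \<noteq> 0 \<Longrightarrow> poly2 g x y \<noteq> 0"
  using vanishing by blast

lemma poly2_D: "f \<in> P2 \<Longrightarrow> poly2 f x y \<in> D"
  using D_I[of f 1] subring_set_one[OF P2_ring] by simp

lemma D_ring: "subring_set D"
  unfolding subring_set_def
proof (intro conjI ballI)
  show "1 \<in> D" using poly2_D[OF subring_set_one[OF P2_ring]] by simp
  fix u v assume "u \<in> D" "v \<in> D"
  then obtain f g f' g' where fg: "f \<in> P2" "g \<in> P2" "val g \<noteq> 0" "u = poly2 f x y / poly2 g x y"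
    "f' \<in> P2" "g' \<in> P2" "val g' \<noteq> 0" "v = poly2 f' x y / poly2 g' x y" by (metis D_E)
  have "u - v = poly2 (f * g' - f' * g) x y / poly2 (g * g') x y"
    using fg val_nonzero by (simp add: diff_frac_eq mult.commute)
  also have "\<dots> \<in> D" using fg P2_ring by (intro D_I subring_set_intros) auto
  finally show "u - v \<in> D" .
  have "u * v = poly2 (f * f') x y / poly2 (g * g') x y" using fg by simp
  also have "\<dots> \<in> D" using fg P2_ring by (intro D_I subring_set_intros) auto
  finally show "u * v \<in> D" .
qed

text \<open>\<open>D\<close> is a discrete valuation ring with parameter \<open>x - x0\<close>. The
  exponent is an integer; its negative case is expressed through \<open>inverse z\<close>.\<close>

lemma K_factorisation:
  assumes "z \<in> K" "z \<noteq> 0"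
  shows "\<exists>n. \<exists>u. u \<in> D \<and> inverse u \<in> D \<and> u \<noteq> 0 \<and> (z = (x - x0) ^ n * u \<or> 0 < n \<and> inverse z = (x - x0) ^ n * u)"
proof -
  obtain f g where fg: "f \<in> P2" "g \<in> P2" "z = poly2 f x y / poly2 g x y" using assms by (auto simp: K_def)
  then have nz: "poly2 f x y \<noteq> 0" "poly2 g x y \<noteq> 0" using assms by auto
  obtain i f1 where f1: "f1 \<in> P2" "poly2 W x y ^ i * poly2 f x y = (x - x0) ^ i * poly2 f1 x y" "val f1 \<noteq> 0"
    using local_factorisation fg nz by blast
  obtain j g1 where g1: "g1 \<in> P2" "poly2 W x y ^ j * poly2 g x y = (x - x0) ^ j * poly2 g1 x y" "val g1 \<noteq> 0"
    using local_factorisation fg nz by blast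
  define u where "u = poly2 (f1 * W ^ j) x y / poly2 (g1 * W ^ i) x y"
  have P: "f1 * W ^ j \<in> P2" "g1 * W ^ i \<in> P2" using f1 g1 W_P2 P2_ring by (auto intro!: subring_set_intros)
  have v: "val (f1 * W ^ j) \<noteq> 0" "val (g1 * W ^ i) \<noteq> 0" using f1 g1 by (auto simp: val_W)
  have u: "u \<in> D" unfolding u_def using P v by (intro D_I)
  have "inverse u = poly2 (g1 * W ^ i) x y / poly2 (f1 * W ^ j) x y" by (simp add: u_def)
  also have "\<dots> \<in> D" using P v by (intro D_I)
  finally have iu: "inverse u \<in> D" .
  have u0: "u \<noteq> 0" unfolding u_def using val_nonzero[OF P(1) v(1)] val_nonzero[OF P(2) v(2)] by simp
  have f': "poly2 f x y = (x - x0) ^ i * poly2 f1 x y / poly2 W x y ^ i"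
    using f1(2) W_nonzero by (simp add: field_simps)
  have g': "poly2 g x y = (x - x0) ^ j * poly2 g1 x y / poly2 W x y ^ j"
    using g1(2) W_nonzero by (simp add: field_simps)
  have z: "z = (x - x0) ^ i / (x - x0) ^ j * u"
    unfolding fg(3) f' g' u_def by (simp add: mult_ac)
  show ?thesis
  proof (cases "j \<le> i")
    case True
    then have "z = (x - x0) ^ (i - j) * u" unfolding z using x_minus_x0_nonzero by (simp add: power_diff)
    then show ?thesis using u iu u0 by blast
  next
    case False
    then have "inverse z = (x - x0) ^ (j - i) * inverse u"
      unfolding z using x_minus_x0_nonzero by (simp add: power_diff field_simps)
    then show ?thesis using u iu u0 False by (intro exI[of _ "j - i"] exI[of _ "inverse u"]) auto
  qed
qed

lemma parameter_D: "x - x0 \<in> D"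
  using poly2_D[OF const_P2[OF linear_P1[OF subring_set_uminus[OF k_ring x0]]]] by simp

lemma D_valuation: "valuation_ring_in K D"
  unfolding valuation_ring_in_def
proof (intro conjI ballI D_ring)
  show "D \<subseteq> K" by (auto simp: D_def local_ring_def K_def)
  fix z assume z: "z \<in> K"
  show "z \<in> D \<or> inverse z \<in> D"
  proof (cases "z = 0")
    case True
    then show ?thesis using subring_set_zero[OF D_ring] by simp
  next
    case False
    then show ?thesis
      using K_factorisation[OF z] D_ring parameter_D by (metis subring_set_mult subring_set_power)
  qed
qed

lemma k_D: "k \<subseteq> D"
  using poly2_D[OF const_P2[OF const_P1]] by auto

lemma D_max_ideal:
  assumes "f \<in> P2" "g \<in> P2" "val f = 0" "val g \<noteq> 0"
  shows "poly2 f x y / poly2 g x y \<in> max_ideal D"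
proof -
  have "inverse (poly2 f x y / poly2 g x y) \<notin> D" if nz: "poly2 f x y \<noteq> 0"
  proof
    assume "inverse (poly2 f x y / poly2 g x y) \<in> D"
    then obtain f' g' where fg: "f' \<in> P2" "g' \<in> P2" "val g' \<noteq> 0"
      "inverse (poly2 f x y / poly2 g x y) = poly2 f' x y / poly2 g' x y" by (rule D_E)
    then have "poly2 (g * g' - f * f') x y = 0"
      using nz val_nonzero[OF fg(2,3)] by (simp add: field_simps)
    moreover have "g * g' - f * f' \<in> P2" using assms fg P2_ring by (intro subring_set_intros)
    ultimately have "val (g * g' - f * f') = 0" using vanishing by blast
    then show False using assms fg by simp
  qed
  then show ?thesis using D_I[OF assms(1,2,4)] by (auto simp: max_ideal_def)
qed

lemma D_rational: "\<forall>z\<in>D. \<exists>b\<in>k. z - b \<in> max_ideal D"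
proof
  fix z assume "z \<in> D"
  then obtain f g where fg: "f \<in> P2" "g \<in> P2" "val g \<noteq> 0" "z = poly2 f x y / poly2 g x y" by (rule D_E)
  have vk: "val h \<in> k" if "h \<in> P2" for h
    by (rule poly2_in_subring_set[OF k_ring order.refl that x0 y0])
  define b where "b = val f / val g"
  have b: "b \<in> k" unfolding b_def divide_inverse using vk fg k_inverse k_ring by (auto intro: subring_set_mult)
  have "z - b = poly2 (f - [:[:b:]:] * g) x y / poly2 g x y"
    using fg val_nonzero by (simp add: field_simps)
  also have "\<dots> \<in> max_ideal D"
    using fg b by (intro D_max_ideal subring_set_diff[OF P2_ring] subring_set_mult[OF P2_ring] const_P2 const_P1)
      (auto simp: b_def)
  finally show "\<exists>b\<in>k. z - b \<in> max_ideal D" using b by blast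
qed

lemma D_coordinates: "x - x0 \<in> max_ideal D" "y - y0 \<in> max_ideal D"
proof -
  have "[:[:- x0, 1:]:] \<in> P2" "[:[:- y0:], 1:] \<in> P2"
    using x0 y0 k_ring by (auto intro!: const_P2 linear_P1 linear_P2 const_P1 subring_set_uminus)
  from this[THEN D_max_ideal[OF _ subring_set_one[OF P2_ring]]]
  show "x - x0 \<in> max_ideal D" "y - y0 \<in> max_ideal D" by simp_all
qed

text \<open>Modulo \<open>max_ideal V\<close> a polynomial in \<open>x\<close> and \<open>y\<close>
  is congruent to its value at the point, so the denominators allowed in \<open>D\<close> are units
  of \<open>V\<close>. Conversely, an element outside \<open>D\<close> has an inverse divisible by
  the parameter, hence in \<open>max_ideal V\<close>, and cannot lie in \<open>V\<close>.\<close>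

lemma D_unique:
  assumes V: "valuation_ring_in K V" "k \<subseteq> V" and xm: "x - x0 \<in> max_ideal V" and ym: "y - y0 \<in> max_ideal V"
  shows "V = D"
proof
  interpret curve_place k x y p m e a V by unfold_locales (fact V)+
  have xV: "x \<in> V" using subring_set_add[OF V_ring m_V[OF xm], of x0] x0 k_V by auto
  then have yV: "y \<in> V" by (rule y_V)
  have x0V: "x0 \<in> V" and y0V: "y0 \<in> V" using x0 y0 k_V by auto
  have cong: "poly2 f x y - val f \<in> \<mm>" if f: "f \<in> P2" for f
  proof -
    obtain g where g: "g \<in> P2" "f = [:poly f [:y0:]:] + [:- [:y0:], 1:] * g"
      using linear_division[OF P1_ring f const_P1[OF y0]] by blast
    define h where "h = poly f [:y0:]"
    have h: "h \<in> P1" unfolding h_def by (rule poly_in_subring_set[OF P1_ring f const_P1[OF y0]])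
    obtain h1 where h1: "h1 \<in> P1" "h = [:poly h x0:] + [:- x0, 1:] * h1"
      using linear_division[OF k_ring h x0] by auto
    have "poly2 f x y = poly h x + (y - y0) * poly2 g x y"
      by (subst g(2)) (simp add: h_def algebra_simps)
    moreover have "poly h x = poly h x0 + (x - x0) * poly h1 x"
      by (subst h1(2)) (simp add: algebra_simps)
    moreover have "poly h x0 = val f" by (simp add: h_def poly2_def)
    ultimately have "poly2 f x y - val f = (x - x0) * poly h1 x + (y - y0) * poly2 g x y" by simp
    also have "\<dots> \<in> \<mm>"
      using poly2_V[OF const_P2[OF h1(1)] xV yV] poly2_V[OF g(1) xV yV] xm ym
      by (intro m_add m_mult) auto
    finally show ?thesis .
  qed
  have vk: "val h \<in> k" if "h \<in> P2" for h
    by (rule poly2_in_subring_set[OF k_ring order.refl that x0 y0])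
  show DV: "D \<subseteq> V"
  proof
    fix z assume "z \<in> D"
    then obtain f g where fg: "f \<in> P2" "g \<in> P2" "val g \<noteq> 0" "z = poly2 f x y / poly2 g x y" by (rule D_E)
    have "poly2 g x y \<in> V - \<mm>"
      by (rule congruent_unit[OF k_unit[OF vk] cong]) (use fg in auto)
    then have "inverse (poly2 g x y) \<in> V" using unit_inverse by blast
    then show "z \<in> V" unfolding fg(4) divide_inverse
      by (intro subring_set_mult[OF V_ring] poly2_V fg xV yV)
  qed
  show "V \<subseteq> D"
  proof
    fix z assume z: "z \<in> V"
    show "z \<in> D"
    proof (cases "z = 0")
      case True
      then show ?thesis using subring_set_zero[OF D_ring] by simp
    next
      case False
      from K_factorisation[OF V_sub[OF z] False] obtain n u
        where u: "u \<in> D" "inverse u \<in> D" "u \<noteq> 0"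
          "z = (x - x0) ^ n * u \<or> 0 < n \<and> inverse z = (x - x0) ^ n * u" by blast
      show ?thesis
      proof (cases "z = (x - x0) ^ n * u")
        case True
        then show ?thesis using u D_ring parameter_D by (auto intro: subring_set_mult subring_set_power)
      next
        case n: False
        then have "inverse z \<in> \<mm>" using u DV power_in_m[OF xm, of n] m_mult by auto
        then have "z * inverse z \<in> \<mm>" using z by (intro m_mult')
        then show ?thesis using False one_not_m by simp
      qed
    qed
  qed
qed

end

section \<open>Classification and number of the rational places\<close>

context artin_schreier_curve
begin

lemma rational_places_eq:
  "rational_places k K = infinite_places \<union> local_ring ` points"
proof (rule equalityI; rule subsetI)
  fix V assume V: "V \<in> rational_places k K"
  then have V1: "valuation_ring_in K V" "k \<subseteq> V" and rat: "\<forall>u\<in>V. \<exists>c\<in>k. u - c \<in> max_ideal V"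
    by (auto simp: rational_places_def valuation_rings_def valuation_ring_in_def subring_set_iff_subring)
  show "V \<in> infinite_places \<union> local_ring ` points"
  proof (cases "x \<in> V")
    case False
    then show ?thesis using V1 by (simp add: infinite_places_def)
  next
    case xV: True
    interpret curve_place k x y p m e a V by unfold_locales (fact V1)+
    have yV: "y \<in> V" by (rule y_V[OF xV])
    obtain x0 where X0: "x0 \<in> k" "x - x0 \<in> \<mm>" using rat xV by blast
    obtain y0 where Y0: "y0 \<in> k" "y - y0 \<in> \<mm>" using rat yV by blast
    have xRV: "xR \<in> poly_over V" using poly_over_mono[OF k_V] xR_P1 by auto
    obtain h where h: "h \<in> poly_over V" "xR = [:poly xR x0:] + [:- x0, 1:] * h"
      using linear_division[OF V_ring xRV] X0 k_V by blast
    \<comment> \<open>The equation is reduced modulo the maximal ideal. What remains is a constant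
      in that ideal, hence zero: the residues of \<open>x\<close> and \<open>y\<close> form a point
      of the curve.\<close>
    have "(y - y0) ^ p - (y - y0) - (x - x0) * poly h x \<in> \<mm>"
      using p_gt_1 by (intro m_diff power_in_m Y0 m_mult[OF X0(2)] poly_in_subring_set[OF V_ring h(1) xV]) auto
    moreover have "poly xR x - poly xR x0 = (x - x0) * poly h x"
      by (subst h(2)) (simp add: algebra_simps)
    then have "(x - x0) * poly h x = (y ^ p - y) - poly xR x0" by (simp add: poly_xR equation)
    ultimately have "(y - y0) ^ p - (y - y0) - ((y ^ p - y) - poly xR x0) \<in> \<mm>" by simp
    then have "poly xR x0 - (y0 ^ p - y0) \<in> \<mm>" by (simp add: power_p_diff algebra_simps)
    moreover have "poly xR x0 - (y0 ^ p - y0) \<in> k"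
      using X0 Y0 by (intro subring_set_intros k_ring poly_in_subring_set xR_P1)
    ultimately have "poly xR x0 - (y0 ^ p - y0) = 0" by (intro k_m)
    then have P: "(x0, y0) \<in> points" using X0 Y0 by (simp add: points_def poly_xR)
    then interpret curve_point k x y p m e a x0 y0 by unfold_locales
    have "V = D" by (rule D_unique[OF V1 X0(2) Y0(2)])
    then show ?thesis using P by (auto simp: D_def)
  qed
next
  \<comment> \<open>Both inclusions around a place are strict. The witness is \<open>x - c\<close>
    at a finite place and \<open>inverse x\<close> at infinity: a nonconstant member whose inverse
    is not a member.\<close>
  have proper: "k \<subset> V \<and> V \<subset> K" if VV: "valuation_ring_in K V" "k \<subseteq> V" "c \<in> k" "x - c \<in> max_ideal V \<or> x \<notin> V" for V c
  proof -
    interpret curve_place k x y p m e a V by unfold_locales (fact VV)+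
    have xk: "x - c \<notin> k" "inverse (x - c) \<notin> k" if c: "c \<in> k" for c
    proof -
      show 1: "x - c \<notin> k"
      proof
        assume "x - c \<in> k"
        then have "x \<in> k" using subring_set_add[OF k_ring, of "x - c" c] c by simp
        then have "[:- x, 1:] \<in> P1" by (intro linear_P1 subring_set_uminus k_ring)
        from transcendental[OF this] show False by simp
      qed
      show "inverse (x - c) \<notin> k" using 1 k_inverse[of "inverse (x - c)"] by auto
    qed
    have xK: "x - c \<in> K" using x_K VV(3) k_K K_ring by (auto intro: subring_set_diff)
    consider (fin) "x - c \<in> max_ideal V" | (inf) "x \<notin> V" using VV(4) by blast
    then show ?thesis
    proof cases
      case fin
      have "x - c \<noteq> 0" using xk(1)[OF VV(3)] subring_set_zero[OF k_ring] by auto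
      then have "inverse (x - c) \<notin> V" using fin by (auto simp: max_ideal_def)
      then show ?thesis using fin m_V xk(1)[OF VV(3)] K_inverse[OF xK] VV(2) V_sub by blast
    next
      case inf
      then have "inverse x \<in> V" using inverse_m m_V x_K by blast
      moreover have "inverse x \<notin> k" using xk(2)[OF subring_set_zero[OF k_ring]] by simp
      ultimately show ?thesis using inf x_K VV(2) V_sub by blast
    qed
  qed
  fix V assume "V \<in> infinite_places \<union> local_ring ` points"
  then show "V \<in> rational_places k K"
  proof
    assume V: "V \<in> infinite_places"
    then have V1: "valuation_ring_in K V" "k \<subseteq> V" "x \<notin> V" by (auto simp: infinite_places_def)
    show ?thesis
      using V1 proper[OF V1(1,2) subring_set_zero[OF k_ring]] infinite_place_rational[OF V]
      by (auto simp: rational_places_def valuation_rings_def valuation_ring_in_def subring_set_iff_subring)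
  next
    assume "V \<in> local_ring ` points"
    then obtain x0 y0 where P: "(x0, y0) \<in> points" and V: "V = local_ring (x0, y0)" by auto
    from P interpret curve_point k x y p m e a x0 y0 by unfold_locales
    show ?thesis
      using D_valuation D_rational proper[OF D_valuation k_D x0] D_coordinates
      unfolding V D_def[symmetric]
      by (auto simp: rational_places_def valuation_rings_def valuation_ring_in_def subring_set_iff_subring)
  qed
qed

text \<open>The point is recovered from its local ring as the pair of residues of \<open>x\<close>
  and \<open>y\<close>; the successor accounts for the infinite place.\<close>

lemma card_rational_places:
  assumes "finite k"
  shows "card (rational_places k K) = Suc (card points)"
proof -
  obtain V where V: "infinite_places = {V}" using infinite_places_singleton by blast
  have fin: "finite points"
    by (rule finite_subset[of _ "k \<times> k"]) (use assms in \<open>auto simp: points_def\<close>)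
  have inj: "inj_on local_ring points"
  proof (intro inj_onI)
    fix P P' assume P: "P \<in> points" and P': "P' \<in> points" and eq: "local_ring P = local_ring P'"
    obtain x0 y0 x1 y1 where P0: "P = (x0, y0)" "P' = (x1, y1)" by (metis surj_pair)
    interpret c0: curve_point k x y p m e a x0 y0 using P P0 by unfold_locales simp
    interpret c1: curve_point k x y p m e a x1 y1 using P' P0 by unfold_locales simp
    interpret curve_place k x y p m e a c0.D by unfold_locales (fact c0.D_valuation c0.k_D)+
    have D: "c1.D = c0.D" using eq by (simp add: c0.D_def c1.D_def P0)
    have "(x - x0) - (x - x1) \<in> \<mm>" "(y - y0) - (y - y1) \<in> \<mm>"
      using c0.D_coordinates c1.D_coordinates unfolding D by (blast intro: m_diff)+
    then have "x1 - x0 \<in> \<mm>" "y1 - y0 \<in> \<mm>" by simp_all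
    moreover have "x1 - x0 \<in> k" "y1 - y0 \<in> k"
      using c0.x0 c0.y0 c1.x0 c1.y0 k_ring by (auto intro: subring_set_diff)
    ultimately have "x1 - x0 = 0" "y1 - y0 = 0" using k_m by blast+
    then show "P = P'" by (simp add: P0)
  qed
  have "V \<notin> local_ring ` points"
  proof
    assume "V \<in> local_ring ` points"
    then obtain x0 y0 where P: "(x0, y0) \<in> points" and V': "V = local_ring (x0, y0)" by auto
    from P interpret curve_point k x y p m e a x0 y0 by unfold_locales
    have "x - x0 \<in> D" "x0 \<in> D" using parameter_D k_D x0 by auto
    then have "x \<in> D" using subring_set_add[OF D_ring, of "x - x0" x0] by simp
    moreover have "V \<in> infinite_places" using V by simp
    ultimately show False by (simp add: infinite_places_def V' D_def)
  qed
  then show ?thesis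
    unfolding rational_places_eq V using fin inj by (simp add: card_image)
qed

end

section \<open>The function field inside the closure of the rational function field\<close>

definition ff_poly :: "'a::field poly \<Rightarrow> 'a ff_closure" where
  "ff_poly f = to_ac (Fract f 1)"

lemma ff_poly_simps [simp]:
  "ff_poly 0 = 0" "ff_poly 1 = 1" "ff_poly (f + g) = ff_poly f + ff_poly g"
  "ff_poly (f * g) = ff_poly f * ff_poly g"
  by (simp_all add: ff_poly_def Zero_fract_def[symmetric] One_fract_def[symmetric] flip: to_ac_add to_ac_mult)

lemma ff_poly_eq_0_iff [simp]: "ff_poly f = 0 \<longleftrightarrow> f = 0"
  by (simp add: ff_poly_def Zero_fract_def eq_fract)

lemma ff_const_conv: "ff_const c = ff_poly [:c:]" and ff_x_conv: "ff_x = ff_poly [:0, 1:]"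
  by (simp_all add: ff_const_def ff_x_def ff_poly_def)

lemma ff_const_simps [simp]:
  "ff_const 0 = 0" "ff_const 1 = 1"
  "ff_const (c + d) = ff_const c + ff_const d" "ff_const (c * d) = ff_const c * ff_const d"
proof -
  show "ff_const (c + d) = ff_const c + ff_const d"
    unfolding ff_const_conv ff_poly_simps(3)[symmetric] by simp
  show "ff_const (c * d) = ff_const c * ff_const d"
    unfolding ff_const_conv ff_poly_simps(4)[symmetric] by (simp add: mult.commute)
  show "ff_const 1 = 1"
    unfolding ff_const_conv ff_poly_simps(2)[symmetric] by (simp only: one_pCons)
qed (simp add: ff_const_conv)

lemma ff_const_eq_0_iff [simp]: "ff_const c = 0 \<longleftrightarrow> c = 0"
  by (simp add: ff_const_conv)

lemma ff_const_uminus [simp]: "ff_const (- c) = - ff_const c"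
  using ff_const_simps(3)[of c "- c"] by (simp add: eq_neg_iff_add_eq_0 add.commute)

lemma ff_const_diff [simp]: "ff_const (c - d) = ff_const c - ff_const d"
  using ff_const_simps(3)[of c "- d"] by simp

lemma inj_ff_const: "inj ff_const"
proof (rule injI)
  fix c d :: 'a assume "ff_const c = ff_const d"
  then have "ff_const (c - d) = 0" by simp
  then show "c = d" unfolding ff_const_eq_0_iff by simp
qed

lemma ff_const_eq_iff [simp]: "ff_const c = ff_const d \<longleftrightarrow> c = d"
  using inj_ff_const by (auto dest: injD)

lemma ff_const_power [simp]: "ff_const (c ^ n) = ff_const c ^ n"
  by (induction n) simp_all

lemma ff_const_inverse [simp]: "ff_const (inverse c) = inverse (ff_const c)"
proof (cases "c = 0")
  case False
  then have "ff_const c * ff_const (inverse c) = 1"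
    by (simp flip: ff_const_simps(4) del: ff_const_simps(4))
  then show ?thesis by (simp add: inverse_unique)
qed simp

lemma ff_const_sum: "ff_const (sum g I) = (\<Sum>i\<in>I. ff_const (g i))"
  by (induction I rule: infinite_finite_induct) simp_all

lemma ff_const_R_fun: "ff_const (R_fun p e a u) = R_fun p e (\<lambda>i. ff_const (a i)) (ff_const u)"
  by (simp add: R_fun_def ff_const_sum)

lemma CHAR_ff_closure: "CHAR('a::field ff_closure) = CHAR('a)"
proof -
  have of_nat: "of_nat n = ff_const (of_nat n :: 'a)" for n
    by (induction n) simp_all
  have "CHAR('a ff_closure) dvd n \<longleftrightarrow> CHAR('a) dvd n" for n
    unfolding of_nat_eq_0_iff_char_dvd[symmetric] of_nat by simp
  from this[of "CHAR('a ff_closure)"] this[of "CHAR('a)"] show ?thesis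
    by (intro dvd_antisym) (blast intro: dvd_refl)+
qed

lemma CHAR_poly_fract: "CHAR('a::field poly fract) = CHAR('a)"
  using CHAR_ff_closure[where ?'a = 'a] by simp

lemma poly_ff_x: "poly (map_poly ff_const g) ff_x = ff_poly g"
proof (induction g)
  case (pCons c g)
  have "ff_poly (pCons c g) = ff_poly ([:c:] + [:0, 1:] * g)" by simp
  also have "\<dots> = ff_const c + ff_x * ff_poly g" unfolding ff_const_conv ff_x_conv ff_poly_simps ..
  finally show ?case using pCons by (simp add: map_poly_pCons)
qed simp

text \<open>Pulled back along \<open>ff_const\<close>, evaluation at \<open>ff_x\<close> becomes the
  embedding of polynomials into the closure, which is injective.\<close>

lemma ff_x_transcendental:
  assumes "f \<in> poly_over (range ff_const)" "poly f ff_x = 0"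
  shows "f = 0"
proof -
  define g where "g = map_poly (inv_into UNIV ff_const) f"
  have inv0: "inv_into UNIV ff_const 0 = 0"
    using inv_f_f[OF inj_ff_const, of 0] by simp
  have "map_poly ff_const g = f"
  proof (rule poly_eqI)
    fix n
    have "coeff f n \<in> range ff_const" using assms(1) by (rule poly_over_coeff)
    then show "coeff (map_poly ff_const g) n = coeff f n"
      by (simp add: g_def coeff_map_poly inv0 f_inv_into_f)
  qed
  then show ?thesis using poly_ff_x[of g] assms(2) by auto
qed

lemma subfield_set_Fq:
  assumes "prime CHAR('a::field)" "q = CHAR('a) ^ f"
  shows "subfield_set (Fq q :: 'a set)"
proof -
  have add: "(u + v) ^ q = u ^ q + v ^ q" for u v :: 'a
    by (rule freshmans_dream'[OF assms])
  have "0 < q" using assms prime_gt_0_nat by auto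
  then have "(u - v) ^ q = u ^ q - v ^ q" for u v :: 'a
    using add[of "u - v" v] by simp
  then show ?thesis
    by (auto simp: subfield_set_def subring_set_def Fq_def power_mult_distrib power_inverse)
qed

lemma artin_schreier_root:
  assumes "1 < p"
  shows "\<exists>y. y ^ p - y = (z :: 'a::alg_closed_field)"
proof -
  have "degree (monom 1 p + (- [:z, 1:])) = p"
    using assms by (subst degree_add_eq_left) (auto simp: degree_monom_eq)
  then obtain y where "poly (monom 1 p + (- [:z, 1:])) y = 0"
    using alg_closed_imp_poly_has_root[of "monom 1 p + (- [:z, 1:])"] assms by auto
  then show ?thesis by (intro exI[of _ y]) (simp add: poly_monom algebra_simps)
qed

lemma ff_y_equation:
  assumes "1 < p"
  shows "ff_y p e a ^ p - ff_y p e a = ff_x * R_fun p e (\<lambda>i. ff_const (a i)) ff_x"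
  unfolding ff_y_def by (rule someI_ex) (rule artin_schreier_root[OF assms])

context artin_schreier_curve
begin

lemma generate_field_eq_K: "generate_field ring_of_type_algebra (k \<union> {x, y}) = K"
proof -
  interpret rf: field "ring_of_type_algebra :: 'b ring" by (rule field_from_type_algebra)
  let ?R = "ring_of_type_algebra :: 'b ring"
  have neg: "\<ominus>\<^bsub>?R\<^esub> u = - u" for u
    by (rule rf.minus_equality) (auto simp: ring_of_type_algebra_def)
  have inv: "inv\<^bsub>?R\<^esub> u = inverse u" if "u \<noteq> 0" for u
    by (rule rf.comm_inv_char) (use that in \<open>auto simp: ring_of_type_algebra_def\<close>)
  have ops: "u \<otimes>\<^bsub>?R\<^esub> v = u * v" "u \<oplus>\<^bsub>?R\<^esub> v = u + v" "\<one>\<^bsub>?R\<^esub> = 1" "\<zero>\<^bsub>?R\<^esub> = 0" for u v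
    by (simp_all add: ring_of_type_algebra_def)
  define G where "G = generate_field ?R (k \<union> {x, y})"
  have K_ring: "subring_set K" and K_inv: "\<And>u. u \<in> K \<Longrightarrow> inverse u \<in> K"
    using subfield_K by (auto simp: subfield_set_def)
  have "u \<in> K" if "u \<in> G" for u
    using that unfolding G_def
    by induction
      (use k_K x_K y_K K_ring K_inv in \<open>auto simp: neg inv ops intro: subring_set_intros\<close>)
  moreover have "u \<in> G" if "u \<in> K" for u
  proof -
    have G1: "1 \<in> G" using generate_field.one[of ?R] by (simp add: G_def ops)
    have Gm: "- u \<in> G" if "u \<in> G" for u
      using generate_field.a_inv[of u ?R] that by (simp add: G_def neg)
    have Ga: "u + v \<in> G" if "u \<in> G" "v \<in> G" for u v
      using generate_field.eng_add[of u ?R _ v] that by (simp add: G_def ops)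
    have Gt: "u * v \<in> G" if "u \<in> G" "v \<in> G" for u v
      using generate_field.eng_mult[of u ?R _ v] that by (simp add: G_def ops)
    have G_ring: "subring_set G"
      using G1 Gm Ga Gt unfolding subring_set_def by (metis diff_conv_add_uminus)
    have Gi: "inverse u \<in> G" if "u \<in> G" for u
      using generate_field.m_inv[of u ?R] that subring_set_zero[OF G_ring]
      by (cases "u = 0") (auto simp: G_def ops inv)
    have "k \<union> {x, y} \<subseteq> G" unfolding G_def by (auto intro: generate_field.incl)
    then have "poly2 f x y \<in> G" if "f \<in> P2" for f
      using poly2_in_subring_set[OF G_ring _ that] by auto
    then show ?thesis using that Gt Gi by (auto simp: K_def divide_inverse)
  qed
  ultimately show ?thesis unfolding G_def by blast
qed

end

lemma card_curve_points:
  fixes a :: "nat \<Rightarrow> 'a::field"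
  assumes char: "prime CHAR('a)" and p: "p = CHAR('a) ^ m" "0 < m" and q: "q = CHAR('a) ^ f"
    and fin: "finite (Fq q :: 'a set)" and e: "0 < e" and a: "\<And>i. i \<le> e \<Longrightarrow> a i \<in> Fq q" "a e \<noteq> 0"
  shows "card (curve_points q p e a) =
    Suc (card {(u, v). u \<in> Fq q \<and> v \<in> Fq q \<and> v ^ p - v = u * R_fun p e a u})"
proof -
  define k where "k = (ff_const ` Fq q :: 'a ff_closure set)"
  have Fq: "subfield_set (Fq q :: 'a set)" by (rule subfield_set_Fq[OF char q])
  have p1: "1 < p" unfolding p(1) by (rule one_less_power[OF prime_gt_1_nat[OF char] p(2)])
  interpret artin_schreier_curve k ff_x "ff_y p e a" p m e "\<lambda>i. ff_const (a i)"
  proof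
    show "subfield_set k"
      using Fq unfolding subfield_set_def subring_set_def k_def
      by (auto simp flip: ff_const_diff ff_const_simps(4) ff_const_inverse)
        (use ff_const_simps(2) in \<open>force\<close>)
    show "f = 0" if "f \<in> poly_over k" "poly f ff_x = 0" for f
      using that poly_over_mono[of k "range ff_const"] ff_x_transcendental by (auto simp: k_def)
    show "ff_y p e a ^ p - ff_y p e a = ff_x * R_fun p e (\<lambda>i. ff_const (a i)) ff_x"
      by (rule ff_y_equation[OF p1])
  qed (use assms in \<open>auto simp: CHAR_poly_fract k_def\<close>)
  have "curve_points q p e a = rational_places k K"
    unfolding generate_field_eq_K[symmetric] by (simp only: curve_points_def function_field_def k_def)
  moreover have "finite k" using fin by (simp add: k_def)
  ultimately have "card (curve_points q p e a) = Suc (card points)"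
    using card_rational_places by simp
  also have "points = map_prod ff_const ff_const ` {(u, v). u \<in> Fq q \<and> v \<in> Fq q \<and> v ^ p - v = u * R_fun p e a u}"
    (is "_ = _ ` ?S")
  proof (rule equalityI; rule subsetI)
    fix P assume "P \<in> points"
    then obtain u v where uv: "u \<in> Fq q" "v \<in> Fq q" "P = (ff_const u, ff_const v)"
      "ff_const v ^ p - ff_const v = ff_const u * R_fun p e (\<lambda>i. ff_const (a i)) (ff_const u)"
      unfolding points_def by (auto simp: k_def)
    then have "v ^ p - v = u * R_fun p e a u"
      by (simp flip: ff_const_R_fun ff_const_power ff_const_diff ff_const_simps(4))
    then show "P \<in> map_prod ff_const ff_const ` ?S" using uv by force
  next
    fix P assume "P \<in> map_prod ff_const ff_const ` ?S"
    then show "P \<in> points"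
      unfolding points_def
      by (auto simp: k_def
          simp flip: ff_const_R_fun ff_const_power ff_const_diff ff_const_simps(4))
  qed
  also have "card \<dots> = card ?S"
    by (rule card_image) (auto simp: inj_on_def)
  finally show ?thesis .
qed

section \<open>Additive polynomials\<close>

lemma card_roots_separable:
  fixes h :: "'a::alg_closed_field poly"
  assumes d: "\<And>u. poly (pderiv h) u \<noteq> 0"
  shows "card {u. poly h u = 0} = degree h"
proof -
  have h0: "h \<noteq> 0" using d[of 0] by auto
  obtain A where A: "size A = degree h" "h = smult (lead_coeff h) (\<Prod>u\<in>#A. [:- u, 1:])"
    using alg_closed_imp_factorization[OF h0] by blast
  have "count A u \<le> 1" for u
  proof (rule ccontr)
    assume "\<not> count A u \<le> 1"
    then have "{#u, u#} \<subseteq># A" by (auto simp: subseteq_mset_def)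
    then obtain B where B: "A = add_mset u (add_mset u B)" by (auto simp: subset_mset.le_iff_add)
    define l where "l = lead_coeff h"
    have "h = smult l (\<Prod>u\<in>#A. [:- u, 1:])" using A(2) by (simp only: l_def)
    also have "\<dots> = [:- u, 1:] * ([:- u, 1:] * smult l (\<Prod>u\<in>#B. [:- u, 1:]))"
      by (simp only: B image_mset_add_mset prod_mset.add_mset mult_smult_right)
    finally obtain g where "h = [:- u, 1:] * ([:- u, 1:] * g)" by blast
    then have "poly (pderiv h) u = 0" by (simp add: pderiv_mult del: mult_pCons_left)
    then show False using d by simp
  qed
  then have "count A u = count (mset_set (set_mset A)) u" for u
    by (cases "u \<in># A") (auto simp: count_mset_set' le_Suc_eq count_eq_zero_iff)
  then have "A = mset_set (set_mset A)" by (intro multiset_eqI)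
  then have "degree h = card (set_mset A)" using A(1) by (metis size_mset_set)
  moreover have "poly h u = lead_coeff h * (\<Prod>v\<in>#A. u - v)" for u
    by (subst A(2)) (simp add: poly_prod_mset)
  then have "{u. poly h u = 0} = set_mset A" using h0 by (auto simp: prod_mset_zero_iff)
  ultimately show ?thesis by simp
qed

lemma card_Fq:
  assumes char: "prime CHAR('a::alg_closed_field)" and q: "q = CHAR('a) ^ f" "0 < f"
  shows "card (Fq q :: 'a set) = q" "finite (Fq q :: 'a set)"
proof -
  define h :: "'a poly" where "h = monom 1 q + (- [:0, 1:])"
  have q1: "1 < q" unfolding q(1) by (rule one_less_power[OF prime_gt_1_nat[OF char] q(2)])
  have "of_nat q = (0 :: 'a)" using q by (simp add: power_0_left)
  then have "poly (pderiv h) u \<noteq> 0" for u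
    by (simp add: h_def pderiv_add pderiv_minus pderiv_monom pderiv_pCons)
  moreover have roots: "{u. poly h u = 0} = Fq q" by (auto simp: h_def Fq_def poly_monom)
  moreover have deg: "degree h = q"
    unfolding h_def using q1 by (subst degree_add_eq_left) (auto simp: degree_monom_eq)
  ultimately show "card (Fq q :: 'a set) = q" using card_roots_separable[of h] by simp
  have "h \<noteq> 0" using deg q1 by auto
  from poly_roots_finite[OF this] show "finite (Fq q :: 'a set)" by (simp add: roots)
qed

lemma infinite_alg_closed: "infinite (UNIV :: 'a::alg_closed_field set)"
proof
  assume fin: "finite (UNIV :: 'a set)"
  define h :: "'a poly" where "h = (\<Prod>u\<in>UNIV. [:- u, 1:]) + 1"
  have "poly h u = 1" for u using fin by (auto simp: h_def poly_prod)
  moreover have "degree (\<Prod>u\<in>(UNIV :: 'a set). [:- u, 1:]) = card (UNIV :: 'a set)"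
    by (subst degree_prod_eq_sum_degree) auto
  then have "degree h > 0"
    using fin unfolding h_def by (subst degree_add_eq_left) (auto simp: card_gt_0_iff)
  ultimately show False using alg_closed_imp_poly_has_root[of h] by auto
qed

lemma poly_eqI_alg_closed:
  fixes f g :: "'a::alg_closed_field poly"
  assumes "\<And>u. poly f u = poly g u"
  shows "f = g"
proof (rule ccontr)
  assume "f \<noteq> g"
  then have "finite {u. poly (f - g) u = 0}" by (intro poly_roots_finite) simp
  moreover have "{u. poly (f - g) u = 0} = UNIV" using assms by auto
  ultimately show False using infinite_alg_closed[where ?'a = 'a] by simp
qed

lemma monic_eq_prod_roots:
  fixes h :: "'a::field poly"
  assumes "finite S" "degree h = card S" "lead_coeff h = 1" "\<And>s. s \<in> S \<Longrightarrow> poly h s = 0"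
  shows "h = (\<Prod>s\<in>S. [:- s, 1:])"
proof (rule poly_eqI_degree_lead_coeff)
  have d: "degree (\<Prod>s\<in>S. [:- s, 1:]) = card S"
    by (subst degree_prod_eq_sum_degree) auto
  have "lead_coeff (\<Prod>s\<in>S. [:- s, 1:]) = 1" by (simp add: lead_coeff_prod)
  then show "coeff h (card S) = coeff (\<Prod>s\<in>S. [:- s, 1:]) (card S)" using assms d by simp
  show "degree (\<Prod>s\<in>S. [:- s, 1:]) \<le> card S" using d by simp
  show "poly h s = poly (\<Prod>s\<in>S. [:- s, 1:]) s" if "s \<in> S" for s
    using that assms by (auto simp: poly_prod)
qed (use assms in auto)

lemma card_fibre:
  fixes f :: "'a::ab_group_add \<Rightarrow> 'b::ab_group_add"
  assumes fin: "finite U" and diff: "\<And>u v. u \<in> U \<Longrightarrow> v \<in> U \<Longrightarrow> u - v \<in> U"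
    and f: "\<And>u v. u \<in> U \<Longrightarrow> v \<in> U \<Longrightarrow> f (u - v) = f u - f v"
    and u0: "u0 \<in> U"
  shows "card {u \<in> U. f u = f u0} = card {u \<in> U. f u = 0}"
proof -
  have neg: "- u \<in> U" if "u \<in> U" for u using diff[of "u - u" u] diff[of u u] that by simp
  have add: "u + v \<in> U" if "u \<in> U" "v \<in> U" for u v using diff[of u "- v"] neg that by simp
  have fadd: "f (u + u0) = f u + f u0" if "u \<in> U" for u using f[of "u + u0" u0] add u0 that by simp
  show ?thesis
    by (rule bij_betw_same_card[of "\<lambda>u. u - u0"], rule bij_betw_byWitness[where f' = "\<lambda>u. u + u0"])
      (use u0 diff add f fadd in auto)
qed

lemma card_image_kernel:
  fixes f :: "'a::ab_group_add \<Rightarrow> 'b::ab_group_add"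
  assumes fin: "finite U" and diff: "\<And>u v. u \<in> U \<Longrightarrow> v \<in> U \<Longrightarrow> u - v \<in> U"
    and f: "\<And>u v. u \<in> U \<Longrightarrow> v \<in> U \<Longrightarrow> f (u - v) = f u - f v"
  shows "card U = card (f ` U) * card {u \<in> U. f u = 0}"
proof -
  have "card U = (\<Sum>c\<in>f ` U. card {u \<in> U. f u = c})"
    using sum.image_gen[OF fin, of "\<lambda>_. 1::nat" f] by simp
  also have "\<dots> = (\<Sum>c\<in>f ` U. card {u \<in> U. f u = 0})"
    using card_fibre[OF fin diff f] by (intro sum.cong) auto
  finally show ?thesis by simp
qed

lemma subring_set_prod:
  "subring_set S \<Longrightarrow> (\<And>i. i \<in> I \<Longrightarrow> g i \<in> S) \<Longrightarrow>
    prod g I \<in> S"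
  by (induction I rule: infinite_finite_induct) (auto intro: subring_set_one subring_set_mult)

section \<open>Linear algebra over \<open>Fp\<close> by counting\<close>

locale frobenius_power =
  fixes p m :: nat and FF :: "'a::alg_closed_field itself"
  assumes char: "prime CHAR('a)" and p: "p = CHAR('a) ^ m" and m: "0 < m"
begin

abbreviation Fp :: "'a set" where "Fp \<equiv> Fq p"

lemma p_gt_1: "1 < p"
  unfolding p by (rule one_less_power[OF prime_gt_1_nat[OF char] m])

lemma p_pow: "p ^ i = CHAR('a) ^ (m * i)"
  by (simp add: p power_mult)

lemma pow_pos: "0 < p ^ i"
  using p_gt_1 by simp

lemma pow_add: "(u + v :: 'a) ^ (p ^ i) = u ^ (p ^ i) + v ^ (p ^ i)"
  by (rule freshmans_dream'[OF char p_pow])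

lemma pow_diff: "(u - v :: 'a) ^ (p ^ i) = u ^ (p ^ i) - v ^ (p ^ i)"
  using pow_add[of "u - v" v i] by simp

lemma pow_uminus: "(- u :: 'a) ^ (p ^ i) = - (u ^ (p ^ i))"
  using pow_diff[of 0 u i] pow_pos[of i] by (simp add: power_0_left)

lemma pow_sum: "(sum g I :: 'a) ^ (p ^ i) = (\<Sum>j\<in>I. g j ^ (p ^ i))"
  by (rule freshmans_dream_sum'[OF char p_pow])

lemma pow_pow: "((u :: 'a) ^ (p ^ i)) ^ (p ^ j) = u ^ (p ^ (i + j))"
  by (simp add: power_add flip: power_mult)

lemma card_Fp: "card Fp = p" and finite_Fp: "finite Fp"
  using card_Fq[OF char p m] by auto

lemma subfield_Fp: "subfield_set Fp"
  by (rule subfield_set_Fq[OF char p])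

lemma Fp_ring: "subring_set Fp"
  using subfield_Fp by (simp add: subfield_set_def)

lemma Fp_pow: "c \<in> Fp \<Longrightarrow> c ^ (p ^ i) = c"
  by (induction i) (auto simp: Fq_def power_mult mult.commute)

definition fp_linear :: "('a \<Rightarrow> 'a) \<Rightarrow> bool" where
  "fp_linear l \<longleftrightarrow> (\<forall>u v. l (u + v) = l u + l v) \<and> (\<forall>c\<in>Fp. \<forall>u. l (c * u) = c * l u)"

lemma fp_linear_add: "fp_linear l \<Longrightarrow> l (u + v) = l u + l v"
  and fp_linear_scale: "fp_linear l \<Longrightarrow> c \<in> Fp \<Longrightarrow> l (c * u) = c * l u"
  by (auto simp: fp_linear_def)

lemma fp_linear_0: "fp_linear l \<Longrightarrow> l 0 = 0"
  using fp_linear_add[of l 0 0] by (metis add_cancel_right_right add_0)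

lemma fp_linear_diff: "fp_linear l \<Longrightarrow> l (u - v) = l u - l v"
  using fp_linear_add[of l "u - v" v] by simp

lemma fp_linear_uminus: "fp_linear l \<Longrightarrow> l (- u) = - l u"
  using fp_linear_diff[of l 0 u] fp_linear_0[of l] by simp

lemma fp_linear_intros:
  "fp_linear (\<lambda>u. u)" "fp_linear (\<lambda>u. 0)"
  "fp_linear l \<Longrightarrow> fp_linear (\<lambda>u. b * l u)" "fp_linear l \<Longrightarrow> fp_linear (\<lambda>u. l u * b)"
  "fp_linear l \<Longrightarrow> fp_linear (\<lambda>u. - l u)"
  "fp_linear l \<Longrightarrow> fp_linear (\<lambda>u. l u ^ (p ^ i))"
  "fp_linear l \<Longrightarrow> fp_linear l' \<Longrightarrow> fp_linear (\<lambda>u. l u + l' u)"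
  "fp_linear l \<Longrightarrow> fp_linear l' \<Longrightarrow> fp_linear (\<lambda>u. l u - l' u)"
  by (auto simp: fp_linear_def algebra_simps pow_add power_mult_distrib Fp_pow)

lemma fp_linear_sum:
  "(\<And>i. i \<in> I \<Longrightarrow> fp_linear (l i)) \<Longrightarrow>
    fp_linear (\<lambda>u. \<Sum>i\<in>I. l i u)"
  by (induction I rule: infinite_finite_induct) (auto intro: fp_linear_intros)

lemma fp_linear_R_fun: "fp_linear (R_fun p N c)"
  unfolding R_fun_def by (intro fp_linear_sum fp_linear_intros)

lemma fp_linear_comp:
  "fp_linear l \<Longrightarrow> fp_linear l' \<Longrightarrow> fp_linear (\<lambda>u. l (l' u))"
  by (simp add: fp_linear_def)

definition fp_subspace :: "'a set \<Rightarrow> bool" where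
  "fp_subspace U \<longleftrightarrow> 0 \<in> U \<and> (\<forall>u\<in>U. \<forall>v\<in>U. u + v \<in> U) \<and> (\<forall>c\<in>Fp. \<forall>u\<in>U. c * u \<in> U)"

lemma subspace_zero: "fp_subspace U \<Longrightarrow> 0 \<in> U"
  and subspace_add: "fp_subspace U \<Longrightarrow> u \<in> U \<Longrightarrow> v \<in> U \<Longrightarrow> u + v \<in> U"
  and subspace_scale: "fp_subspace U \<Longrightarrow> c \<in> Fp \<Longrightarrow> u \<in> U \<Longrightarrow> c * u \<in> U"
  by (auto simp: fp_subspace_def)

lemma subspace_uminus: "fp_subspace U \<Longrightarrow> u \<in> U \<Longrightarrow> - u \<in> U"
  using subspace_scale[of U "- 1" u] subring_set_uminus[OF Fp_ring subring_set_one[OF Fp_ring]] by simp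

lemma subspace_diff:
  "fp_subspace U \<Longrightarrow> u \<in> U \<Longrightarrow> v \<in> U \<Longrightarrow> u - v \<in> U"
  using subspace_add[of U u "- v"] subspace_uminus[of U v] by simp

lemma subspace_trivial: "fp_subspace {0}"
  by (simp add: fp_subspace_def)

lemma subspace_image: "fp_linear l \<Longrightarrow> fp_subspace U \<Longrightarrow> fp_subspace (l ` U)"
  unfolding fp_subspace_def
  by (auto simp flip: fp_linear_add fp_linear_scale) (metis fp_linear_0 imageI)

lemma subspace_kernel:
  "fp_linear l \<Longrightarrow> fp_subspace U \<Longrightarrow> fp_subspace {u \<in> U. l u = 0}"
  unfolding fp_subspace_def by (auto simp: fp_linear_add fp_linear_scale fp_linear_0)

definition span1 :: "'a set \<Rightarrow> 'a \<Rightarrow> 'a set" where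
  "span1 U g = (\<lambda>(u, c). u + c * g) ` (U \<times> Fp)"

lemma span1_I: "u \<in> U \<Longrightarrow> c \<in> Fp \<Longrightarrow> u + c * g \<in> span1 U g"
  by (auto simp: span1_def)

lemma span1_superset: "U \<subseteq> span1 U g" and span1_mem: "fp_subspace U \<Longrightarrow> g \<in> span1 U g"
  using span1_I[of _ U 0 g] span1_I[of 0 U 1 g] subspace_zero[of U]
    subring_set_zero[OF Fp_ring] subring_set_one[OF Fp_ring] by auto

lemma subspace_span1:
  assumes U: "fp_subspace U"
  shows "fp_subspace (span1 U g)"
  unfolding fp_subspace_def
proof (intro conjI ballI)
  show "0 \<in> span1 U g" using span1_superset subspace_zero[OF U] by blast
  fix v assume "v \<in> span1 U g"
  then obtain u c where v: "u \<in> U" "c \<in> Fp" "v = u + c * g" by (auto simp: span1_def)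
  fix v' assume "v' \<in> span1 U g"
  then obtain u' c' where v': "u' \<in> U" "c' \<in> Fp" "v' = u' + c' * g" by (auto simp: span1_def)
  have "(u + u') + (c + c') * g \<in> span1 U g"
    by (intro span1_I subspace_add[OF U] subring_set_add[OF Fp_ring] v v')
  then show "v + v' \<in> span1 U g" by (simp add: v v' algebra_simps)
next
  fix b v assume b: "b \<in> Fp" and "v \<in> span1 U g"
  then obtain u c where v: "u \<in> U" "c \<in> Fp" "v = u + c * g" by (auto simp: span1_def)
  have "b * u + (b * c) * g \<in> span1 U g"
    by (intro span1_I subspace_scale[OF U] subring_set_mult[OF Fp_ring] v b)
  then show "b * v \<in> span1 U g" by (simp add: v algebra_simps)
qed

lemma span1_inj:
  assumes U: "fp_subspace U" and g: "g \<notin> U"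
  shows "inj_on (\<lambda>(u, c). u + c * g) (U \<times> Fp)"
proof (rule inj_onI, clarify)
  fix u c u' c' assume *: "u \<in> U" "c \<in> Fp" "u' \<in> U" "c' \<in> Fp" "u + c * g = u' + c' * g"
  show "u = u' \<and> c = c'"
  proof (cases "c = c'")
    case False
    have "(c - c') * g = u' - u" using *(5) by (simp add: algebra_simps)
    then have "g = inverse (c - c') * (u' - u)" using False by (simp add: field_simps)
    also have "\<dots> \<in> U"
      using * subfield_Fp by (intro subspace_scale[OF U] subspace_diff[OF U])
        (auto simp: subfield_set_def subring_set_diff)
    finally show ?thesis using g by simp
  qed (use * in auto)
qed

lemma card_span1:
  "fp_subspace U \<Longrightarrow> g \<notin> U \<Longrightarrow> card (span1 U g) = p * card U"
  unfolding span1_def by (subst card_image[OF span1_inj]) (simp_all add: card_cartesian_product card_Fp)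

text \<open>Adjoining one vector at a time takes the place of bases. The start may be any subspace,
  so that nested subspaces can be compared.\<close>

lemma subspace_induct [consumes 4, case_names base step]:
  assumes "fp_subspace U" "fp_subspace Z" "U \<subseteq> Z" "finite Z"
    and "P U"
    and step: "\<And>U' g. fp_subspace U' \<Longrightarrow> U \<subseteq> U' \<Longrightarrow> U' \<subseteq> Z \<Longrightarrow> g \<in> Z \<Longrightarrow> g \<notin> U' \<Longrightarrow> P U' \<Longrightarrow> P (span1 U' g)"
  shows "P Z"
proof -
  have "P Z" if "fp_subspace U'" "U \<subseteq> U'" "U' \<subseteq> Z" "P U'" for U'
    using that
  proof (induction "card Z - card U'" arbitrary: U' rule: less_induct)
    case less
    show ?case
    proof (cases "U' = Z")
      case False
      then obtain g where g: "g \<in> Z" "g \<notin> U'" using less.prems by blast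
      have sub: "span1 U' g \<subseteq> Z"
        using less.prems g assms(2) unfolding span1_def
        by (auto intro!: subspace_add[OF assms(2)] subspace_scale[OF assms(2)])
      have fin: "finite U'" using less.prems assms(4) finite_subset by blast
      have "0 < card U'" using subspace_zero[OF less.prems(1)] fin by (auto simp: card_gt_0_iff)
      then have "card U' < card (span1 U' g)" using card_span1[OF less.prems(1) g(2)] p_gt_1 by simp
      moreover have "card (span1 U' g) \<le> card Z" by (rule card_mono[OF assms(4) sub])
      ultimately show ?thesis
        using less.prems g span1_superset[of U' g]
        by (intro less.hyps[OF _ subspace_span1 _ sub step]) auto
    qed (use less.prems in simp)
  qed
  then show ?thesis using assms by blast
qed

lemma subspace_card_kernel:
  assumes "fp_subspace U" "finite U" "fp_linear l"
  shows "card U = card (l ` U) * card {u \<in> U. l u = 0}"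
  using assms by (intro card_image_kernel) (auto simp: subspace_diff fp_linear_diff)

lemma subspace_card_kernel_le:
  assumes "fp_subspace U" "finite U" "fp_linear l" "l ` U \<subseteq> Fp"
  shows "card U \<le> p * card {u \<in> U. l u = 0}"
  using subspace_card_kernel[OF assms(1-3)] card_mono[OF finite_Fp assms(4)] by (simp add: card_Fp)

lemma subspace_card_fibre:
  assumes U: "fp_subspace U" "finite U" and l: "fp_linear l" "l ` U \<subseteq> Fp"
    and u: "u \<in> U" "l u \<noteq> 0" and c: "c \<in> Fp"
  shows "card U = p * card {v \<in> U. l v = c}"
proof -
  have hit: "\<exists>v\<in>U. l v = c" if "c \<in> Fp" for c
  proof
    have *: "c * inverse (l u) \<in> Fp"
      using that u l subfield_Fp Fp_ring by (auto simp: subfield_set_def intro!: subring_set_mult)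
    show "l (c * inverse (l u) * u) = c" using fp_linear_scale[OF l(1) *] u by simp
    show "c * inverse (l u) * u \<in> U" by (rule subspace_scale[OF U(1) * u(1)])
  qed
  then have "l ` U = Fp" using l(2) by blast
  then have "card U = p * card {v \<in> U. l v = 0}"
    using subspace_card_kernel[OF U l(1)] by (simp add: card_Fp)
  moreover obtain v where v: "v \<in> U" "l v = c" using hit[OF c] by blast
  have "card {w \<in> U. l w = l v} = card {w \<in> U. l w = 0}"
    using U l v(1) by (intro card_fibre) (auto simp: subspace_diff fp_linear_diff)
  ultimately show ?thesis using v by simp
qed

definition perp :: "('a \<Rightarrow> 'a \<Rightarrow> 'a) \<Rightarrow> 'a set \<Rightarrow> 'a set \<Rightarrow> 'a set" where
  "perp B Z U = {v \<in> Z. \<forall>u\<in>U. B v u = 0}"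

lemma subspace_perp:
  assumes "fp_subspace Z" "\<And>u. fp_linear (\<lambda>v. B v u)"
  shows "fp_subspace (perp B Z U)"
  using assms unfolding fp_subspace_def perp_def
  by (auto simp: fp_linear_add[OF assms(2)] fp_linear_scale[OF assms(2)] fp_linear_0[OF assms(2)])

text \<open>Adjoining a vector multiplies \<open>card U\<close> by \<open>p\<close> and cuts the
  complement down by one functional, so by a factor of at most \<open>p\<close>. A chain from 0 up
  to \<open>U\<close> bounds the product below, and a chain from \<open>U\<close> up to the whole
  space bounds it above.\<close>

lemma card_perp_mono:
  assumes Z: "fp_subspace Z" "finite Z" and U: "fp_subspace U" "fp_subspace U'" "U \<subseteq> U'" "finite U'"
    and lin1: "\<And>u. fp_linear (\<lambda>v. B v u)" and lin2: "\<And>v. fp_linear (B v)"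
    and val: "\<And>v u. v \<in> Z \<Longrightarrow> u \<in> U' \<Longrightarrow> B v u \<in> Fp"
  shows "card U * card (perp B Z U) \<le> card U' * card (perp B Z U')"
  using U
proof (induction rule: subspace_induct)
  case base
  then show ?case by simp
next
  case (step X' g)
  have P: "fp_subspace (perp B Z X')" by (rule subspace_perp[OF Z(1) lin1])
  have fin: "finite (perp B Z X')" using Z(2) by (rule finite_subset[rotated]) (auto simp: perp_def)
  have "perp B Z (span1 X' g) = {v \<in> perp B Z X'. B v g = 0}"
  proof (rule equalityI; rule subsetI)
    fix v assume "v \<in> perp B Z (span1 X' g)"
    then show "v \<in> {v \<in> perp B Z X'. B v g = 0}"
      using span1_superset[of X' g] span1_mem[OF step(1), of g] by (auto simp: perp_def)
  next
    fix v assume "v \<in> {v \<in> perp B Z X'. B v g = 0}"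
    then show "v \<in> perp B Z (span1 X' g)"
      by (auto simp: perp_def span1_def fp_linear_add[OF lin2] fp_linear_scale[OF lin2])
  qed
  moreover have "card (perp B Z X') \<le> p * card {v \<in> perp B Z X'. B v g = 0}"
    by (rule subspace_card_kernel_le[OF P fin lin1]) (use val step in \<open>auto simp: perp_def\<close>)
  ultimately have "card X' * card (perp B Z X') \<le> card (span1 X' g) * card (perp B Z (span1 X' g))"
    using card_span1[OF step(1,5)] by (simp add: mult.assoc)
  then show ?case using step(6) by linarith
qed

text \<open>The factorisation of \<open>z ^ p - z\<close> over \<open>Fp\<close>, made homogeneous
  by \<open>z = u / w\<close>.\<close>

lemma prod_Fp: "(\<Prod>c\<in>Fp. u - c * w) = u ^ p - w ^ (p - 1) * u"
proof (cases "w = 0")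
  case True
  then show ?thesis using p_gt_1 by (simp add: card_Fp)
next
  case False
  define h :: "'a poly" where "h = monom 1 p + (- [:0, 1:])"
  have deg: "degree h = p"
    unfolding h_def using p_gt_1 by (subst degree_add_eq_left) (auto simp: degree_monom_eq)
  have "h = (\<Prod>c\<in>Fp. [:- c, 1:])"
  proof (rule monic_eq_prod_roots[OF finite_Fp])
    show "degree h = card Fp" by (simp add: deg card_Fp)
    show "lead_coeff h = 1" unfolding deg using p_gt_1 by (simp add: h_def coeff_pCons split: nat.splits)
  qed (auto simp: h_def Fq_def poly_monom)
  then have "poly h z = (\<Prod>c\<in>Fp. z - c)" for z by (simp add: poly_prod)
  then have *: "(\<Prod>c\<in>Fp. z - c) = z ^ p - z" for z by (simp add: h_def poly_monom)
  have "(\<Prod>c\<in>Fp. u - c * w) = (\<Prod>c\<in>Fp. w * (u / w - c))"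
    using False by (intro prod.cong) (auto simp: field_simps)
  also have "\<dots> = w ^ p * ((u / w) ^ p - u / w)"
    unfolding prod.distrib prod_constant card_Fp * ..
  also have "\<dots> = u ^ p - w ^ (p - 1) * u"
    using False p_gt_1 by (simp add: field_simps power_diff)
  finally show ?thesis .
qed

lemma R_fun_pow_p:
  "\<exists>c'. c' (Suc N) = c N ^ p \<and> c' 0 = - b * c 0 \<and> (\<forall>u :: 'a. R_fun p N c u ^ p - b * R_fun p N c u = R_fun p (Suc N) c' u)"
proof -
  define c' where "c' i = (if i = 0 then 0 else c (i - 1) ^ p) - (if i \<le> N then b * c i else 0)" for i
  have "R_fun p N c u ^ p - b * R_fun p N c u = R_fun p (Suc N) c' u" for u
  proof -
    have "R_fun p N c u ^ p = (\<Sum>i\<le>N. c i ^ p * u ^ (p ^ Suc i))"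
      using pow_sum[of "\<lambda>i. c i * u ^ p ^ i" "{..N}" 1]
      by (simp add: R_fun_def power_mult_distrib mult.commute flip: power_mult)
    also have "\<dots> = (\<Sum>i\<le>Suc N. (if i = 0 then 0 else c (i - 1) ^ p) * u ^ (p ^ i))"
      by (subst sum.atMost_Suc_shift) simp
    finally have 1: "R_fun p N c u ^ p = \<dots>" .
    have 2: "b * R_fun p N c u = (\<Sum>i\<le>Suc N. (if i \<le> N then b * c i else 0) * u ^ (p ^ i))"
      by (simp add: R_fun_def sum_distrib_left mult.assoc)
    show ?thesis unfolding 1 2
      by (simp only: R_fun_def[of _ "Suc N"] c'_def sum_subtractf[symmetric] left_diff_distrib)
  qed
  then show ?thesis by (intro exI[of _ c']) (simp add: c'_def)
qed

text \<open>Adjoining \<open>g\<close> turns the polynomial \<open>P\<close> of the subspace into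
  \<open>P ^ p - P(g) ^ (p - 1) * P\<close>. The lowest coefficient is thus multiplied by
  \<open>- (P(g) ^ (p - 1))\<close>, minus a square because \<open>p - 1\<close> is even. The ring
  \<open>T\<close> records that the square root stays rational.\<close>

lemma subspace_polynomial:
  assumes "fp_subspace U" "finite U" "odd p" and T: "subring_set T" "U \<subseteq> T"
  shows "\<exists>d c. card U = p ^ d \<and> c d = 1 \<and> (\<exists>t\<in>T. c 0 = (- 1) ^ d * t\<^sup>2) \<and> (\<forall>u. (\<Prod>v\<in>U. u - v) = R_fun p d c u)"
proof -
  have "{0} \<subseteq> U" using subspace_zero[OF assms(1)] by simp
  from subspace_trivial assms(1) this assms(2) show ?thesis
  proof (induction rule: subspace_induct)
    case base
    show "\<exists>d c. card {0 :: 'a} = p ^ d \<and> c d = 1 \<and> (\<exists>t\<in>T. c 0 = (- 1) ^ d * t\<^sup>2) \<and> (\<forall>u :: 'a. (\<Prod>v\<in>{0}. u - v) = R_fun p d c u)"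
      using subring_set_one[OF T(1)]
      by (intro exI[of _ 0] exI[of _ "\<lambda>_. 1"]) (auto simp: R_fun_def intro!: bexI[of _ 1])
  next
    case (step X' g)
    then obtain d c t where dc: "card X' = p ^ d" "c d = 1" "t \<in> T" "c 0 = (- 1) ^ d * t\<^sup>2" "\<And>u. (\<Prod>v\<in>X'. u - v) = R_fun p d c u" by blast
    obtain c' where c': "c' (Suc d) = c d ^ p" "c' 0 = - (R_fun p d c g ^ (p - 1)) * c 0"
      "\<And>u. R_fun p d c u ^ p - R_fun p d c g ^ (p - 1) * R_fun p d c u = R_fun p (Suc d) c' u"
      using R_fun_pow_p by blast
    have lin: "fp_linear (R_fun p d c)" by (rule fp_linear_R_fun)
    have "(\<Prod>v\<in>span1 X' g. u - v) = R_fun p (Suc d) c' u" for u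
    proof -
      have "(\<Prod>v\<in>span1 X' g. u - v) = (\<Prod>(v, b)\<in>X' \<times> Fp. u - (v + b * g))"
        unfolding span1_def by (subst prod.reindex[OF span1_inj[OF step(1,5)]]) (simp add: case_prod_beta)
      also have "\<dots> = (\<Prod>b\<in>Fp. \<Prod>v\<in>X'. (u - b * g) - v)"
        by (subst prod.cartesian_product[symmetric], subst prod.swap) (simp add: algebra_simps)
      also have "\<dots> = (\<Prod>b\<in>Fp. R_fun p d c u - b * R_fun p d c g)"
        unfolding dc(5) by (intro prod.cong) (simp_all add: fp_linear_diff[OF lin] fp_linear_scale[OF lin])
      also have "\<dots> = R_fun p (Suc d) c' u" unfolding prod_Fp c'(3) ..
      finally show ?thesis .
    qed
    moreover have "\<exists>t\<in>T. c' 0 = (- 1) ^ Suc d * t\<^sup>2"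
    proof
      define z where "z = R_fun p d c g"
      define l where "l = (p - 1) div 2"
      have l: "p - 1 = 2 * l" using assms(3) by (simp add: l_def)
      have "z = (\<Prod>v\<in>X'. g - v)" by (simp add: z_def dc(5))
      also have "\<dots> \<in> T"
        using step T by (intro subring_set_prod subring_set_diff) auto
      finally show "z ^ l * t \<in> T" using dc T by (intro subring_set_mult subring_set_power)
      show "c' 0 = (- 1) ^ Suc d * (z ^ l * t)\<^sup>2"
        unfolding c'(2) z_def[symmetric] l dc(4)
        by (simp add: power_mult_distrib mult.commute flip: power_mult)
    qed
    ultimately show ?case using dc c' card_span1[OF step(1,5)] by (intro exI[of _ "Suc d"] exI[of _ c']) auto
  qed
qed

section \<open>Additive polynomials under composition\<close>

definition lin_poly :: "nat \<Rightarrow> (nat \<Rightarrow> 'a) \<Rightarrow> 'a poly" where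
  "lin_poly N c = (\<Sum>i\<le>N. monom (c i) (p ^ i))"

lemma poly_lin_poly: "poly (lin_poly N c) u = R_fun p N c u"
  by (simp add: lin_poly_def R_fun_def poly_sum poly_monom)

lemma coeff_lin_poly: "i \<le> N \<Longrightarrow> coeff (lin_poly N c) (p ^ i) = c i"
proof -
  assume i: "i \<le> N"
  have "coeff (lin_poly N c) (p ^ i) = (\<Sum>j\<le>N. if j = i then c j else 0)"
    unfolding lin_poly_def coeff_sum coeff_monom
    using p_gt_1 by (intro sum.cong) auto
  then show ?thesis using i by simp
qed

lemma coeff_lin_poly_0:
  "(\<And>i. i \<le> N \<Longrightarrow> k \<noteq> p ^ i) \<Longrightarrow> coeff (lin_poly N c) k = 0"
  unfolding lin_poly_def coeff_sum coeff_monom by (intro sum.neutral) auto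

lemma degree_lin_poly_le: "degree (lin_poly N c) \<le> p ^ N"
  unfolding lin_poly_def
  by (intro degree_sum_le order.trans[OF degree_monom_le]) (use p_gt_1 in auto)

lemma degree_lin_poly: "c N \<noteq> 0 \<Longrightarrow> degree (lin_poly N c) = p ^ N"
  using degree_lin_poly_le[of N c] coeff_lin_poly[of N N c] by (metis le_antisym le_degree order.refl)

lemma lin_poly_eq_0_iff: "lin_poly N c = 0 \<longleftrightarrow> (\<forall>i\<le>N. c i = 0)"
proof
  show "\<forall>i\<le>N. c i = 0" if "lin_poly N c = 0"
    using that coeff_lin_poly[of _ N c] by auto
qed (simp add: lin_poly_def)

lemma pderiv_lin_poly: "pderiv (lin_poly N c) = [:c 0:]"
proof -
  have z: "of_nat (p ^ i) = (0 :: 'a)" if "0 < i" for i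
    using that m p by (simp add: power_0_left)
  have ps: "pderiv (sum g I) = (\<Sum>i\<in>I. pderiv (g i))" for g :: "nat \<Rightarrow> 'a poly" and I
    by (induction I rule: infinite_finite_induct) (auto simp: pderiv_add)
  have "pderiv (lin_poly N c) = (\<Sum>i\<le>N. if i = 0 then [:c 0:] else 0)"
    unfolding lin_poly_def ps
    by (intro sum.cong) (auto simp: pderiv_monom z simp flip: monom_0 simp del: of_nat_power)
  then show ?thesis by simp
qed

lemma R_fun_eqD:
  fixes c c' :: "nat \<Rightarrow> 'a"
  assumes "\<And>u. R_fun p N c u = R_fun p N c' u" "i \<le> N"
  shows "c i = c' i"
proof -
  have "lin_poly N c = lin_poly N c'" by (rule poly_eqI_alg_closed) (simp add: poly_lin_poly assms)
  then show ?thesis using coeff_lin_poly[OF assms(2)] by metis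
qed

lemma R_fun_roots:
  fixes c :: "nat \<Rightarrow> 'a"
  assumes "i \<le> N" "c i \<noteq> 0"
  shows "finite {u. R_fun p N c u = 0}" "card {u. R_fun p N c u = 0} \<le> p ^ N"
proof -
  have "lin_poly N c \<noteq> 0" using assms lin_poly_eq_0_iff by blast
  from poly_roots_finite[OF this] card_poly_roots_bound[OF this] degree_lin_poly_le[of N c]
  show "finite {u. R_fun p N c u = 0}" "card {u. R_fun p N c u = 0} \<le> p ^ N"
    by (auto simp: poly_lin_poly)
qed

lemma card_R_fun_roots:
  fixes c :: "nat \<Rightarrow> 'a"
  assumes "c 0 \<noteq> 0" "c N \<noteq> 0"
  shows "card {u. R_fun p N c u = 0} = p ^ N"
  using card_roots_separable[of "lin_poly N c"] assms degree_lin_poly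
  by (simp add: pderiv_lin_poly poly_lin_poly)

lemma R_fun_surj:
  fixes c :: "nat \<Rightarrow> 'a"
  assumes "c N \<noteq> 0"
  shows "\<exists>u. R_fun p N c u = z"
proof -
  have "degree (lin_poly N c + [:- z:]) = p ^ N"
    using pow_pos[of N] by (subst degree_add_eq_left) (simp_all add: degree_lin_poly[of c N, OF assms])
  then have "degree (lin_poly N c + [:- z:]) > 0" using pow_pos[of N] by simp
  from alg_closed_imp_poly_has_root[OF this] show ?thesis
    by (auto simp: poly_lin_poly)
qed

text \<open>Right division by a monic element in the noncommutative ring of additive polynomials:
  subtracting the top coefficient times a Frobenius power of the divisor lowers the degree.\<close>

lemma right_division:
  fixes b c :: "nat \<Rightarrow> 'a"
  assumes b: "b d = 1"
  shows "\<exists>g s. g N = c (d + N) \<and>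
    (\<forall>u. R_fun p (d + N) c u = R_fun p N g (R_fun p d b u) + (\<Sum>i<d. s i * u ^ (p ^ i)))"
proof (induction N arbitrary: c)
  case 0
  have eq: "R_fun p d b u = (\<Sum>i<d. b i * u ^ (p ^ i)) + u ^ (p ^ d)" for u
    using b by (simp add: R_fun_def flip: lessThan_Suc_atMost)
  have "R_fun p d c u = c d * R_fun p d b u + (\<Sum>i<d. (c i - c d * b i) * u ^ (p ^ i))" for u
  proof -
    have "R_fun p d c u = (\<Sum>i<d. c i * u ^ (p ^ i)) + c d * u ^ (p ^ d)"
      by (simp add: R_fun_def flip: lessThan_Suc_atMost)
    then show ?thesis unfolding eq by (simp add: sum_distrib_left sum_subtractf algebra_simps)
  qed
  then show ?case
    by (intro exI[of _ c] exI[of _ "\<lambda>i. c i - c d * b i"] exI[of _ "\<lambda>_. c d"]) (auto simp: R_fun_def[of p 0])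
next
  case (Suc N)
  define l where "l = c (d + Suc N)"
  define c' where "c' j = c j - (if Suc N \<le> j then l * b (j - Suc N) ^ (p ^ Suc N) else 0)" for j
  obtain g s where gs: "g N = c' (d + N)"
    "\<And>u. R_fun p (d + N) c' u = R_fun p N g (R_fun p d b u) + (\<Sum>i<d. s i * u ^ (p ^ i))"
    using Suc.IH[of c'] by blast
  define g' where "g' i = (if i = Suc N then l else g i)" for i
  have "R_fun p (d + Suc N) c u = R_fun p (Suc N) g' (R_fun p d b u) + (\<Sum>i<d. s i * u ^ (p ^ i))" for u
  proof -
    have "R_fun p d b u ^ (p ^ Suc N) = (\<Sum>i\<le>d. b i ^ (p ^ Suc N) * u ^ (p ^ (i + Suc N)))"
      unfolding R_fun_def pow_sum power_mult_distrib pow_pow ..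
    also have "\<dots> = (\<Sum>j\<in>{Suc N..d + Suc N}. b (j - Suc N) ^ (p ^ Suc N) * u ^ (p ^ j))"
      by (rule sum.reindex_bij_witness[of _ "\<lambda>j. j - Suc N" "\<lambda>i. i + Suc N"]) auto
    also have "\<dots> = (\<Sum>j\<le>d + Suc N. (if Suc N \<le> j then b (j - Suc N) ^ (p ^ Suc N) else 0) * u ^ (p ^ j))"
      by (intro sum.mono_neutral_cong_left) auto
    finally have F: "l * R_fun p d b u ^ (p ^ Suc N) =
        (\<Sum>j\<le>d + Suc N. (if Suc N \<le> j then l * b (j - Suc N) ^ (p ^ Suc N) else 0) * u ^ (p ^ j))"
      by (simp only: sum_distrib_left) (intro sum.cong, auto)
    have "R_fun p (d + Suc N) c u - l * R_fun p d b u ^ (p ^ Suc N) = R_fun p (d + Suc N) c' u"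
      unfolding F R_fun_def[of p "d + Suc N"] c'_def by (simp only: sum_subtractf left_diff_distrib)
    also have "c' (d + Suc N) = 0" using b by (simp add: c'_def l_def)
    then have "R_fun p (d + Suc N) c' u = R_fun p (d + N) c' u" by (simp add: R_fun_def)
    finally have "R_fun p (d + Suc N) c u = R_fun p N g (R_fun p d b u) + l * R_fun p d b u ^ (p ^ Suc N)
      + (\<Sum>i<d. s i * u ^ (p ^ i))" using gs(2)[of u] by (simp add: algebra_simps)
    also have "R_fun p N g (R_fun p d b u) + l * R_fun p d b u ^ (p ^ Suc N) = R_fun p (Suc N) g' (R_fun p d b u)"
      by (simp add: R_fun_def g'_def)
    finally show ?thesis .
  qed
  moreover have "g' (Suc N) = c (d + Suc N)" by (simp add: g'_def l_def)
  ultimately show ?case by blast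
qed

text \<open>The remainder has degree below \<open>p ^ d\<close> but vanishes on the
  \<open>p ^ d\<close> elements of \<open>W\<close>, so it is zero. The relation between lowest
  coefficients is the chain rule, as the derivative of an additive polynomial is its lowest
  coefficient.\<close>

lemma right_factor:
  fixes b c :: "nat \<Rightarrow> 'a"
  assumes b: "b d = 1" and W: "finite W" "card W = p ^ d"
    and F: "\<And>w. w \<in> W \<Longrightarrow> R_fun p d b w = 0"
    and van: "\<And>w. w \<in> W \<Longrightarrow> R_fun p (d + N) c w = 0"
  shows "\<exists>g. g N = c (d + N) \<and> c 0 = g 0 * b 0 \<and> (\<forall>u. R_fun p (d + N) c u = R_fun p N g (R_fun p d b u))"
proof -
  obtain g s where gs: "g N = c (d + N)"
    "\<And>u. R_fun p (d + N) c u = R_fun p N g (R_fun p d b u) + (\<Sum>i<d. s i * u ^ (p ^ i))"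
    using right_division[of b d N c, OF b] by blast
  have g0: "R_fun p N g 0 = 0" by (rule fp_linear_0[OF fp_linear_R_fun])
  have zero: "(\<Sum>i<d. s i * u ^ (p ^ i)) = 0" for u
  proof (cases d)
    case (Suc d')
    have *: "(\<Sum>i<d. s i * u ^ (p ^ i)) = R_fun p d' s u" for u
      by (simp add: R_fun_def Suc lessThan_Suc_atMost)
    have sub: "W \<subseteq> {u. R_fun p d' s u = 0}"
      using gs(2) van F by (auto simp: g0 *)
    have "\<forall>i\<le>d'. s i = 0"
    proof (rule ccontr)
      assume "\<not> (\<forall>i\<le>d'. s i = 0)"
      then obtain i where i: "i \<le> d'" "s i \<noteq> 0" by blast
      have "p ^ d \<le> p ^ d'"
        using card_mono[OF R_fun_roots(1)[of i d' s, OF i] sub] R_fun_roots(2)[of i d' s, OF i] W by simp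
      then show False using Suc p_gt_1 by simp
    qed
    then show ?thesis unfolding * by (simp add: R_fun_def)
  qed simp
  have eq: "R_fun p (d + N) c u = R_fun p N g (R_fun p d b u)" for u using gs(2) zero by simp
  have "lin_poly (d + N) c = pcompose (lin_poly N g) (lin_poly d b)"
    by (rule poly_eqI_alg_closed) (simp add: poly_lin_poly poly_pcompose eq)
  then have "pderiv (lin_poly (d + N) c) = pderiv (pcompose (lin_poly N g) (lin_poly d b))" by simp
  then have "c 0 = g 0 * b 0" by (simp add: pderiv_pcompose pderiv_lin_poly pcompose_pCons)
  then show ?thesis using gs(1) eq by blast
qed

lemma telescope: "(\<Sum>j<n. t ^ (p ^ j)) ^ p - (\<Sum>j<n. t ^ (p ^ j)) = t ^ (p ^ n) - (t :: 'a)"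
proof -
  have "(\<Sum>j<n. t ^ (p ^ j)) ^ p = (\<Sum>j<n. t ^ (p ^ Suc j))"
    using pow_sum[of "\<lambda>j. t ^ (p ^ j)" "{..<n}" 1] by (simp add: mult.commute flip: power_mult)
  then show ?thesis using sum_lessThan_telescope[of "\<lambda>j. t ^ (p ^ j)" n] by (simp add: sum_subtractf)
qed

definition lin_fun :: "nat \<Rightarrow> ('a \<Rightarrow> 'a) \<Rightarrow> bool" where
  "lin_fun N l \<longleftrightarrow> (\<exists>c. \<forall>u. l u = R_fun p N c u)"

lemma lin_fun_monomial: "i \<le> N \<Longrightarrow> lin_fun N (\<lambda>u. b * u ^ (p ^ i))"
  unfolding lin_fun_def
  by (rule exI[of _ "\<lambda>j. if j = i then b else 0"])
    (simp add: R_fun_def if_distrib[of "\<lambda>z. z * _"] cong: if_cong)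

lemma lin_fun_add:
  "lin_fun N l \<Longrightarrow> lin_fun N l' \<Longrightarrow> lin_fun N (\<lambda>u. l u + l' u)"
proof -
  assume "lin_fun N l" "lin_fun N l'"
  then obtain c c' where "\<And>u. l u = R_fun p N c u" "\<And>u. l' u = R_fun p N c' u" by (auto simp: lin_fun_def)
  then show ?thesis unfolding lin_fun_def
    by (intro exI[of _ "\<lambda>i. c i + c' i"]) (simp add: R_fun_def sum.distrib algebra_simps)
qed

lemma lin_fun_uminus: "lin_fun N l \<Longrightarrow> lin_fun N (\<lambda>u. - l u)"
proof -
  assume "lin_fun N l"
  then obtain c where "\<And>u. l u = R_fun p N c u" by (auto simp: lin_fun_def)
  then show ?thesis unfolding lin_fun_def
    by (intro exI[of _ "\<lambda>i. - c i"]) (simp add: R_fun_def sum_negf)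
qed

lemma lin_fun_sum:
  "(\<And>i. i \<in> I \<Longrightarrow> lin_fun N (l i)) \<Longrightarrow>
    lin_fun N (\<lambda>u. \<Sum>i\<in>I. l i u)"
proof (induction I rule: infinite_finite_induct)
  case (insert i I)
  then show ?case by (simp add: lin_fun_add)
qed (auto simp: lin_fun_def R_fun_def intro!: exI[of _ "\<lambda>_. 0"])

end

section \<open>Maximal abelian subgroups of the Heisenberg group\<close>

locale heisenberg = frobenius_power p m FF for p m and FF :: "'a::alg_closed_field itself" +
  fixes e :: nat and a :: "nat \<Rightarrow> 'a"
  assumes e: "0 < e" and a_e: "a e \<noteq> 0"
begin

abbreviation "R \<equiv> R_fun p e a"
abbreviation "E \<equiv> E_fun p e a"
abbreviation "V \<equiv> V_set p e a"
abbreviation "f \<equiv> f_fun p e a"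

text \<open>The two sums in \<open>E_fun\<close> meet only at \<open>j = e\<close>, where
  \<open>a 0\<close> enters twice.\<close>

definition "E_coeff j = (if e \<le> j then a (j - e) ^ (p ^ e) else 0) + (if j \<le> e then a (e - j) ^ (p ^ j) else 0)"

lemma E_fun_eq: "E u = R_fun p (2 * e) E_coeff u"
proof -
  have "R u ^ (p ^ e) = (\<Sum>i\<le>e. a i ^ (p ^ e) * u ^ (p ^ (i + e)))"
    unfolding R_fun_def pow_sum power_mult_distrib pow_pow ..
  also have "\<dots> = (\<Sum>j\<in>{e..2 * e}. a (j - e) ^ (p ^ e) * u ^ (p ^ j))"
    by (rule sum.reindex_bij_witness[of _ "\<lambda>j. j - e" "\<lambda>i. i + e"]) auto
  also have "\<dots> = (\<Sum>j\<le>2 * e. (if e \<le> j then a (j - e) ^ (p ^ e) else 0) * u ^ (p ^ j))"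
    by (intro sum.mono_neutral_cong_left) auto
  finally have 1: "R u ^ (p ^ e) = \<dots>" .
  have "(\<Sum>i\<le>e. (a i * u) ^ (p ^ (e - i))) = (\<Sum>j\<le>e. a (e - j) ^ (p ^ j) * u ^ (p ^ j))"
    by (rule sum.reindex_bij_witness[of _ "\<lambda>j. e - j" "\<lambda>i. e - i"]) (auto simp: power_mult_distrib)
  also have "\<dots> = (\<Sum>j\<le>2 * e. (if j \<le> e then a (e - j) ^ (p ^ j) else 0) * u ^ (p ^ j))"
    by (intro sum.mono_neutral_cong_left) auto
  finally have 2: "(\<Sum>i\<le>e. (a i * u) ^ (p ^ (e - i))) = \<dots>" .
  show ?thesis unfolding E_fun_def 1 2 R_fun_def[of p "2 * e"] E_coeff_def distrib_right sum.distrib ..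
qed

lemma E_coeff_0: "E_coeff 0 = a e" and E_coeff_top: "E_coeff (2 * e) = a e ^ (p ^ e)"
  using e by (auto simp: E_coeff_def mult_2)

lemma fp_linear_E: "fp_linear E"
  using fp_linear_R_fun[of "2 * e" E_coeff] by (simp add: E_fun_eq[abs_def])

lemma V_iff: "u \<in> V \<longleftrightarrow> E u = 0"
  by (simp add: V_set_def)

lemma finite_V: "finite V" and card_V: "card V = p ^ (2 * e)"
  using R_fun_roots(1)[of 0 "2 * e" E_coeff] card_R_fun_roots[of E_coeff "2 * e"] a_e
  by (simp_all add: V_set_def E_fun_eq E_coeff_0 E_coeff_top del: mult_2)

lemma subspace_UNIV: "fp_subspace UNIV"
  by (simp add: fp_subspace_def)

lemma subspace_V: "fp_subspace V"
  using subspace_kernel[OF fp_linear_E subspace_UNIV] by (simp add: V_set_def)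

text \<open>Every inner sum of \<open>f\<close> telescopes under \<open>z ^ p - z\<close>. For
  \<open>v\<close> in \<open>V\<close> the last term vanishes and the rest is the polarisation of
  \<open>u R(u)\<close>, which is why the product stays in the Heisenberg group.\<close>

lemma f_equation: "f u v ^ p - f u v = v * R u + u * R v - u ^ (p ^ e) * E v"
proof -
  define S where "S i = (\<Sum>j<e - i. (a i * u ^ (p ^ i) * v) ^ (p ^ j))" for i
  define T where "T = (\<Sum>i<e. (u * R v) ^ (p ^ i))"
  have f: "f u v = - ((\<Sum>i<e. S i) + T)" by (simp add: f_fun_def S_def T_def sum.distrib)
  have S: "S i ^ p - S i = (a i * u ^ (p ^ i) * v) ^ (p ^ (e - i)) - a i * u ^ (p ^ i) * v" for i
    unfolding S_def by (rule telescope)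
  have T: "T ^ p - T = (u * R v) ^ (p ^ e) - u * R v" unfolding T_def by (rule telescope)
  have "f u v ^ (p ^ 1) = - ((\<Sum>i<e. S i ^ (p ^ 1)) + T ^ (p ^ 1))"
    unfolding f pow_uminus pow_add pow_sum ..
  then have fp: "f u v ^ p = - ((\<Sum>i<e. S i ^ p) + T ^ p)" by (simp only: power_one_right)
  have "f u v ^ p - f u v = - ((\<Sum>i<e. S i ^ p - S i) + (T ^ p - T))"
    unfolding fp unfolding f by (simp add: sum_subtractf)
  \<comment> \<open>The added term \<open>i = e\<close> is zero, since its exponent is
    \<open>p ^ 0\<close>.\<close>
  also have "(\<Sum>i<e. S i ^ p - S i) =
      (\<Sum>i\<le>e. (a i * u ^ (p ^ i) * v) ^ (p ^ (e - i)) - a i * u ^ (p ^ i) * v)"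
    unfolding S by (simp flip: lessThan_Suc_atMost)
  also have "\<dots> = u ^ (p ^ e) * (\<Sum>i\<le>e. (a i * v) ^ (p ^ (e - i))) - v * R u"
    unfolding sum_subtractf R_fun_def sum_distrib_left
    by (intro arg_cong2[of _ _ _ _ "(-)"] sum.cong)
      (auto simp: power_mult_distrib pow_pow)
  finally show ?thesis
    unfolding T by (simp add: E_fun_def power_mult_distrib algebra_simps)
qed

lemma fp_linear_f1: "fp_linear (\<lambda>u. f u v)"
  unfolding f_fun_def by (intro fp_linear_intros fp_linear_sum)

lemma fp_linear_f2: "fp_linear (f u)"
  unfolding f_fun_def
  by (intro fp_linear_intros fp_linear_sum fp_linear_R_fun)

definition D :: "'a \<Rightarrow> 'a \<Rightarrow> 'a" where "D u v = f u v - f v u"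

lemma fp_linear_D1: "fp_linear (\<lambda>u. D u v)"
  unfolding D_def by (intro fp_linear_intros fp_linear_f1 fp_linear_f2)

lemma fp_linear_D2: "fp_linear (D u)"
  unfolding D_def by (intro fp_linear_intros fp_linear_f1 fp_linear_f2)

lemma D_self: "D u u = 0" and D_swap: "D v u = - D u v"
  by (simp_all add: D_def)

lemma D_equation: "D u v ^ p - D u v = v ^ (p ^ e) * E u - u ^ (p ^ e) * E v"
proof -
  have "D u v ^ p - D u v = (f u v ^ p - f u v) - (f v u ^ p - f v u)"
    using pow_diff[of "f u v" "f v u" 1] by (simp add: D_def)
  then show ?thesis unfolding f_equation by simp
qed

lemma D_Fp: "u \<in> V \<Longrightarrow> v \<in> V \<Longrightarrow> D u v \<in> Fp"
  using D_equation[of u v] by (simp add: V_iff Fq_def)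

text \<open>The bound is one below the exponent \<open>2 * e\<close> of \<open>E\<close>. In
  \<open>E_factorisation\<close> this makes the top coefficient vanish when \<open>D\<close> is
  factored.\<close>

lemma lin_fun_D: "lin_fun (2 * e - 1) (\<lambda>u. D u v)"
proof -
  have 1: "lin_fun (2 * e - 1) (\<lambda>u. f u v)"
  proof -
    have "f u v = - (\<Sum>i<e. (\<Sum>j<e - i. (a i * v) ^ (p ^ j) * u ^ (p ^ (i + j))) + R v ^ (p ^ i) * u ^ (p ^ i))" for u
      unfolding f_fun_def power_mult_distrib pow_pow by (simp add: mult_ac)
    then show ?thesis
      by (simp only:) (intro lin_fun_uminus lin_fun_sum lin_fun_add lin_fun_monomial; simp)
  qed
  have 2: "lin_fun (2 * e - 1) (\<lambda>u. f v u)"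
  proof -
    have "f v u = - (\<Sum>i<e. (\<Sum>j<e - i. (a i * v ^ (p ^ i)) ^ (p ^ j) * u ^ (p ^ j)) +
        (\<Sum>j\<le>e. (v * a j) ^ (p ^ i) * u ^ (p ^ (j + i))))" for u
      unfolding f_fun_def R_fun_def power_mult_distrib pow_sum sum_distrib_left pow_pow by (simp add: mult_ac)
    then show ?thesis
      by (simp only:) (intro lin_fun_uminus lin_fun_sum lin_fun_add lin_fun_monomial; simp)
  qed
  show ?thesis unfolding D_def using lin_fun_add[OF 1 lin_fun_uminus[OF 2]] by simp
qed

abbreviation "H \<equiv> Heisenberg p e a"

lemma carrier_H:
  "(\<alpha>, \<beta>) \<in> carrier H \<longleftrightarrow> \<alpha> \<in> V \<and> \<beta> ^ p - \<beta> = \<alpha> * R \<alpha>"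
  and mult_H: "(\<alpha>, \<beta>) \<otimes>\<^bsub>H\<^esub> (\<alpha>', \<beta>') = (\<alpha> + \<alpha>', \<beta> + \<beta>' + f \<alpha> \<alpha>')"
  and one_H: "\<one>\<^bsub>H\<^esub> = (0, 0)"
  by (simp_all add: Heisenberg_def)

lemma power_p_add: "(u + v :: 'a) ^ p = u ^ p + v ^ p"
  using pow_add[of u v 1] by simp

lemma power_p_uminus: "(- u :: 'a) ^ p = - (u ^ p)"
  using pow_uminus[of u 1] by simp

lemma R_add: "R (u + v) = R u + R v" and R_uminus: "R (- u) = - R u"
  using fp_linear_R_fun[of e a] by (simp_all add: fp_linear_add fp_linear_uminus)

lemma f_add1: "f (u + u') v = f u v + f u' v" and f_add2: "f u (v + v') = f u v + f u v'"
  and f_uminus1: "f (- u) v = - f u v" and f_uminus2: "f u (- v) = - f u v"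
  and f_zero1: "f 0 v = 0" and f_zero2: "f u 0 = 0"
  using fp_linear_f1[of v] fp_linear_f2[of u]
  by (simp_all add: fp_linear_add fp_linear_uminus fp_linear_0)
    (rule fp_linear_add[of "\<lambda>u. f u v"] fp_linear_uminus[of "\<lambda>u. f u v"] fp_linear_0[of "\<lambda>u. f u v"], assumption)+

lemma f_V: "v \<in> V \<Longrightarrow> f u v ^ p = f u v + v * R u + u * R v"
  using f_equation[of u v] by (simp add: V_iff algebra_simps)

lemma H_mult_closed:
  assumes "g \<in> carrier H" "h \<in> carrier H"
  shows "g \<otimes>\<^bsub>H\<^esub> h \<in> carrier H"
proof -
  obtain \<alpha> \<beta> \<alpha>' \<beta>' where gh: "g = (\<alpha>, \<beta>)" "h = (\<alpha>', \<beta>')" by (metis surj_pair)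
  with assms have *: "\<alpha> \<in> V" "\<beta> ^ p = \<beta> + \<alpha> * R \<alpha>" "\<alpha>' \<in> V" "\<beta>' ^ p = \<beta>' + \<alpha>' * R \<alpha>'"
    by (auto simp: carrier_H algebra_simps)
  then show ?thesis
    by (simp add: gh mult_H carrier_H subspace_add[OF subspace_V] power_p_add f_V R_add algebra_simps)
qed

definition H_inverse :: "'a \<times> 'a \<Rightarrow> 'a \<times> 'a" where
  "H_inverse g = (- fst g, f (fst g) (fst g) - snd g)"

lemma H_inverse_closed: "g \<in> carrier H \<Longrightarrow> H_inverse g \<in> carrier H"
proof -
  assume g: "g \<in> carrier H"
  obtain \<alpha> \<beta> where g': "g = (\<alpha>, \<beta>)" by (metis surj_pair)
  with g have *: "\<alpha> \<in> V" "\<beta> ^ p = \<beta> + \<alpha> * R \<alpha>" by (auto simp: carrier_H algebra_simps)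
  have "(f \<alpha> \<alpha> - \<beta>) ^ p = f \<alpha> \<alpha> ^ p - \<beta> ^ p"
    using power_p_add[of "f \<alpha> \<alpha>" "- \<beta>"] by (simp add: power_p_uminus)
  then show ?thesis using *
    by (simp add: g' H_inverse_def carrier_H subspace_uminus[OF subspace_V] f_V R_uminus algebra_simps)
qed

lemma H_inverse_left: "H_inverse g \<otimes>\<^bsub>H\<^esub> g = \<one>\<^bsub>H\<^esub>"
  by (cases g) (simp add: H_inverse_def mult_H one_H f_uminus1)

lemma group_H: "group H"
proof (rule groupI)
  show "g \<otimes>\<^bsub>H\<^esub> h \<in> carrier H" if "g \<in> carrier H" "h \<in> carrier H" for g h
    using H_mult_closed that .
  show "\<one>\<^bsub>H\<^esub> \<in> carrier H" using subspace_zero[OF subspace_V] p_gt_1 by (simp add: one_H carrier_H)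
  show "(g \<otimes>\<^bsub>H\<^esub> h) \<otimes>\<^bsub>H\<^esub> l = g \<otimes>\<^bsub>H\<^esub> (h \<otimes>\<^bsub>H\<^esub> l)" for g h l
    by (cases g; cases h; cases l) (simp add: mult_H f_add1 f_add2)
  show "\<one>\<^bsub>H\<^esub> \<otimes>\<^bsub>H\<^esub> g = g" for g by (cases g) (simp add: mult_H one_H f_zero1)
  show "\<exists>h\<in>carrier H. h \<otimes>\<^bsub>H\<^esub> g = \<one>\<^bsub>H\<^esub>" if "g \<in> carrier H" for g
    using H_inverse_closed[OF that] H_inverse_left by blast
qed

lemma inv_H: "g \<in> carrier H \<Longrightarrow> inv\<^bsub>H\<^esub> g = H_inverse g"
  by (rule group.inv_equality[OF group_H H_inverse_left]) (simp_all add: H_inverse_closed)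

lemma isotropic_subgroup:
  assumes Z: "\<And>u v. u \<in> Z \<Longrightarrow> v \<in> Z \<Longrightarrow> u + v \<in> Z" "\<And>u. u \<in> Z \<Longrightarrow> - u \<in> Z" "0 \<in> Z"
    and iso: "\<And>u v. u \<in> Z \<Longrightarrow> v \<in> Z \<Longrightarrow> D u v = 0"
  shows "abelian_subgroup {g \<in> carrier H. fst g \<in> Z} H"
  unfolding abelian_subgroup_def
proof (intro conjI ballI)
  show "subgroup {g \<in> carrier H. fst g \<in> Z} H"
  proof (rule group.subgroupI[OF group_H])
    show "{g \<in> carrier H. fst g \<in> Z} \<noteq> {}"
      using Z(3) group.is_monoid[OF group_H, THEN monoid.one_closed] by (auto simp: one_H)
  next
    fix g assume "g \<in> {g \<in> carrier H. fst g \<in> Z}"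
    then show "inv\<^bsub>H\<^esub> g \<in> {g \<in> carrier H. fst g \<in> Z}"
      using Z(2) H_inverse_closed[of g] by (simp add: inv_H) (simp add: H_inverse_def)
  next
    fix g h assume gh: "g \<in> {g \<in> carrier H. fst g \<in> Z}" "h \<in> {g \<in> carrier H. fst g \<in> Z}"
    then have "fst (g \<otimes>\<^bsub>H\<^esub> h) \<in> Z" using Z(1) by (cases g; cases h) (simp add: mult_H)
    then show "g \<otimes>\<^bsub>H\<^esub> h \<in> {g \<in> carrier H. fst g \<in> Z}" using gh H_mult_closed by blast
  qed auto
next
  fix g h assume "g \<in> {g \<in> carrier H. fst g \<in> Z}" "h \<in> {g \<in> carrier H. fst g \<in> Z}"
  then show "g \<otimes>\<^bsub>H\<^esub> h = h \<otimes>\<^bsub>H\<^esub> g"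
    using iso[of "fst g" "fst h"] by (cases g; cases h) (simp add: mult_H D_def)
qed

text \<open>If \<open>g\<close> is orthogonal to the image \<open>W\<close>, all elements lying over
  \<open>W + Fp * g\<close> form an abelian subgroup containing \<open>A\<close>; by maximality it
  is \<open>A\<close>, so \<open>g\<close> is in \<open>W\<close>. At first \<open>W\<close> is only
  known to be an additive group; closure under \<open>Fp\<close> is inherited from the orthogonal
  complement.\<close>

lemma maximal_abelian_image:
  assumes A: "maximal_abelian_subgroup A H"
  shows "fst ` A = perp D V (fst ` A)" "fp_subspace (fst ` A)"
proof -
  define W where "W = fst ` A"
  have ab: "abelian_subgroup A H" and max: "\<And>B. abelian_subgroup B H \<Longrightarrow> A \<subseteq> B \<Longrightarrow> B = A"
    using A by (auto simp: maximal_abelian_subgroup_def)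
  have sub: "subgroup A H" and comm: "\<And>g h. g \<in> A \<Longrightarrow> h \<in> A \<Longrightarrow> g \<otimes>\<^bsub>H\<^esub> h = h \<otimes>\<^bsub>H\<^esub> g"
    using ab by (auto simp: abelian_subgroup_def)
  have AH: "A \<subseteq> carrier H" by (rule subgroup.subset[OF sub])
  have WV: "W \<subseteq> V" using AH carrier_H by (fastforce simp: W_def)
  have W0: "0 \<in> W" using subgroup.one_closed[OF sub] by (force simp: one_H W_def)
  have Wadd: "u + v \<in> W" if uv: "u \<in> W" "v \<in> W" for u v
  proof -
    obtain \<beta> \<beta>' where "(u, \<beta>) \<in> A" "(v, \<beta>') \<in> A" using uv by (auto simp: W_def)
    from subgroup.m_closed[OF sub this] show ?thesis by (force simp: mult_H W_def)
  qed
  have Wneg: "- u \<in> W" if u: "u \<in> W" for u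
  proof -
    obtain \<beta> where g: "(u, \<beta>) \<in> A" using u by (auto simp: W_def)
    then have "H_inverse (u, \<beta>) \<in> A" using subgroup.m_inv_closed[OF sub g] AH inv_H by auto
    then show ?thesis by (force simp: H_inverse_def W_def)
  qed
  have iso: "D u v = 0" if uv: "u \<in> W" "v \<in> W" for u v
  proof -
    obtain \<beta> \<beta>' where "(u, \<beta>) \<in> A" "(v, \<beta>') \<in> A" using uv by (auto simp: W_def)
    from comm[OF this] show ?thesis by (simp add: mult_H D_def)
  qed
  have "g \<in> W" if g: "g \<in> perp D V W" for g
  proof -
    have gV: "g \<in> V" and gW: "\<And>w. w \<in> W \<Longrightarrow> D g w = 0" using g by (auto simp: perp_def)
    have Wg: "D w g = 0" if "w \<in> W" for w using gW[OF that] D_swap[of w g] by simp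
    define Z where "Z = {w + c * g | w c. w \<in> W \<and> c \<in> Fp}"
    have Z_I: "w + c * g \<in> Z" if "w \<in> W" "c \<in> Fp" for w c using that by (auto simp: Z_def)
    have Z1: "u + v \<in> Z" if uZ: "u \<in> Z" "v \<in> Z" for u v
    proof -
      obtain w c w' c' where *: "w \<in> W" "c \<in> Fp" "u = w + c * g" "w' \<in> W" "c' \<in> Fp" "v = w' + c' * g"
        using uZ unfolding Z_def by blast
      have "(w + w') + (c + c') * g \<in> Z" by (intro Z_I Wadd subring_set_add[OF Fp_ring] *)
      then show ?thesis by (simp add: * algebra_simps)
    qed
    have Z2: "- u \<in> Z" if uZ: "u \<in> Z" for u
    proof -
      obtain w c where *: "w \<in> W" "c \<in> Fp" "u = w + c * g" using uZ unfolding Z_def by blast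
      have "- w + (- c) * g \<in> Z" by (intro Z_I Wneg subring_set_uminus[OF Fp_ring] *)
      then show ?thesis by (simp add: *)
    qed
    have WZ: "W \<subseteq> Z" using Z_I[OF _ subring_set_zero[OF Fp_ring]] by auto
    have gZ: "g \<in> Z" using Z_I[OF W0 subring_set_one[OF Fp_ring]] by simp
    have iso': "D u v = 0" if uZ: "u \<in> Z" "v \<in> Z" for u v
    proof -
      obtain w c w' c' where *: "w \<in> W" "c \<in> Fp" "u = w + c * g" "w' \<in> W" "c' \<in> Fp" "v = w' + c' * g"
        using uZ unfolding Z_def by blast
      have D1: "D (w + c * g) v = D w v + c * D g v" for v
        using fp_linear_add[OF fp_linear_D1[of v]] fp_linear_scale[OF fp_linear_D1[of v] *(2)] by simp
      have D2: "D u (w' + c' * g) = D u w' + c' * D u g" for u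
        using fp_linear_add[OF fp_linear_D2[of u]] fp_linear_scale[OF fp_linear_D2[of u] *(5)] by simp
      show ?thesis unfolding *(3,6) D1 D2 using * iso gW Wg D_self by simp
    qed
    have "abelian_subgroup {g \<in> carrier H. fst g \<in> Z} H"
      by (rule isotropic_subgroup) (use Z1 Z2 WZ W0 iso' in auto)
    moreover have "A \<subseteq> {g \<in> carrier H. fst g \<in> Z}" using AH WZ by (auto simp: W_def)
    ultimately have eq: "{g \<in> carrier H. fst g \<in> Z} = A" by (rule max)
    obtain \<beta> where "\<beta> ^ p - \<beta> = g * R g" using artin_schreier_root[OF p_gt_1] by blast
    then have "(g, \<beta>) \<in> {g \<in> carrier H. fst g \<in> Z}" using gV gZ by (simp add: carrier_H)
    then show ?thesis unfolding eq by (force simp: W_def)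
  qed
  then have W: "W = perp D V W" using WV iso by (auto simp: perp_def)
  show "fst ` A = perp D V (fst ` A)" using W by (simp only: W_def)
  have "fp_subspace (perp D V W)" by (rule subspace_perp[OF subspace_V fp_linear_D1])
  then show "fp_subspace (fst ` A)" using W by (simp only: W_def)
qed

end

section \<open>Factoring \<open>E\<close> through the polynomial of a self-orthogonal
  subspace\<close>

locale lagrangian = heisenberg +
  fixes W :: "'a set"
  assumes W_perp: "W = perp D V W"
begin

lemma W_V: "W \<subseteq> V" and subspace_W: "fp_subspace W" and D_W: "u \<in> W \<Longrightarrow> v \<in> W \<Longrightarrow> D u v = 0"
proof -
  show "W \<subseteq> V" "u \<in> W \<Longrightarrow> v \<in> W \<Longrightarrow> D u v = 0" using W_perp by (auto simp: perp_def)
  show "fp_subspace W" by (subst W_perp) (rule subspace_perp[OF subspace_V fp_linear_D1])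
qed

lemma finite_W: "finite W"
  using W_V finite_V finite_subset by blast

text \<open>A chain from 0 to \<open>W\<close>, with \<open>W\<close> its own complement, gives the
  lower half of \<open>card W = p ^ e\<close>. The upper half is obtained in
  \<open>E_factorisation\<close> by counting roots, without showing \<open>D\<close>
  nondegenerate.\<close>

lemma card_W_ge: "p ^ e \<le> card W"
proof -
  have "perp D V {0} = V" by (auto simp: perp_def fp_linear_0[OF fp_linear_D2])
  moreover have "card {0 :: 'a} * card (perp D V {0}) \<le> card W * card (perp D V W)"
    by (rule card_perp_mono[of V "{0}" W D, OF subspace_V finite_V subspace_trivial subspace_W _ finite_W fp_linear_D1 fp_linear_D2 D_Fp])
      (use subspace_zero[OF subspace_W] W_V in auto)
  ultimately have "p ^ (2 * e) \<le> card W * card W" using W_perp by (simp add: card_V)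
  then have "(p ^ e)\<^sup>2 \<le> (card W)\<^sup>2" by (simp add: power2_eq_square power_mult mult.commute)
  then show ?thesis by (rule power2_le_imp_le) simp
qed

text \<open>\<open>E\<close> is self-adjoint up to a Frobenius twist, so a left factor \<open>G\<close> in
  \<open>E = G \<circ> F\<close> is determined by \<open>F\<close> up to the scalar \<open>\<kappa>\<close>.  The adjoint of \<open>G\<close> vanishes on \<open>W\<close>
  because each \<open>D u \<beta>\<close> with \<open>\<beta> \<in> W\<close> factors through \<open>F\<close>.\<close>

lemma E_factorisation:
  assumes card_W: "card W = p ^ d" and b: "b d = 1"
    and F: "\<And>u. (\<Prod>w\<in>W. u - w) = R_fun p d b u"
  shows "d = e" and "\<exists>\<kappa>. a e = \<kappa> * b 0 \<and> (\<forall>u. E u = (\<Sum>i\<le>e. (\<kappa> * b i * R_fun p e b u) ^ (p ^ (e - i))))"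
proof -
  have FW: "R_fun p d b w = 0" if "w \<in> W" for w
    using F[of w] that finite_W by (metis (no_types, lifting) prod_zero right_minus_eq)
  have ed: "e \<le> d" using card_W_ge card_W p_gt_1 by simp
  have "p ^ d \<le> p ^ (2 * e)" using card_mono[OF finite_V W_V] card_V card_W by simp
  then have de: "d \<le> 2 * e" using p_gt_1 by simp
  define N where "N = 2 * e - d"
  have dN: "d + N = 2 * e" using de by (simp add: N_def)
  obtain g where g: "g N = E_coeff (d + N)" "E_coeff 0 = g 0 * b 0"
    "\<And>u. R_fun p (d + N) E_coeff u = R_fun p N g (R_fun p d b u)"
  proof -
    have "R_fun p (d + N) E_coeff w = 0" if "w \<in> W" for w
      using that W_V V_iff E_fun_eq unfolding dN by auto
    from right_factor[OF b finite_W card_W FW this] show ?thesis using that by blast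
  qed
  have g0: "g 0 \<noteq> 0" using g(2) a_e by (auto simp: E_coeff_0)
  \<comment> \<open>Roots of order \<open>p ^ e\<close> undo the Frobenius twist of the adjoint;
    \<open>hh\<close> collects the coefficients of the untwisted adjoint of
    \<open>g\<close>.\<close>
  define h where "h i = (SOME z. z ^ (p ^ e) = g i)" for i
  have h: "h i ^ (p ^ e) = g i" for i
    unfolding h_def by (rule someI_ex) (use nth_root_exists[of "p ^ e" "g i"] pow_pos in auto)
  define hh where "hh j = h (N - j) ^ (p ^ j)" for j
  have hhW: "R_fun p N hh \<beta> = 0" if \<beta>: "\<beta> \<in> W" for \<beta>
  proof -
    obtain c where c: "\<And>u. D u \<beta> = R_fun p (2 * e - 1) c u" using lin_fun_D by (auto simp: lin_fun_def)
    define c' where "c' i = (if i \<le> 2 * e - 1 then c i else 0)" for i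
    have c': "D u \<beta> = R_fun p (d + N) c' u" for u
    proof -
      have "R_fun p (2 * e - 1) c u = R_fun p (2 * e - 1) c' u" by (simp add: R_fun_def c'_def)
      also have "\<dots> = R_fun p (Suc (2 * e - 1)) c' u"
        unfolding R_fun_def sum.atMost_Suc by (simp add: c'_def)
      finally show ?thesis using c e dN by simp
    qed
    have c'0: "c' (d + N) = 0" using e dN by (simp add: c'_def)
    have "R_fun p (d + N) c' w = 0" if "w \<in> W" for w using D_W[OF that \<beta>] c' by simp
    from right_factor[OF b finite_W card_W FW this] obtain \<mu> where \<mu>: "\<mu> N = 0"
      "\<And>u. R_fun p (d + N) c' u = R_fun p N \<mu> (R_fun p d b u)" using c'0 by auto
    \<comment> \<open>Coefficients of the additive polynomial
      \<open>z \<mapsto> \<mu>(z) ^ p - \<mu>(z)\<close>, which stops at \<open>N\<close> because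
      \<open>\<mu> N = 0\<close>. By \<open>D_equation\<close> and surjectivity of the right factor
      they equal \<open>\<beta> ^ (p ^ e) * g i\<close>.\<close>
    define \<mu>' where "\<mu>' i = (if i = 0 then 0 else \<mu> (i - 1) ^ p) - \<mu> i" for i
    have \<mu>'_eq: "R_fun p N \<mu> z ^ p - R_fun p N \<mu> z = R_fun p N \<mu>' z" for z
    proof -
      have "R_fun p N \<mu> z ^ p = (\<Sum>i\<le>N. \<mu> i ^ p * z ^ (p ^ Suc i))"
        using pow_sum[of "\<lambda>i. \<mu> i * z ^ p ^ i" "{..N}" 1]
        by (simp add: R_fun_def power_mult_distrib mult.commute flip: power_mult)
      also have "\<dots> = (\<Sum>i\<le>Suc N. (if i = 0 then 0 else \<mu> (i - 1) ^ p) * z ^ (p ^ i))"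
        by (subst sum.atMost_Suc_shift) simp
      also have "\<dots> = (\<Sum>i\<le>N. (if i = 0 then 0 else \<mu> (i - 1) ^ p) * z ^ (p ^ i))"
        using \<mu>(1) p_gt_1 by (simp add: power_0_left)
      finally have 1: "R_fun p N \<mu> z ^ p = \<dots>" .
      show ?thesis unfolding 1 unfolding R_fun_def \<mu>'_def sum_subtractf[symmetric] left_diff_distrib ..
    qed
    have coeffs: "\<mu>' i = \<beta> ^ (p ^ e) * g i" if "i \<le> N" for i
    proof (rule R_fun_eqD[OF _ that])
      fix z
      obtain u where u: "R_fun p d b u = z" using R_fun_surj[of b d z] b by auto
      have "R_fun p N \<mu> z ^ p - R_fun p N \<mu> z = \<beta> ^ (p ^ e) * E u"
        using D_equation[of u \<beta>] \<beta> W_V V_iff c' \<mu>(2) by (auto simp: u)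
      also have "E u = R_fun p N g z" using g(3)[of u] by (simp add: E_fun_eq dN u)
      finally show "R_fun p N \<mu>' z = R_fun p N (\<lambda>i. \<beta> ^ (p ^ e) * g i) z"
        by (simp add: \<mu>'_eq) (simp add: R_fun_def sum_distrib_left mult.assoc)
    qed
    \<comment> \<open>The recursion for \<open>\<mu>\<close> is solved from the bottom. At
      \<open>n = N\<close> the value is 0, which says that \<open>\<beta>\<close> is a root of the
      adjoint of \<open>g\<close>.\<close>
    have "(\<Sum>i\<le>n. (\<beta> ^ (p ^ e) * g i) ^ (p ^ (n - i))) = - \<mu> n" if "n \<le> N" for n
      using that
    proof (induction n)
      case 0
      then show ?case using coeffs[of 0] by (simp add: \<mu>'_def)
    next
      case (Suc n)
      have "(\<Sum>i\<le>Suc n. (\<beta> ^ (p ^ e) * g i) ^ (p ^ (Suc n - i))) =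
          (\<Sum>i\<le>n. ((\<beta> ^ (p ^ e) * g i) ^ (p ^ (n - i))) ^ (p ^ 1)) + \<beta> ^ (p ^ e) * g (Suc n)"
        unfolding pow_pow by (simp add: Suc_diff_le)
      also have "\<dots> = (- \<mu> n) ^ (p ^ 1) + \<beta> ^ (p ^ e) * g (Suc n)"
        unfolding Suc.IH[OF Suc_leD[OF Suc.prems], symmetric] pow_sum ..
      also have "\<beta> ^ (p ^ e) * g (Suc n) = \<mu> n ^ p - \<mu> (Suc n)"
        using coeffs[of "Suc n"] Suc.prems by (simp add: \<mu>'_def)
      also have "(- \<mu> n) ^ (p ^ 1) + \<dots> = - \<mu> (Suc n)" unfolding pow_uminus by simp
      finally show ?case .
    qed
    from this[of N] have "0 = (\<Sum>i\<le>N. (\<beta> ^ (p ^ e) * g i) ^ (p ^ (N - i)))" by (simp add: \<mu>)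
    also have "\<dots> = (\<Sum>i\<le>N. (h i ^ (p ^ (N - i)) * \<beta> ^ (p ^ (N - i))) ^ (p ^ e))"
      unfolding h[symmetric] power_mult_distrib pow_pow by (simp add: add.commute mult.commute)
    also have "\<dots> = (\<Sum>i\<le>N. h i ^ (p ^ (N - i)) * \<beta> ^ (p ^ (N - i))) ^ (p ^ e)"
      unfolding pow_sum ..
    also have "(\<Sum>i\<le>N. h i ^ (p ^ (N - i)) * \<beta> ^ (p ^ (N - i))) = R_fun p N hh \<beta>"
      unfolding R_fun_def hh_def
      by (rule sum.reindex_bij_witness[of _ "\<lambda>j. N - j" "\<lambda>i. N - i"]) auto
    finally show ?thesis using pow_pos[of e] by simp
  qed
  have hN: "hh N \<noteq> 0" using h[of 0] g0 pow_pos[of e] unfolding hh_def by (auto simp: power_0_left)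
  \<comment> \<open>The \<open>p ^ d\<close> elements of \<open>W\<close> are roots of a nonzero
    polynomial of degree at most \<open>p ^ N\<close>, so \<open>d \<le> N = 2 * e - d\<close>; this
    is the missing upper bound on \<open>d\<close>.\<close>
  have "W \<subseteq> {u. R_fun p N hh u = 0}" using hhW by auto
  from card_mono[OF R_fun_roots(1)[of N N hh] this] R_fun_roots(2)[of N N hh] hN
  have "p ^ d \<le> p ^ N" by (simp add: card_W)
  then have "d \<le> N" using p_gt_1 by simp
  then show de': "d = e" using ed by (simp add: N_def)
  then have Ne: "N = e" by (simp add: N_def)
  \<comment> \<open>The adjoint now has the same degree as the polynomial of \<open>W\<close> and
    vanishes on \<open>W\<close>, so it is a scalar multiple of it; the scalar
    \<open>hh e = g 0\<close> is the \<open>\<kappa>\<close> sought.\<close>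
  have "R_fun p (d + 0) hh w = 0" if "w \<in> W" for w using hhW[OF that] by (simp add: Ne de')
  from right_factor[OF b finite_W card_W FW this] obtain k
    where "k 0 = hh e" "\<And>u. R_fun p e hh u = R_fun p 0 k (R_fun p e b u)" by (auto simp: de')
  then have k: "R_fun p e hh u = R_fun p e (\<lambda>i. hh e * b i) u" for u
    by (simp add: R_fun_def sum_distrib_left mult.assoc)
  have hb: "hh j = hh e * b j" if "j \<le> e" for j by (rule R_fun_eqD[OF k that])
  have he: "hh e = g 0" using h[of 0] by (simp add: hh_def Ne)
  have gi: "g i = (g 0 * b (e - i)) ^ (p ^ i)" if "i \<le> e" for i
  proof -
    have "(hh (e - i)) ^ (p ^ i) = g i"
      using that unfolding hh_def pow_pow Ne by (simp add: h)
    then show ?thesis using hb[of "e - i"] he by simp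
  qed
  have "E u = (\<Sum>i\<le>e. (g 0 * b i * R_fun p e b u) ^ (p ^ (e - i)))" for u
  proof -
    have "E u = R_fun p e g (R_fun p e b u)" using g(3)[of u] unfolding dN by (simp add: E_fun_eq Ne de')
    also have "\<dots> = (\<Sum>i\<le>e. (g 0 * b (e - i) * R_fun p e b u) ^ (p ^ i))"
      unfolding R_fun_def[of p e g]
    proof (intro sum.cong refl)
      fix i assume "i \<in> {..e}"
      then have "g i = (g 0 * b (e - i)) ^ (p ^ i)" by (intro gi) simp
      then show "g i * R_fun p e b u ^ (p ^ i) = (g 0 * b (e - i) * R_fun p e b u) ^ (p ^ i)"
        by (simp only: power_mult_distrib[symmetric])
    qed
    also have "\<dots> = (\<Sum>i\<le>e. (g 0 * b i * R_fun p e b u) ^ (p ^ (e - i)))"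
      by (rule sum.reindex_bij_witness[of _ "\<lambda>j. e - j" "\<lambda>i. e - i"]) auto
    finally show ?thesis .
  qed
  then show "\<exists>\<kappa>. a e = \<kappa> * b 0 \<and> (\<forall>u. E u = (\<Sum>i\<le>e. (\<kappa> * b i * R_fun p e b u) ^ (p ^ (e - i))))"
    using g(2) by (intro exI[of _ "g 0"]) (simp add: E_coeff_0)
qed

end

section \<open>Quadratic forms given by the trace\<close>

locale finite_trace = frobenius_power p m FF for p m and FF :: "'a::alg_closed_field itself" +
  fixes n q :: nat
  assumes n: "0 < n" and q: "q = p ^ n" and odd_p: "odd p"
begin

abbreviation k :: "'a set" where "k \<equiv> Fq q"
abbreviation Tr :: "'a \<Rightarrow> 'a" where "Tr \<equiv> trace_Fq p n"

lemma card_k: "card k = q" and finite_k: "finite k"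
  using card_Fq[OF char, of q "m * n"] m n by (simp_all add: q p_pow)

lemma subfield_k: "subfield_set k"
  by (rule subfield_set_Fq[OF char]) (use q p_pow in simp)

lemma k_ring: "subring_set k" and k_inverse: "u \<in> k \<Longrightarrow> inverse u \<in> k"
  using subfield_k by (auto simp: subfield_set_def)

lemma k_divide: "u \<in> k \<Longrightarrow> v \<in> k \<Longrightarrow> u / v \<in> k"
  by (simp add: divide_inverse k_inverse subring_set_mult[OF k_ring])

lemma Fp_k: "Fp \<subseteq> k"
  using Fp_pow by (auto simp: Fq_def q)

lemma q_gt_1: "1 < q"
  unfolding q by (rule one_less_power[OF p_gt_1 n])

lemma odd_q: "odd q"
  using odd_p by (simp add: q)

lemma subspace_k: "fp_subspace k"
  using Fp_k k_ring unfolding fp_subspace_def by (auto intro: subring_set_intros)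

lemma two_nonzero: "(2 :: 'a) \<noteq> 0"
proof
  assume "(2 :: 'a) = 0"
  then have "CHAR('a) dvd 2" using of_nat_eq_0_iff_char_dvd[of 2, where ?'a = 'a] by simp
  then have "CHAR('a) = 2" using char primes_dvd_imp_eq two_is_prime_nat by blast
  then show False using odd_p m p by simp
qed

lemma fp_linear_Tr: "fp_linear Tr"
  unfolding trace_Fq_def[abs_def] by (intro fp_linear_sum fp_linear_intros)

lemmas Tr_add = fp_linear_add[OF fp_linear_Tr]
  and Tr_scale = fp_linear_scale[OF fp_linear_Tr]
  and Tr_0 = fp_linear_0[OF fp_linear_Tr]
  and Tr_uminus = fp_linear_uminus[OF fp_linear_Tr]

lemma Tr_pow: "Tr (u ^ (p ^ i)) = Tr u ^ (p ^ i)"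
  unfolding trace_Fq_def pow_sum pow_pow by (simp add: add.commute)

lemma Tr_Fp: "u \<in> k \<Longrightarrow> Tr u \<in> Fp"
  using telescope[of u n] by (simp add: trace_Fq_def Fq_def q)

lemma Tr_frobenius: "u \<in> k \<Longrightarrow> Tr (u ^ (p ^ i)) = Tr u"
  by (simp add: Tr_pow Fp_pow Tr_Fp)

text \<open>Valid on the whole closure, where the right side vanishes exactly on \<open>k\<close>: a
  root of \<open>y ^ p - y = z\<close> is rational if and only if \<open>Tr z = 0\<close>.\<close>

lemma Tr_artin_schreier: "Tr (u ^ p - u) = u ^ q - u"
proof -
  have "Tr (u ^ p - u) = Tr (u ^ p) - Tr u" by (rule fp_linear_diff[OF fp_linear_Tr])
  also have "Tr (u ^ p) = Tr u ^ p" using Tr_pow[of u 1] by simp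
  finally show ?thesis using telescope[of u n] by (simp add: trace_Fq_def q)
qed

text \<open>The trace is a polynomial of degree \<open>p ^ (n - 1)\<close>, too small to vanish on
  all \<open>p ^ n\<close> elements.\<close>

lemma Tr_nonzero: "\<exists>u\<in>k. Tr u \<noteq> 0"
proof (rule ccontr)
  assume *: "\<not> (\<exists>u\<in>k. Tr u \<noteq> 0)"
  have eq: "Tr u = R_fun p (n - 1) (\<lambda>_. 1) u" for u
    using n by (simp add: trace_Fq_def R_fun_def flip: lessThan_Suc_atMost)
  have "k \<subseteq> {u. R_fun p (n - 1) (\<lambda>_. 1) u = 0}" using * eq by fastforce
  from card_mono[OF R_fun_roots(1)[of 0] this] R_fun_roots(2)[of 0 "n - 1" "\<lambda>_. 1"]
  have "p ^ n \<le> p ^ (n - 1)" by (simp add: card_k flip: q)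
  then show False using p_gt_1 n by simp
qed

lemma card_Tr_zero: "p * card {u \<in> k. Tr u = 0} = q"
proof -
  obtain u where "u \<in> k" "Tr u \<noteq> 0" using Tr_nonzero by blast
  from subspace_card_fibre[OF subspace_k finite_k fp_linear_Tr _ this subring_set_zero[OF Fp_ring]]
  show ?thesis using Tr_Fp card_k by (simp add: image_subset_iff)
qed

lemma card_artin_schreier:
  assumes z: "z \<in> k"
  shows "card {y \<in> k. y ^ p - y = z} = (if Tr z = 0 then p else 0)"
proof -
  obtain y where y: "y ^ p - y = z" using artin_schreier_root[OF p_gt_1] by blast
  have mem: "v \<in> k \<longleftrightarrow> Tr z = 0" if "v ^ p - v = z" for v
    using Tr_artin_schreier[of v] that by (auto simp: Fq_def)
  show ?thesis
  proof (cases "Tr z = 0")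
    case True
    have "{v \<in> k. v ^ p - v = z} = (\<lambda>c. y + c) ` Fp"
    proof (rule equalityI; rule subsetI)
      fix v assume "v \<in> {v \<in> k. v ^ p - v = z}"
      then have "v - y \<in> Fp" using y pow_diff[of v y 1] by (auto simp: Fq_def algebra_simps)
      then show "v \<in> (\<lambda>c. y + c) ` Fp" by force
    next
      fix v assume "v \<in> (\<lambda>c. y + c) ` Fp"
      then have "v ^ p - v = z" using y by (auto simp: Fq_def pow_add[of _ _ 1, simplified])
      then show "v \<in> {v \<in> k. v ^ p - v = z}" using mem True by simp
    qed
    then show ?thesis using True by (simp add: card_image inj_on_def card_Fp)
  next
    case False
    then have "{v \<in> k. v ^ p - v = z} = {}" using mem by blast
    then show ?thesis using False by (simp only: card.empty if_False)
  qed
qed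

definition B :: "'a \<Rightarrow> 'a \<Rightarrow> 'a \<Rightarrow> 'a" where "B c u v = Tr (c * (u * v))"

lemma fp_linear_B1: "fp_linear (\<lambda>v. B c v u)" and fp_linear_B2: "fp_linear (B c v)"
  unfolding B_def[abs_def] by (intro fp_linear_comp[OF fp_linear_Tr] fp_linear_intros)+

lemma B_Fp:
  "c \<in> k \<Longrightarrow> u \<in> k \<Longrightarrow> v \<in> k \<Longrightarrow> B c u v \<in> Fp"
  unfolding B_def by (intro Tr_Fp subring_set_mult[OF k_ring])

lemma B_commute: "B c u v = B c v u"
  by (simp add: B_def mult.commute)

text \<open>The two inequalities come from chains from 0 to \<open>U\<close> and from
  \<open>U\<close> to \<open>k\<close>; the complement of \<open>k\<close> is 0 because the trace is
  not identically zero.\<close>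

lemma card_perp:
  assumes c: "c \<in> k" "c \<noteq> 0" and U: "fp_subspace U" "U \<subseteq> k"
  shows "card U * card (perp (B c) k U) = q"
proof -
  have finU: "finite U" using U(2) finite_k finite_subset by blast
  have "perp (B c) k {0} = k" by (auto simp: perp_def fp_linear_0[OF fp_linear_B2])
  then have "q \<le> card U * card (perp (B c) k U)"
    using card_perp_mono[of k "{0}" U "B c", OF subspace_k finite_k subspace_trivial U(1) _ finU
        fp_linear_B1 fp_linear_B2 B_Fp] c U subspace_zero[OF U(1)] by (auto simp: card_k)
  moreover have "perp (B c) k k = {0}"
  proof -
    obtain z where z: "z \<in> k" "Tr z \<noteq> 0" using Tr_nonzero by blast
    have "v = 0" if v: "v \<in> perp (B c) k k" for v
    proof (rule ccontr)
      assume v0: "v \<noteq> 0"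
      have "z / (c * v) \<in> k"
        using v z c by (intro k_divide subring_set_mult[OF k_ring]) (auto simp: perp_def)
      then have "B c v (z / (c * v)) = 0" using v by (auto simp: perp_def)
      moreover have "c * (v * (z / (c * v))) = z" using v0 c by (simp add: field_simps)
      ultimately show False using z(2) by (simp add: B_def)
    qed
    moreover have "0 \<in> perp (B c) k k"
      using subring_set_zero[OF k_ring] by (simp add: perp_def fp_linear_0[OF fp_linear_B1])
    ultimately show ?thesis by blast
  qed
  then have "card U * card (perp (B c) k U) \<le> q"
    using card_perp_mono[of k U k "B c", OF subspace_k finite_k U(1) subspace_k U(2) finite_k
        fp_linear_B1 fp_linear_B2 B_Fp] c by (auto simp: card_k)
  ultimately show ?thesis by simp
qed

lemma subspace_perp_B: "fp_subspace (perp (B c) k U)" and perp_B_k: "perp (B c) k U \<subseteq> k"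
  by (rule subspace_perp[OF subspace_k fp_linear_B1]) (auto simp: perp_def)

lemma double_perp:
  assumes c: "c \<in> k" "c \<noteq> 0" and U: "fp_subspace U" "U \<subseteq> k"
  shows "perp (B c) k (perp (B c) k U) = U"
proof (rule sym, rule card_subset_eq)
  let ?P = "perp (B c) k U"
  show "finite (perp (B c) k ?P)" using finite_subset[OF perp_B_k finite_k] .
  show "U \<subseteq> perp (B c) k ?P" using U(2) B_commute by (auto simp: perp_def)
  have "card ?P * card U = card ?P * card (perp (B c) k ?P)"
    using card_perp[OF c U] card_perp[OF c subspace_perp_B[of c U] perp_B_k] by (simp add: mult.commute)
  moreover have "card ?P \<noteq> 0" using card_perp[OF c U] q_gt_1 by (intro notI) simp
  ultimately show "card U = card (perp (B c) k ?P)" by simp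
qed

definition zeros :: "'a \<Rightarrow> 'a set \<Rightarrow> nat" where
  "zeros c U = card {x \<in> U. Tr (c * x\<^sup>2) = 0}"

text \<open>The form is constant on the cosets of a totally isotropic subspace \<open>I\<close> that lie in its
  orthogonal complement, and a nonconstant affine function on all other cosets.\<close>

lemma zeros_isotropic:
  assumes c: "c \<in> k" and I: "fp_subspace I" "I \<subseteq> k" and iso: "\<And>w. w \<in> I \<Longrightarrow> Tr (c * w\<^sup>2) = 0"
  shows "p * zeros c k + card (perp (B c) k I) = p * zeros c (perp (B c) k I) + q"
proof -
  let ?U = "perp (B c) k I"
  have finI: "finite I" using I finite_k finite_subset by blast
  have finU: "finite ?U" using finite_subset[OF perp_B_k finite_k] .
  have I0: "card I \<noteq> 0" using subspace_zero[OF I(1)] finI by auto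
  have cardS: "card {x \<in> S. P x} = (\<Sum>x\<in>S. of_bool (P x))" if "finite S" for S :: "'a set" and P
    using that by (simp add: sum.If_cases Int_def)
  have Q_add: "Tr (c * (x + w)\<^sup>2) = Tr (c * x\<^sup>2) + 2 * B c x w" if "w \<in> I" for x w
  proof -
    have "c * (x + w)\<^sup>2 = c * x\<^sup>2 + (c * (x * w) + c * (x * w)) + c * w\<^sup>2"
      by (simp add: power2_eq_square algebra_simps)
    then show ?thesis using iso[OF that] by (simp only: Tr_add B_def) simp
  qed
  have cnt: "p * card {w \<in> I. Tr (c * (x + w)\<^sup>2) = 0} =
      (if x \<in> ?U then p * card I * of_bool (Tr (c * x\<^sup>2) = 0) else card I)" if x: "x \<in> k" for x
  proof (cases "x \<in> ?U")
    case True
    then have "{w \<in> I. Tr (c * (x + w)\<^sup>2) = 0} = (if Tr (c * x\<^sup>2) = 0 then I else {})"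
      using Q_add by (auto simp: perp_def)
    then show ?thesis using True by simp
  next
    case False
    then obtain w where w: "w \<in> I" "B c x w \<noteq> 0" using x by (auto simp: perp_def)
    \<comment> \<open>By \<open>Q_add\<close> the form at \<open>x + w\<close> vanishes exactly when
      \<open>B c x w\<close> equals this value.\<close>
    define z where "z = - (Tr (c * x\<^sup>2)) / 2"
    have "(2 :: 'a) \<in> Fp"
      using subring_set_add[OF Fp_ring subring_set_one[OF Fp_ring] subring_set_one[OF Fp_ring]] by simp
    moreover have "Tr (c * x\<^sup>2) \<in> Fp" using x c by (intro Tr_Fp subring_set_intros[OF k_ring])
    ultimately have z: "z \<in> Fp"
      using subfield_Fp Fp_ring unfolding z_def divide_inverse
      by (intro subring_set_mult[OF Fp_ring] subring_set_uminus[OF Fp_ring]) (auto simp: subfield_set_def)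
    have "card I = p * card {w \<in> I. B c x w = z}"
      by (rule subspace_card_fibre[OF I(1) finI fp_linear_B2 _ w z]) (use I x c B_Fp in auto)
    moreover have "{w \<in> I. Tr (c * (x + w)\<^sup>2) = 0} = {w \<in> I. B c x w = z}"
      using Q_add two_nonzero by (auto simp: z_def field_simps add_eq_0_iff2 add_eq_0_iff)
    ultimately show ?thesis using False by simp
  qed
  \<comment> \<open>Pairs \<open>(x, w)\<close> at which the form vanishes on \<open>x + w\<close>
    are counted in two ways; translation by \<open>w\<close> permutes \<open>k\<close>.\<close>
  have "card I * zeros c k = (\<Sum>w\<in>I. card {x \<in> k. Tr (c * (x + w)\<^sup>2) = 0})"
  proof -
    have "card {x \<in> k. Tr (c * (x + w)\<^sup>2) = 0} = zeros c k" if w: "w \<in> I" for w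
      unfolding zeros_def
      by (rule bij_betw_same_card[of "\<lambda>x. x + w"], rule bij_betw_byWitness[where f' = "\<lambda>x. x - w"])
        (use w I in \<open>auto intro: subring_set_intros[OF k_ring]\<close>)
    then show ?thesis by simp
  qed
  also have "\<dots> = (\<Sum>x\<in>k. card {w \<in> I. Tr (c * (x + w)\<^sup>2) = 0})"
    unfolding cardS[OF finI] cardS[OF finite_k] by (rule sum.swap)
  finally have "p * (card I * zeros c k) = (\<Sum>x\<in>k. p * card {w \<in> I. Tr (c * (x + w)\<^sup>2) = 0})"
    by (simp add: sum_distrib_left)
  also have "\<dots> = (\<Sum>x\<in>k. if x \<in> ?U then p * card I * of_bool (Tr (c * x\<^sup>2) = 0) else card I)"
    by (intro sum.cong refl cnt)
  also have "\<dots> = (\<Sum>x\<in>?U. p * card I * of_bool (Tr (c * x\<^sup>2) = 0)) + (\<Sum>x\<in>k - ?U. card I)"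
    using perp_B_k[of c I] by (subst sum.If_cases[OF finite_k]) (auto simp: Int_absorb1 Diff_eq)
  also have "(\<Sum>x\<in>?U. p * card I * of_bool (Tr (c * x\<^sup>2) = 0)) = p * card I * zeros c ?U"
    unfolding zeros_def cardS[OF finU] sum_distrib_left ..
  also have "(\<Sum>x\<in>k - ?U. card I) = (q - card ?U) * card I"
    using card_Diff_subset[OF finU perp_B_k] by (simp add: card_k)
  finally have "card I * (p * zeros c k) = card I * (p * zeros c ?U + (q - card ?U))"
    by (simp add: algebra_simps)
  then have "p * zeros c k = p * zeros c ?U + (q - card ?U)" using I0 by simp
  moreover have "card ?U \<le> q" using card_mono[OF finite_k perp_B_k] card_k by simp
  ultimately show ?thesis by simp
qed

section \<open>Quadratic symbol and zeros of the form on \<open>k\<close>\<close>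

abbreviation \<eta> :: "'a \<Rightarrow> 'a" where "\<eta> u \<equiv> quad_symbol u q"

lemma q_minus_1: "q - 1 = 2 * ((q - 1) div 2)"
  using odd_q by simp

lemma \<eta>_square: "\<eta> u ^ 2 = u ^ (q - 1)"
  using q_minus_1 by (metis quad_symbol_def power_mult mult.commute)

lemma \<eta>_mult: "\<eta> (u * v) = \<eta> u * \<eta> v"
  by (simp add: quad_symbol_def power_mult_distrib)

lemma mem_k_iff: "u \<noteq> 0 \<Longrightarrow> u \<in> k \<longleftrightarrow> u ^ (q - 1) = 1"
  using q_gt_1 power_Suc[of u "q - 1"] by (auto simp: Fq_def)

lemma \<eta>_cases:
  "u \<in> k \<Longrightarrow> u \<noteq> 0 \<Longrightarrow> \<eta> u = 1 \<or> \<eta> u = - 1"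
  using \<eta>_square[of u] mem_k_iff[of u] by (simp add: power2_eq_1_iff)

lemma one_neq_minus_one: "(1 :: 'a) \<noteq> - 1"
  using two_nonzero by (simp add: eq_neg_iff_add_eq_0)

lemma card_square_roots:
  assumes u: "u \<in> k" "u \<noteq> 0"
  shows "card {x \<in> k. x\<^sup>2 = u} = (if \<eta> u = 1 then 2 else 0)"
proof -
  obtain z where z: "z\<^sup>2 = u" using nth_root_exists[of 2 u] by auto
  have z0: "z \<noteq> 0" using z u by auto
  have "\<eta> u = z ^ (q - 1)" unfolding z[symmetric] quad_symbol_def power_mult[symmetric] q_minus_1[symmetric] ..
  then have "z \<in> k \<longleftrightarrow> \<eta> u = 1" using mem_k_iff[OF z0] by simp
  moreover have "x\<^sup>2 = u \<longleftrightarrow> x = z \<or> x = - z" for x unfolding z[symmetric] by (rule power2_eq_iff)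
  moreover have "- z \<in> k \<longleftrightarrow> z \<in> k"
    using subring_set_uminus[OF k_ring, of z] subring_set_uminus[OF k_ring, of "- z"] by auto
  ultimately have "{x \<in> k. x\<^sup>2 = u} = (if \<eta> u = 1 then {z, - z} else {})" by auto
  moreover have "z \<noteq> - z" using two_nonzero z0 by (simp add: eq_neg_iff_add_eq_0 flip: mult_2)
  ultimately show ?thesis by simp
qed

text \<open>Nonzero zeros are grouped by the value \<open>z = c * x\<^sup>2\<close> of trace 0,
  attained twice if \<open>z / c\<close> is a square in \<open>k\<close> and never otherwise. Only
  the symbol of \<open>c\<close> survives on the right.\<close>

lemma zeros_eq:
  assumes c: "c \<in> k" "c \<noteq> 0"
  shows "zeros c k = Suc (\<Sum>z\<in>{z \<in> k - {0}. Tr z = 0}. if \<eta> z = \<eta> c then 2 else 0)"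
proof -
  let ?Z = "{z \<in> k - {0}. Tr z = 0}" and ?S = "{x \<in> k - {0}. Tr (c * x\<^sup>2) = 0}"
  have fin: "finite ?S" using finite_k by simp
  have "{x \<in> k. Tr (c * x\<^sup>2) = 0} = insert 0 ?S"
    using subring_set_zero[OF k_ring] Tr_0 by auto
  then have "zeros c k = Suc (card ?S)" unfolding zeros_def using fin by simp
  also have "card ?S = (\<Sum>z\<in>?Z. card {x \<in> ?S. c * x\<^sup>2 = z})"
  proof -
    have "(\<lambda>x. c * x\<^sup>2) ` ?S \<subseteq> ?Z" using c by (auto intro!: subring_set_intros[OF k_ring])
    moreover have "finite ?Z" using finite_k by simp
    ultimately show ?thesis using sum.group[OF fin, of ?Z "\<lambda>x. c * x\<^sup>2" "\<lambda>_. 1::nat"] by simp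
  qed
  also have "\<dots> = (\<Sum>z\<in>?Z. if \<eta> z = \<eta> c then 2 else 0)"
  proof (intro sum.cong refl)
    fix z assume z: "z \<in> ?Z"
    have zc: "z / c \<in> k" "z / c \<noteq> 0" using z c by (auto intro: k_divide)
    have "{x \<in> ?S. c * x\<^sup>2 = z} = {x \<in> k. x\<^sup>2 = z / c}"
      using z c by (auto simp: field_simps)
    moreover have "\<eta> z = \<eta> (z / c) * \<eta> c" using \<eta>_mult[of "z / c" c] c by simp
    then have "\<eta> z = \<eta> c \<longleftrightarrow> \<eta> (z / c) = 1" using \<eta>_cases[OF c] by auto
    ultimately show "card {x \<in> ?S. c * x\<^sup>2 = z} = (if \<eta> z = \<eta> c then 2 else 0)"
      using card_square_roots[OF zc] by simp
  qed
  finally show ?thesis .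
qed

lemma zeros_cong:
  assumes "c \<in> k" "c \<noteq> 0" "c' \<in> k" "c' \<noteq> 0" "\<eta> c = \<eta> c'"
  shows "zeros c k = zeros c' k"
  using assms by (simp add: zeros_eq)

text \<open>Each nonzero element of trace 0 lies in exactly one of the two square classes and is
  counted twice there; the zero of \<open>k\<close> counts once for each form.\<close>

lemma zeros_add:
  assumes c: "c \<in> k" "c \<noteq> 0" "c' \<in> k" "c' \<noteq> 0" and opp: "\<eta> c' = - \<eta> c"
  shows "p * (zeros c k + zeros c' k) = 2 * q"
proof -
  let ?Z = "{z \<in> k - {0}. Tr z = 0}"
  have "zeros c k + zeros c' k = 2 + (\<Sum>z\<in>?Z. (if \<eta> z = \<eta> c then 2 else 0) + (if \<eta> z = \<eta> c' then 2 else 0))"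
    unfolding zeros_eq[OF c(1,2)] zeros_eq[OF c(3,4)] sum.distrib by simp
  also have "\<dots> = 2 + (\<Sum>z\<in>?Z. 2)"
  proof (intro arg_cong2[where f = "(+)"] sum.cong refl)
    fix z assume "z \<in> ?Z"
    then have "\<eta> z = 1 \<or> \<eta> z = - 1" by (intro \<eta>_cases) auto
    then show "(if \<eta> z = \<eta> c then 2 else 0) + (if \<eta> z = \<eta> c' then 2 else 0) = (2 :: nat)"
      using \<eta>_cases[OF c(1,2)] one_neq_minus_one one_neq_minus_one[symmetric] by (auto simp: opp)
  qed
  also have "\<dots> = 2 * Suc (card ?Z)" by simp
  also have "Suc (card ?Z) = card (insert 0 ?Z)" using finite_k by simp
  also have "insert 0 ?Z = {u \<in> k. Tr u = 0}"
    using subring_set_zero[OF k_ring] Tr_0 by auto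
  finally show ?thesis using card_Tr_zero by simp
qed

text \<open>A nonsquare \<open>t\<close> of \<open>Fp\<close> remains a nonsquare in an extension of
  odd degree, so \<open>zeros_add\<close> applies to \<open>c\<close> and \<open>t * c\<close>. As
  the trace is \<open>Fp\<close>-linear, both forms have the same zeros.\<close>

lemma zeros_odd_degree:
  assumes c: "c \<in> k" "c \<noteq> 0" and "odd n"
  shows "p * zeros c k = q"
proof -
  define l where "l = (p - 1) div 2"
  have l: "p - 1 = l * 2" using odd_p by (simp add: l_def)
  then have "l > 0" using p_gt_1 by (cases l) auto
  then obtain t :: 'a where t: "t ^ l = - 1" using nth_root_exists[of l "- 1"] by auto
  have t0: "t \<noteq> 0" using t \<open>l > 0\<close> by (auto simp: power_0_left)
  have "t ^ (p - 1) = 1" unfolding l power_mult t by simp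
  then have tFp: "t \<in> Fp" using p_gt_1 power_Suc[of t "p - 1"] by (simp add: Fq_def)
  \<comment> \<open>This is \<open>(q - 1) div (p - 1)\<close>, a sum of \<open>n\<close> odd terms
    and hence odd.\<close>
  define S where "S = (\<Sum>i<n. p ^ i)"
  have "odd S \<longleftrightarrow> odd N" if "S = (\<Sum>i<N. p ^ i)" for S N
    using that by (induction N arbitrary: S) (auto simp: odd_p)
  then have "odd S" using assms(3) by (simp add: S_def)
  have "int q - 1 = (int p - 1) * int S"
    unfolding S_def q using power_diff_1_eq[of "int p" n] by (simp add: sum_distrib_left)
  then have "int (q - 1) = int ((p - 1) * S)" using p_gt_1 q_gt_1 by (simp add: of_nat_diff)
  then have "q - 1 = 2 * (l * S)" using l by (simp only: of_nat_eq_iff mult_ac)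
  then have "\<eta> t = - 1" using \<open>odd S\<close> by (simp add: quad_symbol_def power_mult t)
  then have "p * (zeros c k + zeros (t * c) k) = 2 * q"
    using c t0 tFp Fp_k by (intro zeros_add) (auto simp: \<eta>_mult intro: subring_set_mult[OF k_ring])
  moreover have "zeros (t * c) k = zeros c k"
    unfolding zeros_def using tFp t0 by (simp add: mult.assoc Tr_scale)
  ultimately show ?thesis by (simp add: distrib_left)
qed

text \<open>Over a quadratic extension \<open>k\<close> of \<open>Fq s\<close>, choosing \<open>\<omega>\<close> with \<open>\<omega> ^ s = - \<omega>\<close> makes
  \<open>Fq s\<close> its own orthogonal complement for the form with coefficient \<open>\<omega>\<close>.\<close>

lemma exists_hyperbolic_coefficient:
  assumes n_eq: "n = 2 * h" and s: "s = p ^ h"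
  shows "\<exists>\<omega>\<in>k. \<omega> \<noteq> 0 \<and> \<eta> \<omega> = (- 1) ^ ((s + 1) div 2) \<and> p * zeros \<omega> k + s = p * s + q"
proof -
  have h: "0 < h" using n n_eq by simp
  have qs: "q = s * s" by (simp add: q n_eq s mult_2 power_add)
  have s1: "1 < s" unfolding s by (rule one_less_power[OF p_gt_1 h])
  have odd_s: "odd s" using odd_p by (simp add: s)
  obtain \<omega> :: 'a where \<omega>: "\<omega> ^ (s - 1) = - 1" using nth_root_exists[of "s - 1" "- 1"] s1 by auto
  have \<omega>0: "\<omega> \<noteq> 0" using \<omega> s1 by (auto simp: power_0_left)
  have \<omega>s: "\<omega> ^ s = - \<omega>" using power_Suc[of \<omega> "s - 1"] \<omega> s1 by simp
  have \<omega>k: "\<omega> \<in> k" using odd_s by (simp add: Fq_def qs power_mult \<omega>s)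
  define g where "g = (s + 1) div 2"
  obtain j where j: "s = 2 * j + 1" using odd_s by (elim oddE)
  \<comment> \<open>So half of \<open>q - 1\<close> is \<open>(s - 1) * g\<close>, and
    \<open>\<omega> ^ (s - 1)\<close> is -1.\<close>
  have "q - 1 = 2 * ((s - 1) * g)" by (simp add: qs g_def j algebra_simps)
  then have \<eta>\<omega>: "\<eta> \<omega> = (- 1) ^ g" by (simp add: quad_symbol_def power_mult \<omega> del: One_nat_def)
  define I :: "'a set" where "I = Fq s"
  have I: "fp_subspace I"
    by (auto simp: fp_subspace_def I_def Fq_def s pow_add power_mult_distrib)
      (use Fp_pow p_gt_1 in \<open>auto simp: Fq_def power_0_left\<close>)
  have Ik: "I \<subseteq> k" by (auto simp: I_def Fq_def qs power_mult)
  have cI: "card I = s"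
    using card_Fq[OF char, of s "m * h"] m h unfolding I_def by (simp add: s p_pow)
  have iso: "Tr (\<omega> * (u * v)) = 0" if uv: "u \<in> I" "v \<in> I" for u v
  proof -
    \<comment> \<open>The \<open>s\<close>-th power leaves the trace unchanged but negates the
      element, so the trace is its own negative.\<close>
    have "Tr (\<omega> * (u * v)) = Tr ((\<omega> * (u * v)) ^ s)"
      unfolding s using Ik \<omega>k uv by (intro Tr_frobenius[symmetric] subring_set_mult[OF k_ring]) auto
    also have "(\<omega> * (u * v)) ^ s = - (\<omega> * (u * v))"
      using uv by (simp add: power_mult_distrib \<omega>s I_def Fq_def)
    finally have "2 * Tr (\<omega> * (u * v)) = 0" by (simp add: Tr_uminus eq_neg_iff_add_eq_0)
    then show ?thesis using two_nonzero by simp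
  qed
  have "perp (B \<omega>) k I = I"
  proof (rule sym, rule card_subset_eq)
    show "finite (perp (B \<omega>) k I)" using finite_subset[OF perp_B_k finite_k] .
    show "I \<subseteq> perp (B \<omega>) k I" using Ik iso by (auto simp: perp_def B_def)
    show "card I = card (perp (B \<omega>) k I)" using card_perp[OF \<omega>k \<omega>0 I Ik] s1 by (simp add: cI qs)
  qed
  moreover have iso2: "Tr (\<omega> * w\<^sup>2) = 0" if "w \<in> I" for w
    using iso[OF that that] by (simp add: power2_eq_square)
  moreover have "zeros \<omega> I = s"
  proof -
    have "{x \<in> I. Tr (\<omega> * x\<^sup>2) = 0} = I" using iso2 by auto
    then show ?thesis by (simp add: zeros_def cI)
  qed
  ultimately have "p * zeros \<omega> k + s = p * s + q"
    using zeros_isotropic[OF \<omega>k I Ik iso2] by (simp add: cI)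
  then show ?thesis using \<omega>k \<omega>0 \<eta>\<omega> g_def by blast
qed

lemma zeros_even_degree:
  assumes "n = 2 * h" "s = p ^ h" and c: "c \<in> k" "c \<noteq> 0"
  shows "\<eta> c = (- 1) ^ ((s + 1) div 2) \<Longrightarrow> p * zeros c k + s = p * s + q"
    and "\<eta> c = - ((- 1) ^ ((s + 1) div 2)) \<Longrightarrow> p * zeros c k + p * s = q + s"
proof -
  obtain \<omega> where \<omega>: "\<omega> \<in> k" "\<omega> \<noteq> 0" "\<eta> \<omega> = (- 1) ^ ((s + 1) div 2)" "p * zeros \<omega> k + s = p * s + q"
    using exists_hyperbolic_coefficient[OF assms(1,2)] by blast
  show "p * zeros c k + s = p * s + q" if "\<eta> c = (- 1) ^ ((s + 1) div 2)"
    using zeros_cong[OF c \<omega>(1,2)] \<omega> that by simp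
  show "p * zeros c k + p * s = q + s" if "\<eta> c = - ((- 1) ^ ((s + 1) div 2))"
    using zeros_add[OF c \<omega>(1,2)] \<omega>(3,4) that by (simp add: distrib_left)
qed

end

section \<open>Counting points\<close>

lemma linearized_coeff_0: "0 < p \<Longrightarrow> linearized p h \<Longrightarrow> coeff h 0 = 0"
  by (fastforce simp: linearized_def)

locale rational_lagrangian = lagrangian p m FF e a W + finite_trace p m FF n q
  for p m and FF :: "'a::alg_closed_field itself" and e a W n q +
  assumes W_k: "W \<subseteq> k" and a_k: "i \<le> e \<Longrightarrow> a i \<in> k"
begin

definition F :: "'a \<Rightarrow> 'a" where "F u = (\<Prod>w\<in>W. u - w)"

abbreviation F_pol :: "'a poly" where "F_pol \<equiv> (\<Prod>w\<in>W. [:- w, 1:])"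

abbreviation U :: "'a set" where "U \<equiv> F ` k"

definition c :: 'a where "c = (- 1) ^ e * a e / (2 * coeff F_pol 1)"

lemma poly_F_pol: "poly F_pol u = F u"
  by (simp add: F_def poly_prod)

lemma F_eq_0_iff: "F u = 0 \<longleftrightarrow> u \<in> W"
  using finite_W by (auto simp: F_def)

lemma F_k: "u \<in> k \<Longrightarrow> F u \<in> k"
  unfolding F_def using W_k by (intro subring_set_prod subring_set_diff k_ring) auto

lemma factorisation:
  "\<exists>b \<kappa>. card W = p ^ e \<and> F_pol = lin_poly e b \<and> (\<forall>i\<le>e. b i \<in> k) \<and> b e = 1 \<and> b 0 \<noteq> 0 \<and>
     (\<exists>t\<in>k. b 0 = (- 1) ^ e * t\<^sup>2) \<and> a e = \<kappa> * b 0 \<and> F = R_fun p e b \<and>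
     (\<forall>u. E u = (\<Sum>i\<le>e. (\<kappa> * b i * F u) ^ (p ^ (e - i))))"
proof -
  obtain d b t where *: "card W = p ^ d" "b d = 1" "t \<in> k" "b 0 = (- 1) ^ d * t\<^sup>2"
    "\<And>u. (\<Prod>v\<in>W. u - v) = R_fun p d b u"
    using subspace_polynomial[OF subspace_W finite_W odd_p k_ring W_k] by blast
  have d: "d = e" by (rule E_factorisation(1)[OF *(1,2,5)])
  obtain \<kappa> where \<kappa>: "a e = \<kappa> * b 0" "\<And>u. E u = (\<Sum>i\<le>e. (\<kappa> * b i * R_fun p e b u) ^ (p ^ (e - i)))"
    using E_factorisation(2)[OF *(1,2,5)] by blast
  have F: "F = R_fun p e b" using *(5) by (simp add: F_def fun_eq_iff d)
  have pol: "F_pol = lin_poly e b"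
    by (rule poly_eqI_alg_closed) (simp add: poly_F_pol poly_lin_poly F)
  have "F_pol \<in> poly_over k"
    using W_k by (intro subring_set_prod subring_set_poly_over k_ring)
      (auto simp: pCons_in_poly_over intro!: subring_set_intros[OF k_ring] zero_in_poly_over k_ring)
  then have "b i \<in> k" if "i \<le> e" for i using coeff_lin_poly[OF that, of b] poly_over_coeff pol by metis
  then show ?thesis using * d \<kappa> F pol a_e
    by (intro exI[of _ b] exI[of _ \<kappa>]) auto
qed

lemma coeff_F_pol:
  obtains t where "t \<in> k" "t \<noteq> 0" "coeff F_pol 1 = (- 1) ^ e * t\<^sup>2"
proof -
  from factorisation obtain b where b: "F_pol = lin_poly e b" "b 0 \<noteq> 0" "\<exists>t\<in>k. b 0 = (- 1) ^ e * t\<^sup>2"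
    by blast
  have "coeff F_pol 1 = b 0" using coeff_lin_poly[of 0 e b] b(1) by simp
  then show thesis using b that by force
qed

lemma c_k: "c \<in> k" and c_nonzero: "c \<noteq> 0" and c_eq: "\<exists>t\<in>k. t \<noteq> 0 \<and> c = a e / (2 * t\<^sup>2)"
proof -
  obtain t where t: "t \<in> k" "t \<noteq> 0" "coeff F_pol 1 = (- 1) ^ e * t\<^sup>2" by (rule coeff_F_pol)
  have eq: "c = a e / (2 * t\<^sup>2)" unfolding c_def t(3) by (simp add: field_simps)
  have "2 * t\<^sup>2 \<in> k" using t(1) subring_set_add[OF k_ring] by (simp only: mult_2 subring_set_power[OF k_ring])
  then show "c \<in> k" unfolding eq using a_k[of e] by (intro k_divide) auto
  show "c \<noteq> 0" unfolding eq using a_e t(2) two_nonzero by simp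
  show "\<exists>t\<in>k. t \<noteq> 0 \<and> c = a e / (2 * t\<^sup>2)" using t eq by blast
qed

lemma fp_linear_F: "fp_linear F"
  using factorisation fp_linear_R_fun by metis

lemma F_surj: "\<exists>v. F v = u"
proof -
  from factorisation obtain b where "b e = 1" "F = R_fun p e b" by blast
  then show ?thesis using R_fun_surj[of b e u] by simp
qed

lemma F_pow_q: "F (u ^ q) = F u ^ q"
proof -
  from factorisation obtain b where b: "\<And>i. i \<le> e \<Longrightarrow> b i \<in> k" "F = R_fun p e b" by blast
  have "F u ^ q = (\<Sum>i\<le>e. (b i * u ^ (p ^ i)) ^ (p ^ n))" unfolding b(2) q R_fun_def pow_sum ..
  also have "\<dots> = (\<Sum>i\<le>e. b i * (u ^ q) ^ (p ^ i))"
  proof (intro sum.cong refl)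
    fix i assume "i \<in> {..e}"
    then have "b i ^ (p ^ n) = b i" using b(1)[of i] by (simp add: Fq_def q)
    then show "(b i * u ^ (p ^ i)) ^ (p ^ n) = b i * (u ^ q) ^ (p ^ i)"
      unfolding q power_mult_distrib pow_pow by (simp add: add.commute)
  qed
  finally show ?thesis by (simp add: b(2) R_fun_def)
qed

lemma card_W: "card W = p ^ e"
  using factorisation by blast

lemma card_U: "p ^ e * card U = q"
proof -
  have "{u \<in> k. F u = 0} = W" using F_eq_0_iff W_k by auto
  then show ?thesis
    using subspace_card_kernel[OF subspace_k finite_k fp_linear_F] by (simp add: card_k card_W mult.commute)
qed

lemma subspace_U: "fp_subspace U" and U_k: "U \<subseteq> k"
  using subspace_image[OF fp_linear_F subspace_k] F_k by auto

lemma Tr_sum: "Tr (sum g J) = (\<Sum>j\<in>J. Tr (g j))"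
  unfolding trace_Fq_def pow_sum by (rule sum.swap)

text \<open>The adjoint of \<open>R_fun p e g\<close> for the trace pairing, up to a
  \<open>p ^ e\<close> twist: the \<open>i\<close>-th summand is a \<open>p ^ (e - i)\<close>-th
  power, and the trace is invariant under Frobenius.\<close>

lemma Tr_adjoint:
  assumes g: "\<And>i. i \<le> e \<Longrightarrow> g i \<in> k" and u: "u \<in> k" and v: "v \<in> k"
  shows "Tr (u ^ (p ^ e) * (\<Sum>i\<le>e. (g i * v) ^ (p ^ (e - i)))) = Tr (v * R_fun p e g u)"
proof -
  have "u ^ (p ^ e) * (\<Sum>i\<le>e. (g i * v) ^ (p ^ (e - i))) = (\<Sum>i\<le>e. (v * (g i * u ^ (p ^ i))) ^ (p ^ (e - i)))"
    unfolding sum_distrib_left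
  proof (intro sum.cong refl)
    fix i assume "i \<in> {..e}"
    then have "u ^ (p ^ e) = (u ^ (p ^ i)) ^ (p ^ (e - i))" unfolding pow_pow by simp
    then show "u ^ (p ^ e) * (g i * v) ^ (p ^ (e - i)) = (v * (g i * u ^ (p ^ i))) ^ (p ^ (e - i))"
      by (simp only: power_mult_distrib mult_ac)
  qed
  also have "Tr \<dots> = (\<Sum>i\<le>e. Tr (v * (g i * u ^ (p ^ i))))"
    unfolding Tr_sum using g u v
    by (intro sum.cong refl Tr_frobenius subring_set_mult[OF k_ring] subring_set_power[OF k_ring]) auto
  also have "\<dots> = Tr (v * R_fun p e g u)" unfolding R_fun_def sum_distrib_left Tr_sum ..
  finally show ?thesis .
qed

text \<open>\<open>Tr (u ^ (p ^ e) * E u)\<close> is evaluated twice by \<open>Tr_adjoint\<close>: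
  the definition of \<open>E\<close> gives \<open>2 * Tr (u * R u)\<close>, and the factorisation
  through \<open>F\<close> gives \<open>Tr (\<kappa> * (F u)\<^sup>2)\<close>. Since
  \<open>\<kappa> = a e / b 0\<close>, the latter is
  \<open>2 * (- 1) ^ e * Tr (c * (F u)\<^sup>2)\<close>, and the scalar is a unit of
  \<open>Fp\<close>.\<close>

lemma Tr_x_R_eq_0_iff:
  assumes u: "u \<in> k"
  shows "Tr (u * R u) = 0 \<longleftrightarrow> Tr (c * (F u)\<^sup>2) = 0"
proof -
  from factorisation obtain b \<kappa> where b: "F_pol = lin_poly e b" "\<And>i. i \<le> e \<Longrightarrow> b i \<in> k" "b 0 \<noteq> 0"
    "a e = \<kappa> * b 0" "F = R_fun p e b" "\<And>u. E u = (\<Sum>i\<le>e. (\<kappa> * b i * F u) ^ (p ^ (e - i)))"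
    by blast
  have b0: "coeff F_pol 1 = b 0" using coeff_lin_poly[of 0 e b] b(1) by simp
  have \<kappa>: "\<kappa> = 2 * (- 1) ^ e * c" using b(3,4) two_nonzero unfolding c_def b0 by (simp add: field_simps)
  have "\<kappa> = a e / b 0" using b(3,4) by simp
  then have \<kappa>_k: "\<kappa> \<in> k" using k_divide[OF a_k[of e] b(2)[of 0]] by simp
  have uR: "u * R u \<in> k"
    using u a_k unfolding R_fun_def by (intro subring_set_intros[OF k_ring]) auto
  have "Tr (u ^ (p ^ e) * E u) = Tr ((u * R u) ^ (p ^ e)) + Tr (u ^ (p ^ e) * (\<Sum>i\<le>e. (a i * u) ^ (p ^ (e - i))))"
    unfolding E_fun_def distrib_left Tr_add power_mult_distrib ..
  also have "\<dots> = 2 * Tr (u * R u)"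
    using Tr_adjoint[of a u u, OF a_k u u] by (simp add: Tr_frobenius[OF uR])
  finally have 1: "Tr (u ^ (p ^ e) * E u) = 2 * Tr (u * R u)" .
  have "Tr (u ^ (p ^ e) * E u) = Tr (F u * R_fun p e (\<lambda>i. \<kappa> * b i) u)"
    unfolding b(6) using \<kappa>_k b(2) F_k[OF u] u
    by (intro Tr_adjoint subring_set_mult[OF k_ring]) auto
  also have "R_fun p e (\<lambda>i. \<kappa> * b i) u = \<kappa> * F u"
    unfolding b(5) R_fun_def by (simp add: sum_distrib_left mult.assoc)
  also have "F u * (\<kappa> * F u) = (2 * (- 1) ^ e) * (c * (F u)\<^sup>2)"
    unfolding \<kappa> by (simp add: power2_eq_square mult_ac)
  also have "Tr \<dots> = (2 * (- 1) ^ e) * Tr (c * (F u)\<^sup>2)"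
  proof (rule Tr_scale)
    have "(1 + 1) * (- 1) ^ e \<in> Fp" by (intro subring_set_intros[OF Fp_ring])
    then show "2 * (- 1) ^ e \<in> Fp" by simp
  qed
  finally show ?thesis using 1 two_nonzero by auto
qed

lemma card_affine_points:
  "card {(u, v). u \<in> k \<and> v \<in> k \<and> v ^ p - v = u * R u} = p ^ e * (p * zeros c U)"
proof -
  have uR: "u * R u \<in> k" if "u \<in> k" for u
    using that a_k unfolding R_fun_def by (intro subring_set_intros[OF k_ring]) auto
  have "{(u, v). u \<in> k \<and> v \<in> k \<and> v ^ p - v = u * R u} = (SIGMA u:k. {v \<in> k. v ^ p - v = u * R u})"
    by auto
  then have "card {(u, v). u \<in> k \<and> v \<in> k \<and> v ^ p - v = u * R u} =
      (\<Sum>u\<in>k. card {v \<in> k. v ^ p - v = u * R u})"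
    using finite_k by (simp add: card_SigmaI)
  also have "\<dots> = (\<Sum>u\<in>k. if Tr (c * (F u)\<^sup>2) = 0 then p else 0)"
    by (intro sum.cong refl) (simp only: card_artin_schreier[OF uR] Tr_x_R_eq_0_iff)
  also have "\<dots> = p * card {u \<in> k. Tr (c * (F u)\<^sup>2) = 0}"
    using finite_k by (simp add: sum.If_cases Int_def)
  also have "card {u \<in> k. Tr (c * (F u)\<^sup>2) = 0} =
      (\<Sum>z\<in>{z \<in> U. Tr (c * z\<^sup>2) = 0}. card {u \<in> {u \<in> k. Tr (c * (F u)\<^sup>2) = 0}. F u = z})"
    using sum.group[of "{u \<in> k. Tr (c * (F u)\<^sup>2) = 0}" "{z \<in> U. Tr (c * z\<^sup>2) = 0}" F "\<lambda>_. 1::nat"]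
      finite_k by (auto simp: image_subset_iff)
  also have "\<dots> = (\<Sum>z\<in>{z \<in> U. Tr (c * z\<^sup>2) = 0}. p ^ e)"
  proof (intro sum.cong refl)
    fix z assume z: "z \<in> {z \<in> U. Tr (c * z\<^sup>2) = 0}"
    then obtain u0 where u0: "u0 \<in> k" "z = F u0" by blast
    have "{u \<in> {u \<in> k. Tr (c * (F u)\<^sup>2) = 0}. F u = z} = {u \<in> k. F u = F u0}" using z u0 by auto
    also have "card \<dots> = card {u \<in> k. F u = 0}"
      by (rule card_fibre[OF finite_k _ _ u0(1)])
        (auto intro: subring_set_diff[OF k_ring] fp_linear_diff[OF fp_linear_F])
    also have "{u \<in> k. F u = 0} = W" using F_eq_0_iff W_k by auto
    finally show "card {u \<in> {u \<in> k. Tr (c * (F u)\<^sup>2) = 0}. F u = z} = p ^ e" by (simp add: card_W)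
  qed
  finally show ?thesis by (simp add: zeros_def mult_ac)
qed

text \<open>With \<open>h\<close> the product over \<open>U\<close>, the composite
  \<open>h(F(v))\<close> is \<open>v ^ q - v\<close>, by comparing roots. \<open>F\<close> has
  coefficients in \<open>k\<close>, so it commutes with the \<open>q\<close>-th power; since it is
  onto the closure, composition in the other order gives the same polynomial.\<close>

lemma a_poly_eq:
  assumes A: "fst ` A = W"
  shows "a_poly p q A = (\<Prod>u\<in>U. [:- u, 1:])"
proof -
  have finU: "finite U" using finite_k by simp
  have pos: "0 < p" using p_gt_1 by simp
  define h where "h = (\<Prod>u\<in>U. [:- u, 1:])"
  have FA: "F_poly A = F_pol" by (simp add: F_poly_def A)
  obtain d g where g: "card U = p ^ d" "\<And>u. (\<Prod>v\<in>U. u - v) = R_fun p d g u"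
    using subspace_polynomial[OF subspace_U finU odd_p k_ring U_k] by blast
  have "h = lin_poly d g"
    by (rule poly_eqI_alg_closed) (simp add: h_def poly_prod poly_lin_poly flip: g(2))
  then have lin: "linearized p h"
    using coeff_lin_poly_0[of d _ g] by (auto simp: linearized_def)
  have "h \<in> poly_over k" unfolding h_def
    using U_k by (intro subring_set_prod subring_set_poly_over k_ring)
      (auto simp: pCons_in_poly_over intro!: subring_set_intros[OF k_ring] zero_in_poly_over k_ring)
  then have coeffs: "\<forall>i. coeff h i \<in> k" by (simp add: poly_over_def)
  have monic: "lead_coeff h = 1" "lead_coeff F_pol = 1" by (simp_all add: h_def lead_coeff_prod)
  have deg: "degree h = card U" "degree F_pol = card W"
    by (simp_all add: h_def degree_prod_eq_sum_degree)
  have hF: "poly h (F v) = v ^ q - v" for v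
  proof -
    have "pcompose h F_pol = (\<Prod>x\<in>k. [:- x, 1:])"
    proof (rule monic_eq_prod_roots[OF finite_k])
      show "degree (pcompose h F_pol) = card k"
        unfolding degree_pcompose deg card_W card_k using card_U by (simp add: mult.commute)
      have "degree F_pol > 0" using p_gt_1 by (simp add: deg card_W)
      from lead_coeff_comp[OF this, of h] show "lead_coeff (pcompose h F_pol) = 1" by (simp add: monic)
      show "poly (pcompose h F_pol) x = 0" if "x \<in> k" for x
      proof -
        have "poly h (F x) = (\<Prod>u\<in>U. F x - u)" by (simp add: h_def poly_prod)
        also have "\<dots> = 0" using that finU by auto
        finally show ?thesis by (simp only: poly_pcompose poly_F_pol)
      qed
    qed
    moreover have "monom 1 q + (- [:0, 1:]) = (\<Prod>x\<in>k. [:- x, 1 :: 'a:])"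
    proof (rule monic_eq_prod_roots[OF finite_k])
      have d: "degree (monom 1 q + (- [:0, 1 :: 'a:])) = q"
        using q_gt_1 by (subst degree_add_eq_left) (auto simp: degree_monom_eq)
      then show "degree (monom 1 q + (- [:0, 1 :: 'a:])) = card k" by (simp add: card_k)
      show "lead_coeff (monom 1 q + (- [:0, 1 :: 'a:])) = 1"
        unfolding d using q_gt_1 by (simp add: coeff_pCons split: nat.splits)
    qed (auto simp: Fq_def poly_monom)
    ultimately have "pcompose h F_pol = monom 1 q + (- [:0, 1:])" by simp
    then have "poly (pcompose h F_pol) v = poly (monom 1 q + (- [:0, 1:])) v" by simp
    then show ?thesis by (simp add: poly_pcompose poly_F_pol poly_monom)
  qed
  have comp: "pcompose F_pol h = monom 1 q - [:0, 1:]"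
  proof (rule poly_eqI_alg_closed)
    fix u
    obtain v where v: "F v = u" using F_surj by blast
    have "poly (pcompose F_pol h) u = F (v ^ q - v)" by (simp add: poly_pcompose poly_F_pol hF flip: v)
    also have "\<dots> = u ^ q - u" by (simp add: fp_linear_diff[OF fp_linear_F] F_pow_q v)
    finally show "poly (pcompose F_pol h) u = poly (monom 1 q - [:0, 1:]) u" by (simp add: poly_monom)
  qed
  \<comment> \<open>By additivity of \<open>F\<close> the difference composes to 0, hence is
    constant, and linearized polynomials have no constant term.\<close>
  have uniq: "h' = h" if h': "linearized p h'" "pcompose F_pol h' = monom 1 q - [:0, 1:]" for h'
  proof -
    have "pcompose F_pol (h' - h) = 0"
    proof (rule poly_eqI_alg_closed)
      fix u
      have "F (poly h' u) = F (poly h u)"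
        using arg_cong[OF trans[OF h'(2) comp[symmetric]], of "\<lambda>f. poly f u"]
        by (simp add: poly_pcompose poly_F_pol)
      then show "poly (pcompose F_pol (h' - h)) u = poly 0 u"
        by (simp add: poly_pcompose poly_F_pol fp_linear_diff[OF fp_linear_F])
    qed
    moreover have "F_pol \<noteq> 0" using monic by auto
    ultimately have "degree (h' - h) = 0" using pcompose_eq_0[of F_pol "h' - h"] by auto
    moreover have "coeff (h' - h) 0 = 0"
      using linearized_coeff_0[OF pos h'(1)] linearized_coeff_0[OF pos lin] by simp
    ultimately have "h' - h = 0" using leading_coeff_0_iff[of "h' - h"] by simp
    then show ?thesis by simp
  qed
  show ?thesis unfolding a_poly_def FA h_def[symmetric]
    by (rule the_equality) (use lin coeffs comp uniq in blast)+
qed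

text \<open>The condition is applied to \<open>l = c * w\<close>: its premise says that
  \<open>w\<close> is orthogonal to \<open>U\<close>, and \<open>inverse c * l\<^sup>2\<close> is
  \<open>c * w\<^sup>2\<close>.\<close>

lemma condition_star_isotropic:
  assumes A: "fst ` A = W" and star: "condition_star p n e a A" and w: "w \<in> perp (B c) k U"
  shows "Tr (c * w\<^sup>2) = 0"
proof -
  have cA: "c_const e a A = c" by (simp add: c_const_def c_def F_poly_def A)
  have wk: "w \<in> k" using w by (simp add: perp_def)
  have "poly (a_poly p (p ^ n) A) t = 0 \<longleftrightarrow> t \<in> U" for t
    using finite_k unfolding q[symmetric] a_poly_eq[OF A] by (simp add: poly_prod)
  moreover have "Tr ((c * w) * t) = 0" if "t \<in> U" for t
    using w that by (auto simp: perp_def B_def mult.assoc)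
  moreover have "c * w \<in> Fq (p ^ n)" using subring_set_mult[OF k_ring c_k wk] by (simp add: q)
  ultimately have "Tr (inverse c * (c * w)\<^sup>2) = 0"
    using star unfolding condition_star_def cA by blast
  moreover have "inverse c * (c * w)\<^sup>2 = c * w\<^sup>2" using c_nonzero by (simp add: power2_eq_square)
  ultimately show ?thesis by simp
qed

text \<open>\<open>zeros_isotropic\<close> is applied to the complement of \<open>U\<close>, whose
  own complement is \<open>U\<close> again. Terms are moved across so that no subtraction of
  naturals occurs.\<close>

lemma card_affine_points_star:
  assumes "fst ` A = W" "condition_star p n e a A"
  shows "card {(u, v). u \<in> k \<and> v \<in> k \<and> v ^ p - v = u * R u} + p ^ e * q = p ^ e * (p * zeros c k) + q"
proof -
  have "p * zeros c k + card U = p * zeros c U + q"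
    using zeros_isotropic[OF c_k subspace_perp_B[of c U] perp_B_k condition_star_isotropic[OF assms]]
    by (simp add: double_perp[OF c_k c_nonzero subspace_U U_k])
  then have "p ^ e * (p * zeros c k + card U) = p ^ e * (p * zeros c U + q)" by simp
  then show ?thesis unfolding card_affine_points using card_U by (simp add: distrib_left)
qed

end

text \<open>Evaluates the sign \<open>(-1) ^ ((s + 1) div 2)\<close> at \<open>s = p0 ^ l\<close>,
  where \<open>l\<close> will be \<open>f0 div 2\<close>.\<close>

lemma sign_half_1_mod_4:
  "p0 mod 4 = 1 \<Longrightarrow> (- 1) ^ (Suc (p0 ^ l) div 2) = (- 1 :: 'a::comm_ring_1)"
  for p0 :: nat
proof -
  assume "p0 mod 4 = 1"
  then have "p0 ^ l mod 4 = 1" using power_mod[of p0 4 l] by simp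
  then have "odd (Suc (p0 ^ l) div 2)" by presburger
  then show ?thesis by simp
qed

lemma sign_half_3_mod_4:
  "p0 mod 4 = 3 \<Longrightarrow> (- 1) ^ (Suc (p0 ^ l) div 2) = (- ((- 1) ^ l) :: 'a::comm_ring_1)"
  for p0 :: nat
proof -
  assume p0: "p0 mod 4 = 3"
  have *: "p0 ^ l mod 4 = (if even l then 1 else 3)"
  proof (induction l)
    case (Suc l)
    have "p0 ^ Suc l mod 4 = (p0 mod 4) * (p0 ^ l mod 4) mod 4" by (simp add: mod_mult_eq)
    then show ?case by (simp add: p0 Suc.IH)
  qed simp
  show ?thesis
  proof (cases "even l")
    case True
    then have "p0 ^ l mod 4 = 1" using * by simp
    then have "odd (Suc (p0 ^ l) div 2)" by presburger
    then show ?thesis using True by simp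
  next
    case False
    then have "p0 ^ l mod 4 = 3" using * by simp
    then have "even (Suc (p0 ^ l) div 2)" by presburger
    then show ?thesis using False by simp
  qed
qed

context rational_lagrangian
begin

text \<open>The factor 2 disappears only in even degree: as an element of \<open>Fp\<close> it
  satisfies \<open>2 ^ (s - 1) = 1\<close>, and \<open>s - 1\<close> divides half of
  \<open>q - 1\<close>.\<close>

lemma \<eta>_c:
  assumes n_eq: "n = 2 * h"
  shows "\<eta> c = \<eta> (a e)"
proof -
  obtain t where t: "t \<in> k" "t \<noteq> 0" "c = a e / (2 * t\<^sup>2)" using c_eq by blast
  define s where "s = p ^ h"
  have s: "odd s" "q = s * s" using odd_p by (simp_all add: s_def q n_eq mult_2 power_add)
  have "0 < h" using n n_eq by simp
  then have s1: "1 < s" unfolding s_def by (rule one_less_power[OF p_gt_1])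
  obtain j where j: "s = 2 * j + 1" using s(1) by (elim oddE)
  have e1: "(q - 1) div 2 = (s - 1) * (j + 1)" by (simp add: s(2) j algebra_simps)
  have "(2 :: 'a) \<in> Fp"
    using subring_set_add[OF Fp_ring subring_set_one[OF Fp_ring] subring_set_one[OF Fp_ring]] by simp
  then have "(2 :: 'a) ^ s = 2" unfolding s_def by (rule Fp_pow)
  then have "(2 :: 'a) ^ (s - 1) = 1" using power_Suc[of "2 :: 'a" "s - 1"] s1 two_nonzero by simp
  then have "\<eta> 2 = 1" unfolding quad_symbol_def e1 power_mult by simp
  moreover have "\<eta> (t\<^sup>2) = 1"
    using \<eta>_square[of t] mem_k_iff[of t] t by (simp add: quad_symbol_def mult.commute flip: power_mult)
  moreover have "\<eta> (c * (2 * t\<^sup>2)) = \<eta> (a e)" using t(2,3) two_nonzero by simp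
  ultimately show ?thesis unfolding \<eta>_mult by simp
qed

lemma card_curve_points_star:
  assumes "fst ` A = W" "condition_star p n e a A"
  shows "card (curve_points q p e a) + p ^ e * q = p ^ e * (p * zeros c k) + q + 1"
proof -
  have "card (curve_points q p e a) = Suc (card {(u, v). u \<in> k \<and> v \<in> k \<and> v ^ p - v = u * R u})"
    by (rule card_curve_points[where m = m and f = "m * n"])
      (use char p m finite_k e a_k a_e in \<open>auto simp: q p power_mult\<close>)
  then show ?thesis using card_affine_points_star[OF assms] by simp
qed

lemma curve_even_degree:
  assumes A: "fst ` A = W" "condition_star p n e a A" and n_eq: "n = 2 * h"
  shows "\<eta> (a e) = (- 1) ^ ((p ^ h + 1) div 2) \<Longrightarrow> curve_maximal q p e a"
    and "\<eta> (a e) = - ((- 1) ^ ((p ^ h + 1) div 2)) \<Longrightarrow> curve_minimal q p e a"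
proof -
  define s where "s = p ^ h"
  have qs: "q = s * s" by (simp add: s_def q n_eq mult_2 power_add)
  have sq: "sqrt (real q) = real s" by (simp add: qs)
  let ?N = "card (curve_points q p e a)"
  from arg_cong[OF card_curve_points_star[OF A], of real]
  have N: "real ?N = real p ^ e * (real p * real (zeros c k) - real q) + real q + 1"
    by (simp add: algebra_simps)
  note zeros = zeros_even_degree[OF n_eq s_def c_k c_nonzero, unfolded \<eta>_c[OF n_eq] s_def[symmetric]]
  show "curve_maximal q p e a" if "\<eta> (a e) = (- 1) ^ ((p ^ h + 1) div 2)"
  proof -
    from arg_cong[OF zeros(1)[OF that[folded s_def]], of real]
    \<comment> \<open>Multiplied by \<open>p ^ e\<close>, the right side is twice the genus times
      the square root of \<open>q\<close>.\<close>
    have D: "real p * real (zeros c k) - real q = (real p - 1) * real s" by (simp add: algebra_simps)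
    then show ?thesis unfolding curve_maximal_def curve_genus_def sq N D by (simp add: field_simps)
  qed
  show "curve_minimal q p e a" if "\<eta> (a e) = - ((- 1) ^ ((p ^ h + 1) div 2))"
  proof -
    from arg_cong[OF zeros(2)[OF that[folded s_def]], of real]
    have D: "real p * real (zeros c k) - real q = - ((real p - 1) * real s)" by (simp add: algebra_simps)
    then show ?thesis unfolding curve_minimal_def curve_genus_def sq N D by (simp add: field_simps)
  qed
qed

lemma curve_odd_degree:
  assumes A: "fst ` A = W" "condition_star p n e a A" and "odd n"
  shows "\<not> curve_maximal q p e a" "\<not> curve_minimal q p e a"
proof -
  have "card (curve_points q p e a) = q + 1"
    using card_curve_points_star[OF A] by (simp add: zeros_odd_degree[OF c_k c_nonzero assms(3)])
  moreover have "curve_genus p e * sqrt (real q) \<noteq> 0"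
    using p_gt_1 q_gt_1 by (simp add: curve_genus_def)
  ultimately show "\<not> curve_maximal q p e a" "\<not> curve_minimal q p e a"
    by (simp_all add: curve_maximal_def curve_minimal_def)
qed

end

theorem theorem4p11:
  fixes p0 p q m n f0 e :: nat
    and a :: "nat \<Rightarrow> 'a::alg_closed_field"
    and A :: "('a \<times> 'a) set"
  assumes "prime p0" and "odd p0"
    and "algebraic_closure_of_prime_field TYPE('a) p0"
    and "m \<ge> 1" and "p = p0 ^ m"
    and "n \<ge> 1" and "q = p ^ n" and "q = p0 ^ f0"
    and "e \<ge> 1" and "\<forall>i\<le>e. a i \<in> Fq q" and "a e \<noteq> 0"
    and "maximal_abelian_subgroup A (Heisenberg p e a)"
    and "A \<subseteq> Fq q \<times> Fq q"
    and "condition_star p n e a A"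
  shows "(even n \<and> p0 mod 4 = 1 \<longrightarrow>
            (quad_symbol (a e) q = -1 \<longrightarrow> curve_maximal q p e a) \<and>
            (quad_symbol (a e) q = 1 \<longrightarrow> curve_minimal q p e a)) \<and>
         (even n \<and> p0 mod 4 = 3 \<longrightarrow>
            (quad_symbol (a e) q = - ((-1) ^ (f0 div 2)) \<longrightarrow> curve_maximal q p e a) \<and>
            (quad_symbol (a e) q = (-1) ^ (f0 div 2) \<longrightarrow> curve_minimal q p e a)) \<and>
         (odd n \<longrightarrow> \<not> curve_maximal q p e a \<and> \<not> curve_minimal q p e a)"
proof -
  have char: "CHAR('a) = p0" using assms(3) by (simp add: algebraic_closure_of_prime_field_def)
  interpret heisenberg p m "TYPE('a)" e a
    by unfold_locales (use assms char in auto)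
  interpret rational_lagrangian p m "TYPE('a)" e a "fst ` A" n q
  proof unfold_locales
    show "fst ` A = perp D (V_set p e a) (fst ` A)" by (rule maximal_abelian_image(1)[OF assms(12)])
  qed (use assms in auto)
  \<comment> \<open>Comparing exponents identifies \<open>s = p ^ (n div 2)\<close> with
    \<open>p0 ^ (f0 div 2)\<close>, the form in which the sign lemmas apply.\<close>
  have "p0 ^ f0 = p0 ^ (m * n)" using assms by (simp add: power_mult)
  then have f0: "f0 = m * n" using prime_gt_1_nat[OF assms(1)] by simp
  have even: "p ^ (n div 2) = p0 ^ (f0 div 2)" "n = 2 * (n div 2)" if "even n"
    using that by (auto simp: assms(5) f0 simp flip: power_mult)
  note curve_even = curve_even_degree[OF refl assms(14) even(2)]
  show ?thesis
  proof (intro conjI impI)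
    assume *: "even n \<and> p0 mod 4 = 1"
    show "curve_maximal q p e a" if "quad_symbol (a e) q = -1"
      using * that by (intro curve_even(1)) (auto simp: sign_half_1_mod_4 even(1))
    show "curve_minimal q p e a" if "quad_symbol (a e) q = 1"
      using * that by (intro curve_even(2)) (auto simp: sign_half_1_mod_4 even(1))
  next
    assume *: "even n \<and> p0 mod 4 = 3"
    show "curve_maximal q p e a" if "quad_symbol (a e) q = - ((-1) ^ (f0 div 2))"
      using * that by (intro curve_even(1)) (auto simp: sign_half_3_mod_4 even(1))
    show "curve_minimal q p e a" if "quad_symbol (a e) q = (-1) ^ (f0 div 2)"
      using * that by (intro curve_even(2)) (auto simp: sign_half_3_mod_4 even(1))
  next
    assume "odd n"
    then show "\<not> curve_maximal q p e a" "\<not> curve_minimal q p e a"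
      using curve_odd_degree[OF refl assms(14)] by auto
  qed
qed

end
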